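(* Let $W=W(\sigma)$ be a family of integer-valued random variables with $\mathrm{Var}\,W=\sigma^2$, such that for some $\sigma$-algebra $\mathcal{F}$, \[ W=Y+\sum_{i=1}^N Z_i, \] where $N$ is $\mathcal{F}$-measurable, $Y,Z_1,Z_2,\dots$ are integer-valued, and conditional on $\mathcal{F}$ the variables $Y,Z_1,\dots,Z_N$ are mutually independent. Assume there are constants $u$ and $\beta$, not depending on $\sigma$, such that, conditional on $\mathcal{F}$, $0<u\le 1-\tfrac12 D_1(Z_i)$ for all $1\le i\le N$ (where $D_1(Z_i)$ is computed for the conditional law of $Z_i$ given $\mathcal{F}$), and such that \[ \mathbb{P}[N<\beta\sigma^2]=O(\sigma^{-k})\quad\text{as }\sigma\to\infty \] for some $k\ge 2$. Let $\tilde W=(W-\mathbb{E}W)/\sigma$ and let $\Phi$ denote the standard normal distribution. Then, as $\sigma\to\infty$, \[ d_{\mathrm{loc}}\bigl(\mathcal{L}(W),\mathrm{TP}(\mathbb{E}W,\sigma^2)\bigr)=O\Bigl(\frac{d_{\mathrm{K}}(\mathcal{L}(\tilde W),\Phi)^{1-1/k}}{\sigma}\Bigr) \] and \[ d_{\mathrm{loc}}\bigl(\mathcal{L}(W),\mathrm{TP}(\mathbb{E}W,\sigma^2)\bigr)=O\Bigl(\frac{d_{\mathrm{W}}(\mathcal{L}(\tilde W),\Phi)^{1-2/(k+1)}}{\sigma}\Bigr). \] Moreover, if all the previous hypotheses hold except that the tail condition on $N$ holds for some $k\ge 1$, then as $\sigma\to\infty$, \[ d_{\mathrm{TV}}\bigl(\mathcal{L}(W),\mathrm{TP}(\mathbb{E}W,\sigma^2)\bigr)=O\bigl(d_{\mathrm{W}}(\mathcal{L}(\tilde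 W),\Phi)^{k/(k+1)}\bigr). \]
   Context: For $f:\mathbb{Z}\to\mathbb{R}$, $\|f\|_1=\sum_i|f(i)|$, $\|f\|_\infty=\sup_i|f(i)|$; $\Delta^0 f=f$, $\Delta^{n+1}f(k)=\Delta^nf(k+1)-\Delta^nf(k)$, $\Delta=\Delta^1$. For an integer-valued random variable $X$ with distribution function $F(j)=\mathbb{P}[X\le j]$, $D_1(X)=D_1(\mathcal{L}(X)):=\|\Delta^2F\|_1$. For integer-supported laws with distribution functions $F,G$: $d_{\mathrm{loc}}=\|\Delta F-\Delta G\|_\infty$, $d_{\mathrm{TV}}=\frac12\|\Delta F-\Delta G\|_1$. For general real distributions with distribution functions $F,G$: $d_{\mathrm{K}}=\sup_{x\in\mathbb{R}}|F(x)-G(x)|$, $d_{\mathrm{W}}=\int_{\mathbb{R}}|F(x)-G(x)|\,dx$. Translated Poisson: for $\mu\in\mathbb{R}$, $\sigma^2>0$, $Z\sim\mathrm{TP}(\mu,\sigma^2)$ means $Z-\lfloor\mu-\sigma^2\rfloor\sim\mathrm{Po}(\sigma^2+\gamma)$ with $\gamma=\mu-\sigma^2-\lfloor\mu-\sigma^2\rfloor$.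
   Formalization: The constant β is required to be positive; for β ≤ 0 the tail condition on N is vacuous and the claim fails, e.g. N = 0 and W = Y = 2·Bin(n,1/2), where the local distance is of order 1/σ. *)

theory Defs
  imports "HOL-Probability.Probability" "HOL-Library.Landau_Symbols"
begin

definition fdiff :: "(int \<Rightarrow> real) \<Rightarrow> int \<Rightarrow> real" where
  "fdiff f k = f (k + 1) - f k"

text \<open>D_1 of a law given by its distribution function F: the 1-norm of the second difference.\<close>
definition D1_df :: "(int \<Rightarrow> real) \<Rightarrow> real" where
  "D1_df F = (\<Sum>\<^sub>\<infinity> j\<in>(UNIV::int set). \<bar>fdiff (fdiff F) j\<bar>)"

definition dloc_df :: "(int \<Rightarrow> real) \<Rightarrow> (int \<Rightarrow> real) \<Rightarrow> real" where
  "dloc_df F G = (SUP j\<in>(UNIV::int set). \<bar>fdiff F j - fdiff G j\<bar>)"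

definition dTV_df :: "(int \<Rightarrow> real) \<Rightarrow> (int \<Rightarrow> real) \<Rightarrow> real" where
  "dTV_df F G = (\<Sum>\<^sub>\<infinity> j\<in>(UNIV::int set). \<bar>fdiff F j - fdiff G j\<bar>) / 2"

definition dK_df :: "(real \<Rightarrow> real) \<Rightarrow> (real \<Rightarrow> real) \<Rightarrow> real" where
  "dK_df F G = (SUP x\<in>(UNIV::real set). \<bar>F x - G x\<bar>)"

definition dW_df :: "(real \<Rightarrow> real) \<Rightarrow> (real \<Rightarrow> real) \<Rightarrow> real" where
  "dW_df F G = (\<integral>x. \<bar>F x - G x\<bar> \<partial>lborel)"

definition TP_pmf :: "real \<Rightarrow> real \<Rightarrow> int pmf" where
  "TP_pmf mu s2 =
     (let gam = mu - s2 - of_int \<lfloor>mu - s2\<rfloor>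
      in map_pmf (\<lambda>n. int n + \<lfloor>mu - s2\<rfloor>) (poisson_pmf (s2 + gam)))"

definition TP_df :: "real \<Rightarrow> real \<Rightarrow> int \<Rightarrow> real" where
  "TP_df mu s2 j = measure_pmf.prob (TP_pmf mu s2) {..j}"

definition int_df :: "'a measure \<Rightarrow> ('a \<Rightarrow> int) \<Rightarrow> int \<Rightarrow> real" where
  "int_df M X j = measure M {\<omega> \<in> space M. X \<omega> \<le> j}"

definition real_df :: "'a measure \<Rightarrow> ('a \<Rightarrow> real) \<Rightarrow> real \<Rightarrow> real" where
  "real_df M X x = measure M {\<omega> \<in> space M. X \<omega> \<le> x}"

definition Phi :: "real \<Rightarrow> real" where
  "Phi x = measure (density lborel std_normal_density) {..x}"

definition cond_df :: "'a measure \<Rightarrow> 'a measure \<Rightarrow> ('a \<Rightarrow> int) \<Rightarrow> 'a \<Rightarrow> int \<Rightarrow> real" where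
  "cond_df M F X \<omega> j = real_cond_exp M F (indicator {\<omega> \<in> space M. X \<omega> \<le> j}) \<omega>"

text \<open>X 0, ..., X n are mutually independent conditional on F, on the event E (E in F).\<close>
definition cond_indep_on :: "'a measure \<Rightarrow> 'a measure \<Rightarrow> 'a set \<Rightarrow> (nat \<Rightarrow> 'a \<Rightarrow> int) \<Rightarrow> nat \<Rightarrow> bool" where
  "cond_indep_on M F E X n \<longleftrightarrow>
     (\<forall>A :: nat \<Rightarrow> int set. AE \<omega> in M. \<omega> \<in> E \<longrightarrow>
        real_cond_exp M F (\<lambda>\<omega>. \<Prod>i\<le>n. indicator (A i) (X i \<omega>)) \<omega>
        = (\<Prod>i\<le>n. real_cond_exp M F (\<lambda>\<omega>. indicator (A i) (X i \<omega>)) \<omega>))"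

end

theory Submission
  imports Defs
begin

text \<open>
  Let \<open>f\<close> be the difference of the distribution functions of \<open>W\<close> and of the translated Poisson law.
  Averaging over windows of length \<open>m\<close> replaces \<open>\<Delta>f\<close> by a difference quotient of \<open>f\<close>, which is small
  because \<open>f\<close> is controlled by \<open>d\<^sub>K\<close> or \<open>d\<^sub>W\<close>; by using the operator \<open>1 - (1 - A\<^sup>2)\<^sup>r\<close> instead of the plain
  average \<open>A\<close>, the error made is at most of order \<open>m\<^sup>r\<close> times the norm of \<open>\<Delta>\<^sup>r\<Delta>f\<close>. Optimising \<open>m\<close> gives the rates.
  The event \<open>N < \<beta>\<sigma>\<^sup>2\<close> contributes \<open>O(\<sigma>\<^sup>-\<^sup>k)\<close> additively, so \<open>k\<close> need not be an integer. On its
  complement, each \<open>Z\<^sub>i\<close> is a mixture which contains, with weight \<open>u\<close>, a fair coin as an independent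
  summand, and differences of symmetric binomial laws are small by the Cauchy--Schwarz inequality;
  the Poisson law is handled in the same way, being infinitely divisible.
  Passing from the translated Poisson law to \<open>\<Phi>\<close> costs \<open>O(1 / \<sigma>)\<close> in both metrics by Stein's method,
  and this is harmless since any law on a lattice of span \<open>1 / \<sigma>\<close> is at least that far from \<open>\<Phi>\<close>.
\<close>

section \<open>Bounds for sums of absolute values over finite sets of integers\<close>

text \<open>With \<open>D\<close> the given distance and \<open>m\<close> the window length, three
  errors compete: \<open>(m / \<sigma>)^r\<close> from the smooth part,
  \<open>D * (\<sigma> / m)^e\<close> from the difference of distribution functions, and
  \<open>\<sigma> powr (- s)\<close> from the exceptional event (local distances being multiplied by
  \<open>\<sigma>\<close>). Balancing the first two at
  \<open>m = \<sigma> * D powr (1 / (r + e))\<close> yields the exponent \<open>r / (r + e)\<close>.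
  Here \<open>e = 1\<close> from Kolmogorov to local and from Wasserstein to total variation, but
  \<open>e = 2\<close> from Wasserstein to local, because a second window is spent on passing from
  the 1-norm to the supremum; this is why the smoothing is built from \<open>A^2\<close>. The third
  error is at most a constant times \<open>D powr s\<close>, since \<open>D\<close> is at least of
  order \<open>1 / \<sigma>\<close>; \<open>s = k - 1\<close> locally and \<open>s = k\<close> in
  total variation. The same lower bound keeps the balanced window from being much shorter than one
  lattice step. Any integer \<open>r \<ge> k\<close> makes all exponents at least the claimed
  ones.\<close>

text \<open>For \<open>n = 1\<close> this bounds the supremum norm, and for all \<open>n\<close> together the 1-norm; keeping \<open>n\<close> free
  gives both versions of the estimates below at once.\<close>
definition l1bnd :: "nat \<Rightarrow> real \<Rightarrow> (int \<Rightarrow> real) \<Rightarrow> bool" where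
  "l1bnd n c g \<longleftrightarrow> (\<forall>A. finite A \<and> card A \<le> n \<longrightarrow> (\<Sum>j\<in>A. \<bar>g j\<bar>) \<le> c)"

lemma l1bndD: "l1bnd n c g \<Longrightarrow> finite A \<Longrightarrow> card A \<le> n \<Longrightarrow> (\<Sum>j\<in>A. \<bar>g j\<bar>) \<le> c"
  by (auto simp: l1bnd_def)

lemma l1bnd_nonneg: "l1bnd n c g \<Longrightarrow> 0 \<le> c"
  using l1bndD[of n c g "{}"] by simp

lemma l1bnd_mono: "l1bnd n c g \<Longrightarrow> c \<le> d \<Longrightarrow> l1bnd n d g"
  unfolding l1bnd_def by (meson order_trans)

lemma l1bnd_pointwise: "l1bnd n c g \<Longrightarrow> 1 \<le> n \<Longrightarrow> \<bar>g j\<bar> \<le> c"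
  using l1bndD[of n c g "{j}"] by simp

lemma l1bnd_1I: "0 \<le> c \<Longrightarrow> (\<And>j. \<bar>g j\<bar> \<le> c) \<Longrightarrow> l1bnd 1 c g"
  unfolding l1bnd_def
proof (intro allI impI)
  fix A :: "int set" assume c: "0 \<le> c" "\<And>j. \<bar>g j\<bar> \<le> c" and A: "finite A \<and> card A \<le> 1"
  have "(\<Sum>j\<in>A. \<bar>g j\<bar>) \<le> of_nat (card A) * c" by (rule sum_bounded_above) (rule c)
  also have "\<dots> \<le> 1 * c" using A c by (intro mult_right_mono) auto
  finally show "(\<Sum>j\<in>A. \<bar>g j\<bar>) \<le> c" by simp
qed

lemma l1bnd_add: "l1bnd n c g \<Longrightarrow> l1bnd n d h \<Longrightarrow> l1bnd n (c + d) (\<lambda>j. g j + h j)"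
  unfolding l1bnd_def
proof (intro allI impI)
  fix A :: "int set"
  assume *: "\<forall>A. finite A \<and> card A \<le> n \<longrightarrow> (\<Sum>j\<in>A. \<bar>g j\<bar>) \<le> c"
    "\<forall>A. finite A \<and> card A \<le> n \<longrightarrow> (\<Sum>j\<in>A. \<bar>h j\<bar>) \<le> d" "finite A \<and> card A \<le> n"
  have "(\<Sum>j\<in>A. \<bar>g j + h j\<bar>) \<le> (\<Sum>j\<in>A. \<bar>g j\<bar> + \<bar>h j\<bar>)" by (intro sum_mono) auto
  also have "\<dots> \<le> c + d" unfolding sum.distrib using * by (intro add_mono) auto
  finally show "(\<Sum>j\<in>A. \<bar>g j + h j\<bar>) \<le> c + d" .
qed

lemma l1bnd_scale: "l1bnd n c g \<Longrightarrow> l1bnd n (\<bar>r\<bar> * c) (\<lambda>j. r * g j)"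
  unfolding l1bnd_def abs_mult sum_distrib_left[symmetric] by (meson abs_ge_zero mult_left_mono)

lemma l1bnd_minus: "l1bnd n c g \<Longrightarrow> l1bnd n c (\<lambda>j. - g j)"
  by (auto simp: l1bnd_def)

lemma l1bnd_diff: "l1bnd n c g \<Longrightarrow> l1bnd n d h \<Longrightarrow> l1bnd n (c + d) (\<lambda>j. g j - h j)"
  using l1bnd_add[OF _ l1bnd_minus, of n c g d h] by simp

lemma l1bnd_zero: "l1bnd n 0 (\<lambda>j. 0)"
  by (auto simp: l1bnd_def)

lemma l1bnd_sum:
  "finite I \<Longrightarrow> (\<And>i. i \<in> I \<Longrightarrow> l1bnd n (c i) (g i)) \<Longrightarrow> l1bnd n (\<Sum>i\<in>I. c i) (\<lambda>j. \<Sum>i\<in>I. g i j)"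
  by (induction I rule: finite_induct) (auto intro: l1bnd_zero l1bnd_add)

lemma l1bnd_shift: "l1bnd n c g \<Longrightarrow> l1bnd n c (\<lambda>j. g (j + i))"
  unfolding l1bnd_def
proof (intro allI impI)
  fix A :: "int set"
  assume *: "\<forall>A. finite A \<and> card A \<le> n \<longrightarrow> (\<Sum>j\<in>A. \<bar>g j\<bar>) \<le> c" "finite A \<and> card A \<le> n"
  have inj: "inj_on (\<lambda>j. j + i) A" by auto
  have "(\<Sum>j\<in>A. \<bar>g (j + i)\<bar>) = (\<Sum>j\<in>(\<lambda>j. j + i) ` A. \<bar>g j\<bar>)"
    by (subst sum.reindex[OF inj]) auto
  also have "\<dots> \<le> c" using * by (intro *(1)[rule_format]) (auto simp: card_image)
  finally show "(\<Sum>j\<in>A. \<bar>g (j + i)\<bar>) \<le> c" .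
qed

lemma l1bnd_fdiff: "l1bnd n c g \<Longrightarrow> l1bnd n (2 * c) (fdiff g)"
  using l1bnd_diff[OF l1bnd_shift[of n c g 1], of c g] by (simp add: fdiff_def[abs_def])

lemma summable_if_l1bnd: "(\<And>n. l1bnd n c g) \<Longrightarrow> (\<lambda>j. \<bar>g j\<bar>) summable_on UNIV"
  by (rule nonneg_bdd_above_summable_on) (auto intro!: bdd_aboveI[of _ c] dest: l1bndD)

lemma infsum_le_if_l1bnd: "(\<And>n. l1bnd n c g) \<Longrightarrow> (\<Sum>\<^sub>\<infinity>j\<in>UNIV. \<bar>g j\<bar>) \<le> c"
  by (rule infsum_le_finite_sums) (use summable_if_l1bnd[of c g] in \<open>auto dest: l1bndD\<close>)

lemma l1bnd_if_has_sum:
  assumes "((\<lambda>j. \<bar>g j\<bar>) has_sum c) UNIV" shows "l1bnd n c g"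
  unfolding l1bnd_def
proof (intro allI impI)
  fix A :: "int set" assume A: "finite A \<and> card A \<le> n"
  show "(\<Sum>j\<in>A. \<bar>g j\<bar>) \<le> c"
    by (rule has_sum_mono_neutral[OF has_sum_finite assms]) (use A in auto)
qed

text \<open>If \<open>\<bar>g j\<bar> = d + e\<close> with \<open>e > 0\<close>, telescoping keeps
  \<open>\<bar>g\<bar> \<ge> e\<close> on all of \<open>j, j + 1, ...\<close>, and the 1-norm of
  \<open>g\<close> is infinite. In this way the local estimates gain their extra factor
  \<open>1 / \<sigma>\<close>: the supremum of one difference is bounded by the 1-norm of the
  next.\<close>

lemma l1bnd_sup_le_fdiff:
  assumes "\<And>n. l1bnd n c g" and "\<And>n. l1bnd n d (fdiff g)"
  shows "l1bnd 1 d g"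
proof (rule l1bnd_1I)
  show "0 \<le> d" using assms(2) l1bnd_nonneg by blast
  fix j
  show "\<bar>g j\<bar> \<le> d"
  proof (rule ccontr)
    assume "\<not> \<bar>g j\<bar> \<le> d"
    define e where "e = \<bar>g j\<bar> - d"
    have e: "e > 0" using \<open>\<not> \<bar>g j\<bar> \<le> d\<close> by (simp add: e_def)
    have tel: "g (j + int i) - g j = (\<Sum>l<i. fdiff g (j + int l))" for i
      by (induction i) (auto simp: fdiff_def algebra_simps)
    have lb: "e \<le> \<bar>g (j + int i)\<bar>" for i
    proof -
      have "\<bar>\<Sum>l<i. fdiff g (j + int l)\<bar> \<le> (\<Sum>l<i. \<bar>fdiff g (j + int l)\<bar>)" by (rule sum_abs)
      also have "\<dots> = (\<Sum>x\<in>(\<lambda>l. j + int l) ` {..<i}. \<bar>fdiff g x\<bar>)"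
        by (subst sum.reindex) (auto simp: inj_on_def)
      also have "\<dots> \<le> d" by (rule l1bndD[OF assms(2)[of i]]) (auto intro: order_trans[OF card_image_le])
      finally show ?thesis using tel[of i] by (auto simp: e_def)
    qed
    obtain i :: nat where i: "c < real i * e" using e reals_Archimedean3 by blast
    have "real i * e \<le> (\<Sum>l<i. \<bar>g (j + int l)\<bar>)"
      using sum_bounded_below[of "{..<i}" e "\<lambda>l. \<bar>g (j + int l)\<bar>"] lb by simp
    also have "\<dots> = (\<Sum>x\<in>(\<lambda>l. j + int l) ` {..<i}. \<bar>g x\<bar>)"
      by (subst sum.reindex) (auto simp: inj_on_def)
    also have "\<dots> \<le> c" by (rule l1bndD[OF assms(1)[of i]]) (auto intro: order_trans[OF card_image_le])
    finally show False using i by simp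
  qed
qed

section \<open>Window averages and the smoothing operator\<close>

definition avg :: "nat \<Rightarrow> (int \<Rightarrow> real) \<Rightarrow> int \<Rightarrow> real" where
  "avg m g j = (\<Sum>i<m. g (j + int i)) / real m"

lemma avg_diff: "avg m (\<lambda>j. g j - h j) = (\<lambda>j. avg m g j - avg m h j)"
  by (auto simp: avg_def sum_subtractf diff_divide_distrib)

lemma avg_add: "avg m (\<lambda>j. g j + h j) = (\<lambda>j. avg m g j + avg m h j)"
  by (auto simp: avg_def sum.distrib add_divide_distrib)

lemma avg_shift: "avg m (\<lambda>j. g (j + a)) = (\<lambda>j. avg m g (j + a))"
  by (auto simp: avg_def ac_simps)

lemma fdiff_avg: "fdiff (avg m g) = avg m (fdiff g)"
  unfolding fdiff_def[abs_def] avg_diff avg_shift ..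

lemma l1bnd_avg:
  assumes "l1bnd n c g" shows "l1bnd n c (avg m g)"
proof (cases "m = 0")
  case True
  then show ?thesis using l1bnd_nonneg[OF assms] l1bnd_mono[OF l1bnd_zero, of c n] by (auto simp: avg_def[abs_def])
next
  case False
  have "l1bnd n (\<Sum>i<m. c) (\<lambda>j. \<Sum>i<m. g (j + int i))"
    by (intro l1bnd_sum l1bnd_shift assms) auto
  from l1bnd_scale[OF this, of "1 / m"] show ?thesis
    using False by (simp add: avg_def[abs_def])
qed

text \<open>\<open>g - A g\<close> is an average of sums of fewer than \<open>m\<close> consecutive
  first differences of \<open>g\<close>, that is, of translates of \<open>fdiff g\<close>.\<close>

lemma l1bnd_minus_avg:
  assumes "l1bnd n d (fdiff g)" and m: "m > 0"
  shows "l1bnd n (real m * d) (\<lambda>j. g j - avg m g j)"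
proof -
  have d: "0 \<le> d" using assms l1bnd_nonneg by blast
  have tel: "g (j + int i) - g j = (\<Sum>l<i. fdiff g (j + int l))" for i j
    by (induction i) (auto simp: fdiff_def algebra_simps)
  have *: "l1bnd n (real m * d) (\<lambda>j. g (j + int i) - g j)" if "i < m" for i
  proof -
    have "l1bnd n (\<Sum>l<i. d) (\<lambda>j. \<Sum>l<i. fdiff g (j + int l))"
      by (intro l1bnd_sum l1bnd_shift assms) auto
    then show ?thesis unfolding tel
      by (rule l1bnd_mono) (use that d in \<open>auto intro!: mult_right_mono\<close>)
  qed
  have "l1bnd n (\<Sum>i<m. real m * d) (\<lambda>j. \<Sum>i<m. g (j + int i) - g j)"
    by (intro l1bnd_sum *) auto
  from l1bnd_scale[OF this, of "- 1 / m"]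
  have "l1bnd n (real m * d) (\<lambda>j. (- 1 / real m) * (\<Sum>i<m. g (j + int i) - g j))"
    using m by simp
  moreover have "(- 1 / real m) * (\<Sum>i<m. g (j + int i) - g j) = g j - avg m g j" for j
    using m by (simp add: avg_def sum_subtractf field_simps)
  ultimately show ?thesis by simp
qed

text \<open>The sum telescopes: after one averaging, a difference involves \<open>f\<close> at two
  points only, and \<open>1 / m\<close> is gained from the mere size of \<open>f\<close>.\<close>

lemma fdiff_avg_eq: "fdiff (avg m f) j = (f (j + int m) - f j) / real m"
proof -
  have "(\<Sum>i<m. f (j + 1 + int i)) - (\<Sum>i<m. f (j + int i)) = f (j + int m) - f j"
    by (induction m) (auto simp: algebra_simps)
  then show ?thesis by (simp add: fdiff_def avg_def flip: diff_divide_distrib)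
qed

lemma l1bnd_fdiff_avg:
  assumes "l1bnd n c f" shows "l1bnd n (2 * c / real m) (fdiff (avg m f))"
  using l1bnd_scale[OF l1bnd_diff[OF l1bnd_shift[OF assms, of "int m"] assms], of "1 / real m"]
  unfolding fdiff_avg_eq[abs_def] by simp

text \<open>A window meets \<open>m\<close> distinct points, so its sum stays below the 1-norm.
  Averaging thus trades the 1-norm for the supremum and gains another \<open>1 / m\<close>.\<close>

lemma l1bnd_avg_sup:
  assumes "\<And>n. l1bnd n c g" shows "l1bnd 1 (c / real m) (avg m g)"
proof (rule l1bnd_1I)
  show "0 \<le> c / real m" using assms l1bnd_nonneg by (intro divide_nonneg_nonneg) auto
  fix j
  have "\<bar>\<Sum>i<m. g (j + int i)\<bar> \<le> (\<Sum>i<m. \<bar>g (j + int i)\<bar>)" by (rule sum_abs)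
  also have "\<dots> = (\<Sum>x\<in>(\<lambda>l. j + int l) ` {..<m}. \<bar>g x\<bar>)"
    by (subst sum.reindex) (auto simp: inj_on_def)
  also have "\<dots> \<le> c" by (rule l1bndD[OF assms[of m]]) (auto intro: order_trans[OF card_image_le])
  finally show "\<bar>avg m g j\<bar> \<le> c / real m" by (auto simp: avg_def intro!: divide_right_mono)
qed

text \<open>The operator \<open>1 - A^2\<close>. One factor \<open>A\<close> is to absorb a
  difference (\<open>fdiff_avg_eq\<close>), the other is kept for the passage to the supremum
  (\<open>l1bnd_avg_sup\<close>).\<close>

definition residual :: "nat \<Rightarrow> (int \<Rightarrow> real) \<Rightarrow> int \<Rightarrow> real" where
  "residual m g j = g j - avg m (avg m g) j"

lemma residual_add: "residual m (\<lambda>j. g j + h j) = (\<lambda>j. residual m g j + residual m h j)"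
  unfolding residual_def[abs_def] avg_add by (auto simp: fun_eq_iff)

lemma fdiff_residual: "fdiff (residual m g) = residual m (fdiff g)"
proof -
  have "fdiff (residual m g) = (\<lambda>j. fdiff g j - fdiff (avg m (avg m g)) j)"
    by (auto simp: fdiff_def residual_def)
  then show ?thesis unfolding fdiff_avg by (simp add: residual_def[abs_def])
qed

lemma l1bnd_residual: "l1bnd n c g \<Longrightarrow> l1bnd n (2 * c) (residual m g)"
  using l1bnd_diff[OF _ l1bnd_avg[OF l1bnd_avg], of n c g c g m m] by (simp add: residual_def[abs_def])

lemma l1bnd_residual_fdiff:
  assumes "l1bnd n d (fdiff g)" and m: "m > 0"
  shows "l1bnd n (2 * real m * d) (residual m g)"
proof -
  have 1: "l1bnd n (real m * d) (\<lambda>j. g j - avg m g j)" by (rule l1bnd_minus_avg[OF assms])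
  \<comment> \<open>\<open>1 - A^2 = (1 - A) + A (1 - A)\<close>.\<close>
  from l1bnd_add[OF 1 l1bnd_avg[OF 1, of m]] show ?thesis
    unfolding avg_diff by (simp add: residual_def[abs_def] mult.commute mult.left_commute)
qed

lemma residual_pow_add: "(residual m ^^ r) (\<lambda>j. g j + h j) = (\<lambda>j. (residual m ^^ r) g j + (residual m ^^ r) h j)"
  by (induction r) (auto simp: residual_add)

lemma fdiff_residual_pow: "fdiff ((residual m ^^ r) g) = (residual m ^^ r) (fdiff g)"
  by (induction r) (auto simp: fdiff_residual)

lemma l1bnd_residual_pow: "l1bnd n c g \<Longrightarrow> l1bnd n (2 ^ r * c) ((residual m ^^ r) g)"
  by (induction r) (auto dest: l1bnd_residual simp: mult.assoc)

text \<open>Each application of \<open>1 - A^2\<close> uses up one difference and costs a factor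
  \<open>2 m\<close>; as it commutes with differencing, operators and differences can be paired off
  one by one.\<close>

lemma l1bnd_residual_pow_fdiff:
  "l1bnd n d ((fdiff ^^ r) g) \<Longrightarrow> m > 0 \<Longrightarrow> l1bnd n ((2 * real m) ^ r * d) ((residual m ^^ r) g)"
proof (induction r arbitrary: g)
  case (Suc r)
  have "l1bnd n d ((fdiff ^^ r) (fdiff g))" using Suc.prems by (simp only: funpow_Suc_right o_def)
  then have "l1bnd n ((2 * real m) ^ r * d) (fdiff ((residual m ^^ r) g))"
    unfolding fdiff_residual_pow using Suc by blast
  from l1bnd_residual_fdiff[OF this Suc.prems(2)] show ?case by (simp add: mult.assoc)
qed auto

text \<open>With \<open>B = A^2\<close> this is the geometric sum
  \<open>1 = (1 - B)^r + (\<Sum>i<r. (1 - B)^i B)\<close>: every term but the first has passed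
  through both averages.\<close>

lemma residual_pow_telescope: "g j = (residual m ^^ r) g j + (\<Sum>i<r. (residual m ^^ i) (avg m (avg m g)) j)"
proof (induction r arbitrary: j)
  case (Suc r)
  have comm: "(residual m ^^ i) (avg m (avg m g)) = avg m (avg m ((residual m ^^ i) g))" for i
  proof (induction i)
    case (Suc i)
    have "residual m (avg m (avg m h)) = avg m (avg m (residual m h))" for h
      unfolding residual_def[abs_def] avg_diff ..
    then show ?case by (simp add: Suc)
  qed auto
  have "(residual m ^^ Suc r) g j = (residual m ^^ r) g j - (residual m ^^ r) (avg m (avg m g)) j"
    by (simp add: comm residual_def[of m "(residual m ^^ r) g" j])
  then show ?case using Suc[of j] by simp
qed auto

text \<open>A discrete substitute for the Landau--Kolmogorov inequality, leaving the window m free: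
  smoothing by \<open>1 - (1 - avg\<^sup>2)\<^sup>r\<close> reproduces polynomials of degree below r.\<close>
lemma l1bnd_fdiff_interpolation:
  assumes m: "m > 0"
    and split: "\<And>j. fdiff f j = h j + p j"
    and h: "l1bnd n d ((fdiff ^^ r) h)" and p: "l1bnd n e p"
    and b: "l1bnd n b (fdiff (avg m (avg m f)))"
  shows "l1bnd n ((2 * real m) ^ r * d + 2 ^ r * e + 2 ^ r * b) (fdiff f)"
proof -
  have b0: "b \<ge> 0" using b l1bnd_nonneg by blast
  have "l1bnd n ((2 * real m) ^ r * d + 2 ^ r * e) ((residual m ^^ r) (fdiff f))"
    unfolding split[abs_def] residual_pow_add
    by (intro l1bnd_add l1bnd_residual_pow_fdiff h l1bnd_residual_pow p m)
  moreover have "l1bnd n (2 ^ r * b) (\<lambda>j. \<Sum>i<r. (residual m ^^ i) (avg m (avg m (fdiff f))) j)"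
  proof (rule l1bnd_mono)
    show "l1bnd n (\<Sum>i<r. 2 ^ i * b) (\<lambda>j. \<Sum>i<r. (residual m ^^ i) (avg m (avg m (fdiff f))) j)"
      using b unfolding fdiff_avg by (intro l1bnd_sum l1bnd_residual_pow) auto
    have "(\<Sum>i<r. 2 ^ i) = (2::real) ^ r - 1" by (induction r) auto
    then show "(\<Sum>i<r. 2 ^ i * b) \<le> 2 ^ r * b"
      using b0 by (simp add: sum_distrib_right[symmetric] mult_right_mono)
  qed
  ultimately have "l1bnd n ((2 * real m) ^ r * d + 2 ^ r * e + 2 ^ r * b)
     (\<lambda>j. (residual m ^^ r) (fdiff f) j + (\<Sum>i<r. (residual m ^^ i) (avg m (avg m (fdiff f))) j))"
    by (rule l1bnd_add)
  then show ?thesis unfolding residual_pow_telescope[of "fdiff f" _ r m, symmetric] .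
qed

section \<open>Convolution with a law on the integers\<close>

definition tconv :: "(int \<Rightarrow> real) \<Rightarrow> (int \<Rightarrow> real) \<Rightarrow> int \<Rightarrow> real" where
  "tconv q x j = (\<Sum>\<^sub>\<infinity>i\<in>UNIV. q i * x (j - i))"

lemma tconv_summable:
  assumes "\<And>i. 0 \<le> q i" "q summable_on UNIV" "l1bnd 1 c x"
  shows "(\<lambda>i. q i * x (j - i)) summable_on UNIV"
    and "(\<lambda>i. \<bar>q i * x (j - i)\<bar>) summable_on UNIV"
proof -
  have "(\<lambda>i. q i * c) summable_on UNIV" using assms(2) by (rule summable_on_cmult_left)
  then show 1: "(\<lambda>i. \<bar>q i * x (j - i)\<bar>) summable_on UNIV"
  proof (rule summable_on_comparison_test)
    fix i
    have "\<bar>x (j - i)\<bar> \<le> c" using l1bnd_pointwise[OF assms(3)] by simp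
    then show "\<bar>q i * x (j - i)\<bar> \<le> q i * c"
      using assms(1)[of i] by (simp add: abs_mult mult_left_mono)
  qed auto
  show "(\<lambda>i. q i * x (j - i)) summable_on UNIV"
    by (rule abs_summable_summable) (use 1 in \<open>simp only: real_norm_def\<close>)
qed

lemma has_sum_finite_sum:
  fixes f :: "'i \<Rightarrow> 'b \<Rightarrow> 'c :: topological_comm_monoid_add"
  assumes "finite I" "\<And>i. i \<in> I \<Longrightarrow> (f i has_sum s i) A"
  shows "((\<lambda>x. \<Sum>i\<in>I. f i x) has_sum (\<Sum>i\<in>I. s i)) A"
  using assms by (induction I rule: finite_induct) (auto intro: has_sum_add)

text \<open>Young's inequality. It holds for each \<open>n\<close> separately because a translate of
  \<open>A\<close> has as many elements as \<open>A\<close>. The mass is left general since the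
  remainder in the mixtures below has mass \<open>1 - u\<close>; \<open>1 \<le> n\<close> provides
  the pointwise bound that makes the convolution converge.\<close>

lemma l1bnd_tconv:
  assumes q: "\<And>i. 0 \<le> q i" "(q has_sum s) UNIV" and x: "l1bnd n c x" and n: "1 \<le> n"
  shows "l1bnd n (s * c) (tconv q x)"
  unfolding l1bnd_def
proof (intro allI impI)
  fix A :: "int set" assume A: "finite A \<and> card A \<le> n"
  have x1: "l1bnd 1 c x" using x n by (auto simp: l1bnd_def)
  have qs: "q summable_on UNIV" using q(2) summable_on_def by blast
  have sm: "(\<lambda>i. q i * \<bar>x (j - i)\<bar>) summable_on UNIV" for j
    using tconv_summable(2)[OF q(1) qs x1, of j] q(1) by (simp add: abs_mult)
  have "(\<Sum>j\<in>A. \<bar>tconv q x j\<bar>) \<le> (\<Sum>j\<in>A. \<Sum>\<^sub>\<infinity>i. q i * \<bar>x (j - i)\<bar>)"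
  proof (rule sum_mono)
    fix j
    have "norm (tconv q x j) \<le> (\<Sum>\<^sub>\<infinity>i. norm (q i * x (j - i)))"
      unfolding tconv_def by (rule norm_infsum_bound) (use sm q(1) in \<open>simp add: abs_mult\<close>)
    then show "\<bar>tconv q x j\<bar> \<le> (\<Sum>\<^sub>\<infinity>i. q i * \<bar>x (j - i)\<bar>)"
      using q(1) by (simp add: abs_mult)
  qed
  also have "\<dots> = (\<Sum>\<^sub>\<infinity>i. \<Sum>j\<in>A. q i * \<bar>x (j - i)\<bar>)"
    by (rule infsumI[symmetric], rule has_sum_finite_sum) (use A sm in \<open>auto intro!: has_sum_infsum\<close>)
  also have "\<dots> \<le> (\<Sum>\<^sub>\<infinity>i. q i * c)"
  proof (rule infsum_mono)
    show "(\<lambda>i. \<Sum>j\<in>A. q i * \<bar>x (j - i)\<bar>) summable_on UNIV" 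
      by (rule has_sum_imp_summable, rule has_sum_finite_sum) (use A sm in \<open>auto intro!: has_sum_infsum\<close>)
    show "(\<lambda>i. q i * c) summable_on UNIV" using qs by (rule summable_on_cmult_left)
    fix i
    have "(\<Sum>j\<in>A. \<bar>x (j - i)\<bar>) \<le> c"
      using l1bndD[OF l1bnd_shift[OF x, of "-i"], of A] A by simp
    then show "(\<Sum>j\<in>A. q i * \<bar>x (j - i)\<bar>) \<le> q i * c"
      using q(1) by (simp add: sum_distrib_left[symmetric] mult_left_mono)
  qed
  also have "\<dots> = s * c" using q(2) by (simp add: infsum_cmult_left' infsumI)
  finally show "(\<Sum>j\<in>A. \<bar>tconv q x j\<bar>) \<le> s * c" .
qed

lemma fdiff_tconv:
  assumes "\<And>i. 0 \<le> q i" "q summable_on UNIV" "l1bnd 1 c x"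
  shows "fdiff (tconv q x) = tconv q (fdiff x)"
proof
  fix j
  have "tconv q (fdiff x) j = (\<Sum>\<^sub>\<infinity>i. q i * x (j + 1 - i) + - (q i * x (j - i)))"
    by (simp add: tconv_def fdiff_def algebra_simps)
  also have "\<dots> = fdiff (tconv q x) j"
    unfolding fdiff_def tconv_def
    by (subst infsum_add) (auto intro!: tconv_summable[OF assms] simp: summable_on_uminus infsum_uminus)
  finally show "fdiff (tconv q x) j = tconv q (fdiff x) j" by simp
qed

section \<open>Convolution with fair coins, and symmetric binomial weights\<close>

definition coin :: "(int \<Rightarrow> real) \<Rightarrow> int \<Rightarrow> real" where
  "coin x j = (x j + x (j - 1)) / 2"

lemma l1bnd_coin: "l1bnd n c x \<Longrightarrow> l1bnd n c (coin x)"
  using l1bnd_scale[OF l1bnd_add[OF _ l1bnd_shift[of n c x "-1"]], of c x "1/2"]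
  by (simp add: coin_def[abs_def])

lemma l1bnd_coin_pow: "l1bnd n c x \<Longrightarrow> l1bnd n c ((coin ^^ K) x)"
  by (induction K) (auto intro: l1bnd_coin)

lemma coin_tconv:
  assumes "\<And>i. 0 \<le> q i" "q summable_on UNIV" "l1bnd 1 c x"
  shows "coin (tconv q x) = tconv q (coin x)"
proof
  fix j
  have "tconv q (coin x) j = (\<Sum>\<^sub>\<infinity>i. (q i * x (j - i) + q i * x (j - 1 - i)) * (1/2))"
    by (simp add: tconv_def coin_def algebra_simps add_divide_distrib)
  also have "\<dots> = (\<Sum>\<^sub>\<infinity>i. (q i * x (j - i) + q i * x (j - 1 - i))) * (1/2)"
    by (rule infsum_cmult_left')
  also have "\<dots> = coin (tconv q x) j"
    unfolding coin_def tconv_def by (subst infsum_add) (auto intro!: tconv_summable[OF assms])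
  finally show "coin (tconv q x) j = tconv q (coin x) j" by simp
qed

lemma coin_pow_tconv:
  assumes "\<And>i. 0 \<le> q i" "q summable_on UNIV" "l1bnd 1 c x"
  shows "(coin ^^ K) (tconv q x) = tconv q ((coin ^^ K) x)"
  by (induction K) (auto simp: coin_tconv[OF assms(1,2) l1bnd_coin_pow[OF assms(3)]])

lemma coin_pow_add: "(coin ^^ K) (\<lambda>j. a * x j + y j) = (\<lambda>j. a * (coin ^^ K) x j + (coin ^^ K) y j)"
proof (induction K)
  case (Suc K)
  then show ?case by (auto simp: coin_def field_simps)
qed auto

lemma binomial_coin: "(coin ^^ K) x j = (\<Sum>i\<le>K. real (K choose i) / 2 ^ K * x (j - int i))"
proof (induction K arbitrary: j)
  case (Suc K)
  have "(\<Sum>i\<le>Suc K. real (Suc K choose i) * x (j - int i))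
      = x j + (\<Sum>i\<le>K. real ((K choose i) + (K choose Suc i)) * x (j - int (Suc i)))"
    by (subst sum.atMost_Suc_shift) (simp add: add.commute)
  also have "\<dots> = (x j + (\<Sum>i\<le>K. real (K choose Suc i) * x (j - int (Suc i))))
      + (\<Sum>i\<le>K. real (K choose i) * x (j - 1 - int i))"
    by (simp add: sum.distrib algebra_simps)
  also have "x j + (\<Sum>i\<le>K. real (K choose Suc i) * x (j - int (Suc i)))
      = (\<Sum>i\<le>Suc K. real (K choose i) * x (j - int i))"
    by (subst sum.atMost_Suc_shift) simp
  also have "\<dots> = (\<Sum>i\<le>K. real (K choose i) * x (j - int i))" by (simp add: binomial_eq_0)
  finally have *: "(\<Sum>i\<le>Suc K. real (Suc K choose i) * x (j - int i)) =
     (\<Sum>i\<le>K. real (K choose i) * x (j - int i)) + (\<Sum>i\<le>K. real (K choose i) * x (j - 1 - int i))" .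
  have "(coin ^^ Suc K) x j = ((\<Sum>i\<le>K. real (K choose i) / 2 ^ K * x (j - int i))
     + (\<Sum>i\<le>K. real (K choose i) / 2 ^ K * x (j - 1 - int i))) / 2"
    by (simp add: coin_def[of "(coin ^^ K) x"] Suc)
  also have "\<dots> = (\<Sum>i\<le>Suc K. real (Suc K choose i) * x (j - int i)) / 2 ^ Suc K"
    unfolding * by (simp add: sum_divide_distrib[symmetric] add_divide_distrib)
  finally show ?case by (simp only: sum_divide_distrib times_divide_eq_left)
qed auto

text \<open>Rewriting the difference as a weight of row \<open>Suc K\<close> times a centred
  variable turns the variation of the binomial weights into a mean absolute deviation.\<close>

lemma choose_diff:
  "real (K choose Suc i) - real (K choose i)
    = real (Suc K choose Suc i) * (real (Suc K) - 2 * real (Suc i)) / real (Suc K)"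
proof -
  have 1: "real (Suc i) * real (Suc K choose Suc i) = real (Suc K) * real (K choose i)"
    using Suc_times_binomial_eq[of K i] by (metis mult.commute of_nat_mult)
  have 2: "real (Suc K choose Suc i) = real (K choose i) + real (K choose Suc i)" by simp
  have "real (Suc K choose Suc i) * (real (Suc K) - 2 * real (Suc i))
      = real (Suc K) * (real (K choose i) + real (K choose Suc i)) - 2 * (real (Suc i) * real (Suc K choose Suc i))"
    unfolding 2 by (simp add: algebra_simps)
  also have "\<dots> = real (Suc K) * (real (K choose Suc i) - real (K choose i))"
    unfolding 1 by (simp add: algebra_simps)
  finally show ?thesis by simp
qed

text \<open>The variance of a sum of \<open>n\<close> random signs, obtained from the moments of
  orders 0, 1 and 2 of the Bernstein basis at \<open>1/2\<close>.\<close>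

lemma sum_choose_centered_square: "(\<Sum>i\<le>n. real (n choose i) * (real n - 2 * real i)\<^sup>2) = real n * 2 ^ n"
proof -
  have B: "Bernstein n i (1/2) = real (n choose i) / 2 ^ n" if "i \<le> n" for i
    using that by (simp add: Bernstein_def power_add[symmetric] power_divide)
  have "(\<Sum>i\<le>n. real (n choose i) * (real n - 2 * real i)\<^sup>2) / 2 ^ n
     = (\<Sum>i\<le>n. (real n)\<^sup>2 * Bernstein n i (1/2) - 4 * (real n - 1) * (real i * Bernstein n i (1/2))
          + 4 * (real i * (real i - 1) * Bernstein n i (1/2)))"
    by (simp add: sum_divide_distrib) (intro sum.cong refl, auto simp: B power2_eq_square field_simps)
  also have "\<dots> = real n"
    by (simp only: sum.distrib sum_subtractf sum_distrib_left[symmetric] sum_Bernstein sum_k_Bernstein sum_kk_Bernstein)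
      (simp add: power2_eq_square field_simps)
  finally show ?thesis by (simp add: field_simps)
qed

lemma sum_abs_choose_diff:
  "(\<Sum>i\<le>n. real (n choose i) * \<bar>real n - 2 * real i\<bar>) \<le> 2 ^ n * sqrt (real n)"
proof -
  let ?a = "\<lambda>i. sqrt (real (n choose i))"
  have "(\<Sum>i\<le>n. real (n choose i) * \<bar>real n - 2 * real i\<bar>)\<^sup>2
      = (\<Sum>i\<le>n. ?a i * (?a i * \<bar>real n - 2 * real i\<bar>))\<^sup>2"
    by (simp add: mult.assoc[symmetric])
  also have "\<dots> \<le> (\<Sum>i\<le>n. (?a i)\<^sup>2) * (\<Sum>i\<le>n. (?a i * \<bar>real n - 2 * real i\<bar>)\<^sup>2)"
    by (rule Cauchy_Schwarz_ineq_sum)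
  also have "(\<Sum>i\<le>n. (?a i)\<^sup>2) = 2 ^ n"
    using choose_row_sum[of n] by (simp flip: of_nat_sum)
  also have "(\<Sum>i\<le>n. (?a i * \<bar>real n - 2 * real i\<bar>)\<^sup>2) = real n * 2 ^ n"
    using sum_choose_centered_square[of n] by (simp add: power_mult_distrib)
  also have "2 ^ n * (real n * 2 ^ n) = (2 ^ n * sqrt (real n))\<^sup>2"
    by (simp add: power_mult_distrib power2_eq_square)
  finally show ?thesis by (rule power2_le_imp_le) auto
qed

text \<open>Summation by parts moves the difference from \<open>x\<close> onto the binomial weights,
  whose variation is estimated by \<open>choose_diff\<close> and \<open>sum_abs_choose_diff\<close>.
  At \<open>K = 0\<close> the constant is the trivial 2, so that an induction can start without any
  coin.\<close>

lemma l1bnd_fdiff_coin_pow: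
  assumes x: "l1bnd n c x"
  shows "l1bnd n (2 / sqrt (real (Suc K)) * c) (fdiff ((coin ^^ K) x))"
proof -
  let ?d = "\<lambda>i. real (Suc K choose i) * (real (Suc K) - 2 * real i) / real (Suc K) / 2 ^ K"
  have eq: "fdiff ((coin ^^ K) x) = (\<lambda>j. \<Sum>i\<le>Suc K. ?d i * x (j + (1 - int i)))"
  proof
    fix j
    have "fdiff ((coin ^^ K) x) j =
      (\<Sum>i\<le>K. real (K choose i) / 2 ^ K * x (j + 1 - int i)) - (\<Sum>i\<le>K. real (K choose i) / 2 ^ K * x (j - int i))"
      by (simp add: fdiff_def binomial_coin)
    also have "(\<Sum>i\<le>K. real (K choose i) / 2 ^ K * x (j + 1 - int i)) =
       (\<Sum>i\<le>Suc K. real (K choose i) / 2 ^ K * x (j + 1 - int i))" by (simp add: binomial_eq_0)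
    also have "\<dots> = x (j + 1) / 2 ^ K + (\<Sum>i\<le>K. real (K choose Suc i) / 2 ^ K * x (j - int i))"
      by (subst sum.atMost_Suc_shift) simp
    also have "\<dots> - (\<Sum>i\<le>K. real (K choose i) / 2 ^ K * x (j - int i)) =
       x (j + 1) / 2 ^ K + (\<Sum>i\<le>K. (real (K choose Suc i) - real (K choose i)) / 2 ^ K * x (j - int i))"
      by (simp add: sum_subtractf diff_divide_distrib left_diff_distrib)
    also have "\<dots> = (\<Sum>i\<le>Suc K. ?d i * x (j + (1 - int i)))"
    proof -
      \<comment> \<open>The leftover \<open>x (j + 1)\<close> is the term \<open>i = 0\<close> of
        the row \<open>Suc K\<close>, whose coefficient is again \<open>1 / 2 ^ K\<close>.\<close>
      have "x (j + (1 - int (Suc i))) = x (j - int i)" for i by simp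
      moreover have "?d 0 = 1 / 2 ^ K" by simp
      ultimately show ?thesis
        unfolding choose_diff by (subst sum.atMost_Suc_shift) (simp only:, simp)
    qed
    finally show "fdiff ((coin ^^ K) x) j = (\<Sum>i\<le>Suc K. ?d i * x (j + (1 - int i)))" .
  qed
  have c: "c \<ge> 0" using x l1bnd_nonneg by blast
  show ?thesis unfolding eq
  proof (rule l1bnd_mono)
    show "l1bnd n (\<Sum>i\<le>Suc K. \<bar>?d i\<bar> * c) (\<lambda>j. \<Sum>i\<le>Suc K. ?d i * x (j + (1 - int i)))"
      by (intro l1bnd_sum l1bnd_scale l1bnd_shift x) auto
    have "(\<Sum>i\<le>Suc K. \<bar>?d i\<bar>) = (\<Sum>i\<le>Suc K. real (Suc K choose i) * \<bar>real (Suc K) - 2 * real i\<bar>) / (real (Suc K) * 2 ^ K)"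
      unfolding sum_divide_distrib by (intro sum.cong refl) (simp add: abs_mult del: binomial_Suc_Suc of_nat_Suc)
    also have "\<dots> \<le> (2 ^ Suc K * sqrt (real (Suc K))) / (real (Suc K) * 2 ^ K)"
      by (intro divide_right_mono sum_abs_choose_diff) auto
    also have "\<dots> = 2 / sqrt (real (Suc K))"
      by (simp add: field_simps del: of_nat_Suc)
    finally show "(\<Sum>i\<le>Suc K. \<bar>?d i\<bar> * c) \<le> 2 / sqrt (real (Suc K)) * c"
      using c unfolding sum_distrib_right[symmetric] by (rule mult_right_mono)
  qed
qed

section \<open>Smoothing by convolution\<close>

text \<open>The condition \<open>u \<le> 1 - D_1 / 2\<close> in terms of point masses: their first
  difference is, up to a shift, the second difference of the distribution function.\<close>

definition overlap :: "real \<Rightarrow> (int \<Rightarrow> real) \<Rightarrow> bool" where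
  "overlap u q \<longleftrightarrow> (\<forall>i. 0 \<le> q i) \<and> (q has_sum 1) UNIV \<and> (\<Sum>\<^sub>\<infinity>i. \<bar>fdiff q i\<bar>) \<le> 2 * (1 - u)"

lemma has_sum_int_shift:
  fixes q :: "int \<Rightarrow> 'b :: topological_comm_monoid_add"
  assumes "(q has_sum s) UNIV" shows "((\<lambda>i. q (i + a)) has_sum s) UNIV"
  using has_sum_reindex_bij_betw[of "\<lambda>i. i + a" UNIV UNIV q s] assms
  by (auto simp: bij_betw_def intro!: image_eqI[of _ _ "_ - a"])

lemma min_eq_abs: "min a b = (a + b + - \<bar>b - a\<bar>) * (1 / 2)" for a b :: real
  by (auto simp: min_def)

text \<open>By \<open>min_eq_abs\<close>, the mass shared by \<open>q\<close> and its translate is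
  exactly 1 minus half the 1-norm of \<open>fdiff q\<close>.\<close>

lemma overlap_mass:
  assumes "overlap u q"
  obtains v where "((\<lambda>i. min (q i) (q (i + 1))) has_sum v) UNIV" "u \<le> v"
proof
  let ?D = "\<Sum>\<^sub>\<infinity>i. \<bar>fdiff q i\<bar>"
  have q: "(q has_sum 1) UNIV" "\<And>i. 0 \<le> q i" using assms by (auto simp: overlap_def)
  have "l1bnd n 2 (fdiff q)" for n
    using l1bnd_fdiff[OF l1bnd_if_has_sum[of q 1 n]] q by simp
  then have "((\<lambda>i. \<bar>fdiff q i\<bar>) has_sum ?D) UNIV"
    using summable_if_l1bnd by (intro has_sum_infsum) blast
  then show "((\<lambda>i. min (q i) (q (i + 1))) has_sum ((1 + 1 + - ?D) * (1 / 2))) UNIV"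
    unfolding min_eq_abs fdiff_def[symmetric]
    by (intro has_sum_cmult_left has_sum_add has_sum_int_shift q) (simp add: has_sum_uminus)
  show "u \<le> (1 + 1 + - ?D) * (1 / 2)" using assms by (simp add: overlap_def)
qed

lemma overlap_le_1:
  assumes "overlap u q" shows "u \<le> 1"
proof -
  have "0 \<le> (\<Sum>\<^sub>\<infinity>i. \<bar>fdiff q i\<bar>)" by (intro infsum_nonneg) auto
  then show ?thesis using assms by (simp add: overlap_def)
qed

text \<open>A law that overlaps its translate by mass \<open>u\<close> is a mixture containing, with weight \<open>u\<close>,
  the convolution of some law with a fair coin.\<close>
lemma overlap_decomp:
  assumes "overlap u q" "0 < u"
  obtains r s where "\<And>i. 0 \<le> r i" "(r has_sum 1) UNIV" "\<And>i. 0 \<le> s i" "(s has_sum (1 - u)) UNIV"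
    "\<And>i. q i = u * ((r i + r (i - 1)) / 2) + s i"
proof -
  have q: "(q has_sum 1) UNIV" "\<And>i. 0 \<le> q i" using assms by (auto simp: overlap_def)
  obtain v where v: "((\<lambda>i. min (q i) (q (i + 1))) has_sum v) UNIV" "u \<le> v"
    using overlap_mass[OF assms(1)] by blast
  \<comment> \<open>\<open>r\<close> is the shared mass made into a law. It enters with weight
    \<open>u\<close> instead of its full mass \<open>v\<close>, so that all summands have the same
    mixture weight.\<close>
  define r where "r i = min (q i) (q (i + 1)) * (1 / v)" for i
  define s where "s i = q i + - (u * ((r i + r (i + -1)) * (1 / 2)))" for i
  have r: "(r has_sum 1) UNIV"
    using has_sum_cmult_left[OF v(1), of "1 / v"] v(2) assms(2) by (simp add: r_def[abs_def])
  have s: "(s has_sum (1 + - (u * ((1 + 1) * (1 / 2))))) UNIV"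
    unfolding s_def[abs_def]
    by (intro has_sum_add q has_sum_uminus[THEN iffD2])
       (simp only: minus_minus, intro has_sum_cmult_right has_sum_cmult_left has_sum_add r has_sum_int_shift)
  \<comment> \<open>The coin puts half of \<open>u * r i\<close> on each of \<open>i\<close> and
    \<open>i + 1\<close>, so \<open>u * r i\<close> has to fit under both masses; the two halves
    arriving at a point then never exceed \<open>q\<close> there.\<close>
  have r_le: "u * r i \<le> min (q i) (q (i + 1))" for i
  proof -
    have "u / v * min (q i) (q (i + 1)) \<le> 1 * min (q i) (q (i + 1))"
      using v(2) assms(2) q(2) by (intro mult_right_mono) (auto simp: field_simps)
    then show ?thesis by (simp add: r_def field_simps)
  qed
  show thesis
  proof
    show "0 \<le> r i" for i using q(2) v(2) assms(2) by (simp add: r_def)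
    show "(r has_sum 1) UNIV" by (rule r)
    show "(s has_sum (1 - u)) UNIV" using s by simp
    show "0 \<le> s i" for i using r_le[of i] r_le[of "i - 1"] by (simp add: s_def field_simps)
    show "q i = u * ((r i + r (i - 1)) / 2) + s i" for i by (simp add: s_def)
  qed
qed

lemma tconv_decomp:
  assumes r: "\<And>i. 0 \<le> r i" "(r has_sum 1) UNIV" and s: "\<And>i. 0 \<le> s i" "(s has_sum t) UNIV"
    and q: "\<And>i. q i = u * ((r i + r (i - 1)) / 2) + s i" and x: "l1bnd 1 c x"
  shows "tconv q x = (\<lambda>j. u * coin (tconv r x) j + tconv s x j)"
proof
  fix j
  have rs: "r summable_on UNIV" "s summable_on UNIV" using r s by (auto intro: has_sum_imp_summable)
  have 1: "((\<lambda>i. r i * x (j - i)) has_sum tconv r x j) UNIV" for j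
    unfolding tconv_def by (intro has_sum_infsum tconv_summable[OF r(1) rs(1) x])
  have 2: "((\<lambda>i. s i * x (j - i)) has_sum tconv s x j) UNIV"
    unfolding tconv_def by (intro has_sum_infsum tconv_summable[OF s(1) rs(2) x])
  have 3: "((\<lambda>i. r (i - 1) * x (j - i)) has_sum tconv r x (j - 1)) UNIV"
    using has_sum_int_shift[OF 1[of "j - 1"], of "-1"] by (simp add: algebra_simps)
  have "((\<lambda>i. u * ((r i * x (j - i) + r (i - 1) * x (j - i)) * (1 / 2)) + s i * x (j - i))
      has_sum (u * ((tconv r x j + tconv r x (j - 1)) * (1 / 2)) + tconv s x j)) UNIV"
    by (intro has_sum_add has_sum_cmult_right has_sum_cmult_left 1 2 3)
  then show "tconv q x j = u * coin (tconv r x) j + tconv s x j"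
    unfolding tconv_def[of q] coin_def by (intro infsumI) (simp add: q algebra_simps add_divide_distrib)
qed

text \<open>One step of the induction in \<open>l1bnd_smoothing\<close>, where a coin is gained with
  weight \<open>u\<close>. Jensen's inequality reduces to squares, where \<open>1 / (x + 1)\<close>
  and \<open>1 / x\<close> are averaged explicitly. By convexity the gain in \<open>x\<close> cannot
  be the full \<open>u\<close>; half of it is safe once \<open>x \<ge> 1\<close>.\<close>

lemma smoothing_recursion:
  assumes "1 \<le> x" "0 \<le> u" "u \<le> 1"
  shows "u / sqrt (x + 1) + (1 - u) / sqrt x \<le> 1 / sqrt (x + u / 2)"
proof (rule power2_le_imp_le)
  let ?a = "1 / sqrt (x + 1)" and ?b = "1 / sqrt x"
  have ab: "?a\<^sup>2 = 1 / (x + 1)" "?b\<^sup>2 = 1 / x" using assms by (auto simp: power_divide)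
  have "0 \<le> u * (1 - u) * (?a - ?b)\<^sup>2" using assms by (intro mult_nonneg_nonneg) auto
  moreover have "u * a\<^sup>2 + (1 - u) * b\<^sup>2 - (u * a + (1 - u) * b)\<^sup>2 = u * (1 - u) * (a - b)\<^sup>2" for a b :: real
    by (simp add: power2_eq_square algebra_simps)
  ultimately have "(u * ?a + (1 - u) * ?b)\<^sup>2 \<le> u * ?a\<^sup>2 + (1 - u) * ?b\<^sup>2"
    by (metis diff_ge_0_iff_ge)
  also have "\<dots> \<le> 1 / (x + u / 2)"
  proof -
    have "(x + 1 - u) * (x + u / 2) = x * (x + 1) - (u / 2) * (x - 1 + u)" by (simp add: field_simps)
    also have "\<dots> \<le> x * (x + 1)" using assms by simp
    finally have "(x + 1 - u) / (x * (x + 1)) \<le> 1 / (x + u / 2)"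
      using assms by (simp add: divide_le_eq le_divide_eq mult.commute)
    moreover have "u * (1 / (x + 1)) + (1 - u) * (1 / x) = (x + 1 - u) / (x * (x + 1))"
      using assms by (simp add: divide_simps) (simp add: algebra_simps)
    ultimately show ?thesis unfolding ab by simp
  qed
  also have "\<dots> = (1 / sqrt (x + u / 2))\<^sup>2" using assms by (simp add: power_divide)
  finally show "(u / sqrt (x + 1) + (1 - u) / sqrt x)\<^sup>2 \<le> (1 / sqrt (x + u / 2))\<^sup>2" by simp
  show "0 \<le> 1 / sqrt (x + u / 2)" using assms by simp
qed

lemma l1bnd_foldr_tconv:
  assumes "\<And>q. q \<in> set qs \<Longrightarrow> overlap u q" and "l1bnd n c x" and "1 \<le> n"
  shows "l1bnd n c (foldr tconv qs x)"
  using assms(1)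
proof (induction qs)
  case (Cons q qs)
  have "(\<forall>i. 0 \<le> q i) \<and> (q has_sum 1) UNIV" using Cons.prems by (auto simp: overlap_def)
  then show ?case using l1bnd_tconv[of q 1 n c "foldr tconv qs x"] Cons assms(3) by simp
qed (use assms in auto)

lemma l1bnd_le_n: "l1bnd n c x \<Longrightarrow> m \<le> n \<Longrightarrow> l1bnd m c x"
  by (meson order_trans l1bnd_def)

lemma fdiff_foldr_tconv:
  assumes "\<And>q. q \<in> set qs \<Longrightarrow> overlap u q" and "l1bnd 1 c x"
  shows "(fdiff ^^ r) (foldr tconv qs x) = foldr tconv qs ((fdiff ^^ r) x)"
  using assms(1)
proof (induction qs)
  case (Cons q qs)
  have q: "\<And>i. 0 \<le> q i" "q summable_on UNIV" using Cons.prems by (auto simp: overlap_def intro: has_sum_imp_summable)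
  have "(fdiff ^^ r) (tconv q y) = tconv q ((fdiff ^^ r) y)" if "l1bnd 1 c y" for y
  proof -
    have "l1bnd 1 (2 ^ r * c) ((fdiff ^^ r) y)" for r
      by (induction r) (use that l1bnd_fdiff in \<open>auto simp: mult.assoc\<close>)
    then have "fdiff (tconv q ((fdiff ^^ r) y)) = tconv q (fdiff ((fdiff ^^ r) y))" for r
      by (rule fdiff_tconv[OF q])
    then show ?thesis by (induction r) auto
  qed
  moreover have "l1bnd 1 c (foldr tconv qs x)"
    using Cons.prems assms(2) by (intro l1bnd_foldr_tconv) auto
  ultimately show ?case using Cons by simp
qed auto

text \<open>Expanding all mixtures would produce a binomially distributed number of coins. Instead
  \<open>K\<close>, the number of coins already collected, is general in the induction: the coin
  part of a summand raises \<open>K\<close> by one, the remainder leaves it alone, and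
  \<open>smoothing_recursion\<close> merges the two bounds.\<close>

lemma l1bnd_smoothing:
  assumes "\<And>q. q \<in> set qs \<Longrightarrow> overlap u q" and u: "0 < u" "u \<le> 1" and x: "l1bnd n c x" and n: "1 \<le> n"
  shows "l1bnd n (2 / sqrt (real (Suc K) + u * real (length qs) / 2) * c)
     (fdiff ((coin ^^ K) (foldr tconv qs x)))"
  using assms(1)
proof (induction qs arbitrary: K)
  case Nil
  then show ?case using l1bnd_fdiff_coin_pow[OF x] by simp
next
  case (Cons q qs)
  define y where "y = foldr tconv qs x"
  have y: "l1bnd n c y" unfolding y_def using Cons.prems x n by (intro l1bnd_foldr_tconv) auto
  have y1: "l1bnd 1 c y" using y n by (rule l1bnd_le_n)
  have q: "overlap u q" using Cons.prems by simp
  obtain r s where rs: "\<And>i. 0 \<le> r i" "(r has_sum 1) UNIV" "\<And>i. 0 \<le> s i" "(s has_sum (1 - u)) UNIV"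
    "\<And>i. q i = u * ((r i + r (i - 1)) / 2) + s i" using overlap_decomp[OF q u(1)] by blast
  have sm: "r summable_on UNIV" "s summable_on UNIV" using rs by (auto intro: has_sum_imp_summable)
  define z where "z = real (Suc K) + u * real (length qs) / 2"
  have z: "z \<ge> 1" using u by (simp add: z_def)
  have IH: "l1bnd n (2 / sqrt (real (Suc K) + u * real (length qs) / 2) * c) (fdiff ((coin ^^ K) y))" for K
    using Cons by (simp add: y_def)
  have dec: "tconv q y = (\<lambda>j. u * coin (tconv r y) j + tconv s y j)" by (rule tconv_decomp[OF rs y1])
  have comm: "fdiff ((coin ^^ k) (tconv p y)) = tconv p (fdiff ((coin ^^ k) y))"
    if "\<And>i. 0 \<le> p i" "p summable_on UNIV" for p k
    using coin_pow_tconv[OF that y1] fdiff_tconv[OF that l1bnd_coin_pow[OF y1]] by simp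
  have "fdiff ((coin ^^ K) (tconv q y))
     = (\<lambda>j. u * fdiff ((coin ^^ Suc K) (tconv r y)) j + fdiff ((coin ^^ K) (tconv s y)) j)"
    unfolding dec coin_pow_add by (auto simp: fdiff_def funpow_swap1 algebra_simps)
  also have "\<dots> = (\<lambda>j. u * tconv r (fdiff ((coin ^^ Suc K) y)) j + tconv s (fdiff ((coin ^^ K) y)) j)"
    by (simp only: comm[OF rs(1) sm(1)] comm[OF rs(3) sm(2)])
  finally have eq: "fdiff ((coin ^^ K) (tconv q y))
    = (\<lambda>j. u * tconv r (fdiff ((coin ^^ Suc K) y)) j + tconv s (fdiff ((coin ^^ K) y)) j)" .
  have "l1bnd n (\<bar>u\<bar> * (1 * (2 / sqrt (z + 1) * c)) + (1 - u) * (2 / sqrt z * c)) (fdiff ((coin ^^ K) (tconv q y)))"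
    unfolding eq
    by (intro l1bnd_add l1bnd_scale l1bnd_tconv rs n)
       (use IH[of "Suc K"] IH[of K] in \<open>simp_all add: z_def add_ac\<close>)
  then have "l1bnd n (2 / sqrt (z + u / 2) * c) (fdiff ((coin ^^ K) (tconv q y)))"
  proof (rule l1bnd_mono)
    have "2 * c * (u / sqrt (z + 1) + (1 - u) / sqrt z) \<le> 2 * c * (1 / sqrt (z + u / 2))"
      using l1bnd_nonneg[OF x] z u by (intro mult_left_mono smoothing_recursion) auto
    then show "\<bar>u\<bar> * (1 * (2 / sqrt (z + 1) * c)) + (1 - u) * (2 / sqrt z * c) \<le> 2 / sqrt (z + u / 2) * c"
      using u by (simp add: field_simps)
  qed
  then show ?case by (simp add: y_def z_def add_divide_distrib distrib_left add_ac)
qed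

text \<open>Each of the \<open>r\<close> differences is given its own block of \<open>m\<close>
  summands; since differences commute with convolutions, every block has to smooth exactly
  one.\<close>

lemma l1bnd_fdiff_pow_foldr:
  assumes "\<And>q. q \<in> set qs \<Longrightarrow> overlap u q" and u: "0 < u" "u \<le> 1" and x: "l1bnd n c x" and n: "1 \<le> n"
    and "r * m \<le> length qs"
  shows "l1bnd n ((2 / sqrt (1 + u * real m / 2)) ^ r * c) ((fdiff ^^ r) (foldr tconv qs x))"
  using assms(1,6)
proof (induction r arbitrary: qs)
  case 0
  show ?case using l1bnd_foldr_tconv[OF 0(1) x n] by simp
next
  case (Suc r)
  define y where "y = foldr tconv (drop m qs) x"
  have 1: "l1bnd 1 c y" unfolding y_def
    using Suc.prems(1) l1bnd_foldr_tconv[OF _ l1bnd_le_n[OF x n]] by (meson in_set_dropD le_refl)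
  have IH: "l1bnd n ((2 / sqrt (1 + u * real m / 2)) ^ r * c) ((fdiff ^^ r) y)"
    unfolding y_def using Suc.prems by (intro Suc.IH) (auto dest: in_set_dropD)
  have "(fdiff ^^ Suc r) (foldr tconv qs x) = fdiff ((fdiff ^^ r) (foldr tconv (take m qs) y))"
    by (simp add: y_def flip: foldr_append)
  also have "\<dots> = fdiff ((coin ^^ 0) (foldr tconv (take m qs) ((fdiff ^^ r) y)))"
    by (subst fdiff_foldr_tconv[OF _ 1, of "take m qs" u r]) (auto dest: in_set_takeD Suc.prems(1))
  finally have eq: "(fdiff ^^ Suc r) (foldr tconv qs x)
    = fdiff ((coin ^^ 0) (foldr tconv (take m qs) ((fdiff ^^ r) y)))" .
  have "length (take m qs) = m" using Suc.prems(2) by simp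
  then show ?case unfolding eq
    using l1bnd_smoothing[OF _ u IH n, of "take m qs" 0] Suc.prems(1) by (auto dest: in_set_takeD simp: mult.assoc)
qed

text \<open>Blocks of length \<open>m = length qs div r\<close> waste fewer than \<open>r\<close>
  summands; with \<open>u \<le> 1\<close> this gives
  \<open>u * L \<le> 2 * r * (1 + u * m / 2)\<close>, whence the constant 8.\<close>

lemma l1bnd_fdiff_pow_foldr_length:
  assumes "\<And>q. q \<in> set qs \<Longrightarrow> overlap u q" and u: "0 < u" "u \<le> 1" and x: "l1bnd n c x" and n: "1 \<le> n"
    and L: "0 < L" "L \<le> real (length qs)"
  shows "l1bnd n (sqrt (8 * real r / (u * L)) ^ r * c) ((fdiff ^^ r) (foldr tconv qs x))"
proof (cases "r = 0")
  case True
  then show ?thesis using l1bnd_foldr_tconv[OF assms(1) x n] by simp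
next
  case False
  define m where "m = length qs div r"
  have "real (length qs) \<le> real r * (real m + 1)"
  proof -
    have "length qs \<le> r * (m + 1)" unfolding m_def using False
      by (metis add.commute add_leD1 dividend_less_times_div less_imp_le_nat mult_Suc_right plus_1_eq_Suc zero_less_iff_neq_zero)
    then have "real (length qs) \<le> real (r * (m + 1))" by (rule of_nat_mono)
    then show ?thesis by (simp only: of_nat_mult of_nat_add of_nat_1)
  qed
  then have "u * L \<le> u * (real r * (real m + 1))" using L u by (intro mult_left_mono) auto
  also have "\<dots> \<le> 2 * real r * (1 + u * real m / 2)" using u False by (simp add: algebra_simps)
  finally have "4 / (1 + u * real m / 2) \<le> 8 * real r / (u * L)"
    using u L False by (simp add: field_simps add_pos_nonneg)
  then have "sqrt (4 / (1 + u * real m / 2)) \<le> sqrt (8 * real r / (u * L))" by simp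
  then have "2 / sqrt (1 + u * real m / 2) \<le> sqrt (8 * real r / (u * L))" by (simp add: real_sqrt_divide)
  then have "(2 / sqrt (1 + u * real m / 2)) ^ r * c \<le> sqrt (8 * real r / (u * L)) ^ r * c"
    using u l1bnd_nonneg[OF x] by (intro mult_right_mono power_mono) auto
  moreover have "l1bnd n ((2 / sqrt (1 + u * real m / 2)) ^ r * c) ((fdiff ^^ r) (foldr tconv qs x))"
    by (rule l1bnd_fdiff_pow_foldr[OF assms(1) u x n]) (auto simp: m_def)
  ultimately show ?thesis using l1bnd_mono by blast
qed

section \<open>Smoothness of the Poisson law\<close>

definition pois :: "real \<Rightarrow> int \<Rightarrow> real" where
  "pois a j = (if j < 0 then 0 else a ^ nat j / fact (nat j) * exp (- a))"

lemma pois_nonneg: "0 \<le> a \<Longrightarrow> 0 \<le> pois a j"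
  by (simp add: pois_def)

lemma pois_sums: "(\<lambda>n. pois a (int n)) sums 1"
proof -
  have "(\<lambda>n. a ^ n /\<^sub>R fact n * exp (- a)) sums (exp a * exp (- a))"
    by (intro sums_mult2 exp_converges)
  then show ?thesis by (simp add: pois_def exp_minus field_simps)
qed

lemma pois_has_sum: "0 \<le> a \<Longrightarrow> (pois a has_sum 1) UNIV"
proof -
  assume a: "0 \<le> a"
  then have "((\<lambda>n. pois a (int n)) has_sum 1) UNIV"
    by (intro sums_nonneg_imp_has_sum pois_sums pois_nonneg)
  then have "(pois a has_sum 1) (range int)"
    by (subst has_sum_reindex) (auto simp: o_def)
  also have "?this \<longleftrightarrow> (pois a has_sum 1) UNIV"
  proof (rule has_sum_cong_neutral)
    fix j assume "j \<in> UNIV - range int"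
    then have "j < 0" by (metis DiffD2 int_nat_eq linorder_not_le rangeI)
    then show "pois a j = 0" by (simp add: pois_def)
  qed auto
  finally show ?thesis .
qed

lemma tconv_pois: "tconv (pois a) (pois b) = pois (a + b)"
proof
  fix j
  show "tconv (pois a) (pois b) j = pois (a + b) j"
  proof (cases "j < 0")
    case True
    then have "(\<lambda>i. pois a i * pois b (j - i)) = (\<lambda>i. 0)" by (auto simp: pois_def)
    then show ?thesis using True by (simp add: tconv_def pois_def)
  next
    case False
    define n where "n = nat j"
    have j: "j = int n" using False by (simp add: n_def)
    have "tconv (pois a) (pois b) j = (\<Sum>\<^sub>\<infinity>i\<in>int ` {..n}. pois a i * pois b (j - i))"
      unfolding tconv_def
    proof (rule infsum_cong_neutral)
      fix i assume "i \<in> UNIV - int ` {..n}"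
      then have "i < 0 \<or> j < i" using j by (metis DiffD2 atMost_iff image_eqI int_nat_eq linorder_not_le nat_le_iff)
      then show "pois a i * pois b (j - i) = 0" by (auto simp: pois_def)
    qed auto
    also have "\<dots> = (\<Sum>i\<le>n. pois a (int i) * pois b (j - int i))"
      by (simp add: sum.reindex)
    also have "\<dots> = (\<Sum>i\<le>n. real (n choose i) * a ^ i * b ^ (n - i) / fact n * exp (- (a + b)))"
    proof (rule sum.cong)
      fix i assume "i \<in> {..n}"
      then have i: "i \<le> n" by simp
      have "nat (j - int i) = n - i" "\<not> j - int i < 0" using i j by auto
      then show "pois a (int i) * pois b (j - int i)
         = real (n choose i) * a ^ i * b ^ (n - i) / fact n * exp (- (a + b))"
        using i by (simp add: pois_def binomial_fact exp_add[symmetric] field_simps)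
    qed auto
    also have "\<dots> = (a + b) ^ n / fact n * exp (- (a + b))"
      by (simp add: binomial_ring sum_distrib_right sum_divide_distrib)
    also have "\<dots> = pois (a + b) j" by (simp add: pois_def j)
    finally show ?thesis .
  qed
qed

lemma pois_eq_foldr: "pois (real n * a) = foldr tconv (replicate n (pois a)) (pois 0)"
proof (induction n)
  case (Suc n)
  have "pois (real (Suc n) * a) = tconv (pois a) (pois (real n * a))"
    by (simp add: tconv_pois algebra_simps)
  then show ?case by (simp add: Suc)
qed auto

text \<open>At \<open>i = k\<close> the difference is at most
  \<open>q k + q (k + 1) - 2 * u\<close>; everywhere else the sum of the two masses will do.\<close>

lemma overlap_if_min:
  assumes q: "\<And>i. 0 \<le> q i" "(q has_sum 1) UNIV" and u: "u \<le> q k" "u \<le> q (k + 1)"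
  shows "overlap u q"
  unfolding overlap_def
proof (intro conjI allI q)
  have 0: "((\<lambda>i. if i = k then u else 0) has_sum u) UNIV"
    using has_sum_cong_neutral[of UNIV "{k}" "\<lambda>i. if i = k then u else 0" "\<lambda>i. u" u]
      has_sum_finite[of "{k}" "\<lambda>i. u"] by auto
  have 1: "((\<lambda>i. q i + q (i + 1) + - (2 * (if i = k then u else 0))) has_sum (1 + 1 + - (2 * u))) UNIV"
    by (intro has_sum_add has_sum_int_shift q has_sum_uminus[THEN iffD2]) (simp only: minus_minus, rule has_sum_cmult_right[OF 0])
  have "(\<Sum>\<^sub>\<infinity>i. \<bar>fdiff q i\<bar>) \<le> (\<Sum>\<^sub>\<infinity>i. q i + q (i + 1) + - (2 * (if i = k then u else 0)))"
  proof (rule infsum_mono)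
    have "l1bnd n 2 (fdiff q)" for n
      using l1bnd_fdiff[OF l1bnd_if_has_sum[of q 1 n]] q by simp
    then show "(\<lambda>i. \<bar>fdiff q i\<bar>) summable_on UNIV" using summable_if_l1bnd by blast
    show "(\<lambda>i. q i + q (i + 1) + - (2 * (if i = k then u else 0))) summable_on UNIV"
      using 1 by (rule has_sum_imp_summable)
    fix i show "\<bar>fdiff q i\<bar> \<le> q i + q (i + 1) + - (2 * (if i = k then u else 0))"
      using q(1)[of i] q(1)[of "i + 1"] u by (auto simp: fdiff_def)
  qed
  also have "\<dots> = 2 * (1 - u)" using 1 by (simp add: infsumI)
  finally show "(\<Sum>\<^sub>\<infinity>i. \<bar>fdiff q i\<bar>) \<le> 2 * (1 - u)" .
qed

lemma overlap_pois:
  assumes "1 \<le> a" "a \<le> 2" shows "overlap (exp (- 2)) (pois a)"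
proof (rule overlap_if_min[where k = 0])
  show "exp (- 2) \<le> pois a 0" using assms by (simp add: pois_def)
  have "exp (- 2) \<le> 1 * exp (- a)" using assms by simp
  also have "\<dots> \<le> a * exp (- a)" using assms by (intro mult_right_mono) auto
  finally show "exp (- 2) \<le> pois a (0 + 1)" by (simp add: pois_def)
qed (use assms pois_nonneg pois_has_sum in auto)

text \<open>The law is cut into \<open>\<lfloor>a\<rfloor>\<close> Poisson laws with parameter in
  \<open>[1, 2]\<close>, started from the point mass \<open>pois 0\<close>. Each piece overlaps its
  translate by \<open>exp (- 2)\<close>, and \<open>\<lfloor>a\<rfloor> \<ge> a / 2\<close>.\<close>

lemma l1bnd_fdiff_pow_pois:
  assumes "1 \<le> a" "1 \<le> n"
  shows "l1bnd n (sqrt (16 * real r * exp 2 / a) ^ r) ((fdiff ^^ r) (pois a))"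
proof -
  define k where "k = nat \<lfloor>a\<rfloor>"
  have k: "real k \<le> a" "a < real k + 1" "1 \<le> real k"
    using assms le_nat_floor[of 1 a] unfolding k_def by (linarith, linarith, simp)
  define b where "b = a / real k"
  have b: "1 \<le> b" "b \<le> 2" "real k * b = a" using k by (auto simp: b_def field_simps)
  have 0: "l1bnd n 1 (pois 0)" using pois_has_sum[of 0] pois_nonneg[of 0] by (intro l1bnd_if_has_sum) auto
  have "l1bnd n (sqrt (8 * real r / (exp (- 2) * (a / 2))) ^ r * 1) ((fdiff ^^ r) (foldr tconv (replicate k (pois b)) (pois 0)))"
    by (rule l1bnd_fdiff_pow_foldr_length[OF _ _ _ 0 assms(2)]) (use b k assms overlap_pois in auto)
  then show ?thesis unfolding pois_eq_foldr[symmetric] b(3) by (simp add: exp_minus field_simps)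
qed

section \<open>Mills' ratio\<close>

abbreviation phi :: "real \<Rightarrow> real" where "phi \<equiv> std_normal_density"

lemma phi_pos [simp]: "0 < phi x"
  by (simp add: normal_density_pos)

lemma phi_minus [simp]: "phi (- x) = phi x"
  by (simp add: normal_density_def)

lemma phi_le_1: "phi x \<le> 1"
proof -
  have "1 \<le> sqrt (2 * pi)" using pi_gt3 by simp
  then have "1 / sqrt (2 * pi) * exp (- x\<^sup>2 / 2) \<le> 1 * 1" by (intro mult_mono) auto
  then show ?thesis by (simp add: std_normal_density_def)
qed

lemma phi_decreasing: "\<bar>x\<bar> \<le> \<bar>y\<bar> \<Longrightarrow> phi y \<le> phi x"
  unfolding std_normal_density_def by (intro mult_left_mono) (auto simp: abs_le_square_iff)

lemma DERIV_phi: "(phi has_real_derivative - x * phi x) (at x within T)"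
proof -
  have "((\<lambda>x. 1 / sqrt (2 * pi) * exp (- x\<^sup>2 / 2)) has_real_derivative
      1 / sqrt (2 * pi) * (exp (- x\<^sup>2 / 2) * (- x))) (at x within T)"
    by (intro DERIV_cmult) (auto intro!: derivative_eq_intros)
  then show ?thesis unfolding std_normal_density_def[abs_def] by (simp add: mult_ac)
qed

lemma phi_at_top: "(phi \<longlongrightarrow> 0) at_top"
proof -
  have "filterlim (\<lambda>x::real. x\<^sup>2 / 2) at_top at_top"
    unfolding divide_inverse
    by (intro filterlim_at_top_mult_tendsto_pos[OF tendsto_const] filterlim_pow_at_top filterlim_ident) auto
  then have "filterlim (\<lambda>x::real. - x\<^sup>2 / 2) at_bot at_top"
    by (simp add: filterlim_uminus_at_bot)
  then have "((\<lambda>x::real. exp (- x\<^sup>2 / 2)) \<longlongrightarrow> 0) at_top"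
    by (rule filterlim_compose[OF exp_at_bot])
  then show ?thesis unfolding std_normal_density_def[abs_def] by (rule tendsto_mult_right_zero)
qed

lemma phi_at_bot: "(phi \<longlongrightarrow> 0) at_bot"
  using phi_at_top by (simp add: filterlim_at_bot_mirror)

lemma Phi_eq_cdf: "Phi = cdf std_normal_distribution"
  by (auto simp: Phi_def cdf_def)

interpretation std_normal: real_distribution std_normal_distribution
  by (rule real_dist_normal_dist)

lemma Phi_at_top: "(Phi \<longlongrightarrow> 1) at_top"
  unfolding Phi_eq_cdf by (rule std_normal.cdf_lim_at_top_prob)

lemma Phi_at_bot: "(Phi \<longlongrightarrow> 0) at_bot"
  unfolding Phi_eq_cdf by (rule std_normal.cdf_lim_at_bot)

lemma Phi_mono: "x \<le> y \<Longrightarrow> Phi x \<le> Phi y"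
  unfolding Phi_eq_cdf by (rule std_normal.cdf_nondecreasing)

lemma Phi_nonneg [simp]: "0 \<le> Phi x"
  by (simp add: Phi_def)

lemma Phi_le_1 [simp]: "Phi x \<le> 1"
  unfolding Phi_eq_cdf by (rule std_normal.cdf_bounded_prob)

lemma borel_measurable_Phi [measurable]: "Phi \<in> borel_measurable borel"
  by (rule borel_measurable_mono) (auto simp: mono_def Phi_mono)

lemma Phi_diff: "a \<le> x \<Longrightarrow> Phi x - Phi a = integral {a..x} phi"
proof -
  assume ax: "a \<le> x"
  have "Phi x - Phi a = measure std_normal_distribution {a<..x}"
    unfolding Phi_def using ax
    by (subst std_normal.finite_measure_Diff[symmetric]) (auto intro!: arg_cong[where f = "measure _"])
  also have "\<dots> = (LINT t:{a<..x}|lborel. phi t)"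
    unfolding set_lebesgue_integral_def measure_def
    by (subst emeasure_density, simp, simp, subst integral_eq_nn_integral)
       (auto simp: ennreal_mult'' mult.commute ennreal_indicator normal_density_nonneg intro!: arg_cong[where f = enn2real] nn_integral_cong split: split_indicator)
  also have "\<dots> = (LINT t:{a..x}|lborel. phi t)"
    unfolding set_lebesgue_integral_def
    by (intro integral_cong_AE) (auto intro!: AE_I[where N = "{a}"] split: split_indicator)
  also have "\<dots> = integral {a..x} phi"
    by (rule set_borel_integral_eq_integral)
       (auto simp: set_integrable_def intro!: integrable_mult_indicator[where 'b = real, simplified] integrable_normal_density)
  finally show ?thesis .
qed

lemma DERIV_Phi: "(Phi has_real_derivative phi x) (at x)"
proof -
  have "((\<lambda>t. integral {x - 1..t} phi) has_real_derivative phi x) (at x within {x - 1..x + 1})"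
    by (rule integral_has_real_derivative)
       (auto intro!: continuous_intros simp: std_normal_density_def)
  then have "((\<lambda>t. Phi (x - 1) + integral {x - 1..t} phi) has_real_derivative phi x) (at x within {x - 1..x + 1})"
    by (auto intro!: derivative_eq_intros)
  then have "(Phi has_real_derivative phi x) (at x within {x - 1..x + 1})"
  proof (rule has_field_derivative_transform_within[where d = 1])
    fix t assume "t \<in> {x - 1..x + 1}"
    then show "Phi (x - 1) + integral {x - 1..t} phi = Phi t" using Phi_diff[of "x - 1" t] by simp
  qed auto
  then show ?thesis by (subst (asm) at_within_interior) auto
qed

lemma Phi_minus: "Phi (- x) = 1 - Phi x"
proof -
  have D: "((\<lambda>x. Phi x + Phi (- x)) has_real_derivative 0) (at x)" for x
    by (auto intro!: derivative_eq_intros DERIV_Phi DERIV_chain'[where f = uminus and g = Phi])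
  have const: "Phi y + Phi (- y) = Phi x + Phi (- x)" for y
    using DERIV_isconst_all[of "\<lambda>x. Phi x + Phi (- x)" y x] D by blast
  have eq: "(\<lambda>y. Phi y + Phi (- y)) = (\<lambda>y. Phi x + Phi (- x))" by (rule ext) (rule const)
  have lim: "((\<lambda>y. Phi y + Phi (- y)) \<longlongrightarrow> 1 + 0) at_top"
    by (intro tendsto_add Phi_at_top filterlim_compose[OF Phi_at_bot filterlim_uminus_at_bot_at_top])
  from lim[unfolded eq] have "Phi x + Phi (- x) = 1" by (subst (asm) tendsto_const_iff) auto
  then show ?thesis by simp
qed

lemma nonneg_if_deriv_nonneg_at_bot:
  fixes f :: "real \<Rightarrow> real"
  assumes "\<And>x. x < b \<Longrightarrow> (f has_real_derivative f' x) (at x)" "\<And>x. x < b \<Longrightarrow> 0 \<le> f' x"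
    and lim: "(f \<longlongrightarrow> 0) at_bot" and x: "x < b"
  shows "0 \<le> f x"
proof (rule tendsto_upperbound[OF lim])
  show "\<forall>\<^sub>F y in at_bot. f y \<le> f x"
    using eventually_le_at_bot[of x]
  proof eventually_elim
    case (elim y)
    show ?case
    proof (rule DERIV_nonneg_imp_nondecreasing[OF elim])
      fix z assume "y \<le> z" "z \<le> x"
      then show "\<exists>d. (f has_real_derivative d) (at z) \<and> 0 \<le> d"
        using assms(1)[of z] assms(2)[of z] x by auto
    qed
  qed
qed simp

lemma mills_upper: "x < 0 \<Longrightarrow> - x * Phi x \<le> phi x"
proof -
  assume x: "x < 0"
  have "0 \<le> - phi x / x - Phi x"
  proof (rule nonneg_if_deriv_nonneg_at_bot[where b = 0 and f = "\<lambda>x. - phi x / x - Phi x" and f' = "\<lambda>x. phi x / x\<^sup>2"])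
    fix x :: real assume "x < (0::real)"
    then show "((\<lambda>x. - phi x / x - Phi x) has_real_derivative phi x / x\<^sup>2) (at x)"
      by (auto intro!: derivative_eq_intros DERIV_phi DERIV_Phi simp: power2_eq_square field_simps)
  next
    have "(inverse \<longlongrightarrow> (0::real)) at_bot"
      by (rule filterlim_mono[OF tendsto_inverse_0 order_refl at_bot_le_at_infinity])
    then have "((\<lambda>x. - phi x * inverse x - Phi x) \<longlongrightarrow> - 0 * 0 - 0) at_bot"
      by (intro tendsto_diff tendsto_mult tendsto_minus phi_at_bot Phi_at_bot)
    then show "((\<lambda>x. - phi x / x - Phi x) \<longlongrightarrow> 0) at_bot" by (simp add: divide_inverse)
  qed (use x in \<open>auto simp: normal_density_nonneg\<close>)
  then show ?thesis using x by (simp add: field_simps)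
qed

text \<open>Of interest for negative \<open>x\<close>, where it complements
  \<open>mills_upper\<close>. The combination vanishes at minus infinity and has positive derivative
  on the whole line, so any right end \<open>b\<close> beyond \<open>x\<close> will do.\<close>

lemma mills_lower: "0 \<le> Phi x + x * phi x / (1 + x\<^sup>2)"
proof (rule nonneg_if_deriv_nonneg_at_bot[where b = "x + 1" and f = "\<lambda>x. Phi x + x * phi x / (1 + x\<^sup>2)" and f' = "\<lambda>x. 2 * phi x / (1 + x\<^sup>2)\<^sup>2"])
  fix x :: real
  have nz: "1 + x\<^sup>2 \<noteq> 0" by (simp add: add_nonneg_eq_0_iff)
  have "((\<lambda>x. Phi x + x * phi x / (1 + x\<^sup>2)) has_real_derivative
     phi x + ((phi x + x * (- x * phi x)) * (1 + x\<^sup>2) - x * phi x * (2 * x)) / ((1 + x\<^sup>2) * (1 + x\<^sup>2))) (at x)"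
    using nz by (auto intro!: derivative_eq_intros DERIV_phi DERIV_Phi)
  also have "phi x + ((phi x + x * (- x * phi x)) * (1 + x\<^sup>2) - x * phi x * (2 * x)) / ((1 + x\<^sup>2) * (1 + x\<^sup>2))
     = 2 * phi x / (1 + x\<^sup>2)\<^sup>2"
    using nz by (simp add: divide_simps) (simp add: power2_eq_square algebra_simps)
  finally show "((\<lambda>x. Phi x + x * phi x / (1 + x\<^sup>2)) has_real_derivative 2 * phi x / (1 + x\<^sup>2)\<^sup>2) (at x)" .
next
  have "((\<lambda>x. phi x * (x / (1 + x\<^sup>2))) \<longlongrightarrow> 0) at_bot"
  proof (rule Lim_null_comparison[OF _ phi_at_bot], intro always_eventually allI)
    fix x :: real
    have "\<bar>x\<bar> \<le> 1 + x\<^sup>2" using zero_le_power2[of "\<bar>x\<bar> - 1 / 2"] by (simp add: power2_eq_square algebra_simps)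
    then have "\<bar>x / (1 + x\<^sup>2)\<bar> \<le> 1" by (simp add: abs_divide divide_le_eq add_pos_nonneg)
    then have "phi x * \<bar>x / (1 + x\<^sup>2)\<bar> \<le> phi x * 1"
      by (intro mult_left_mono) (auto simp: normal_density_nonneg)
    moreover have "norm (phi x * (x / (1 + x\<^sup>2))) = phi x * \<bar>x / (1 + x\<^sup>2)\<bar>"
      by (simp only: real_norm_def abs_mult) (simp add: normal_density_nonneg)
    ultimately show "norm (phi x * (x / (1 + x\<^sup>2))) \<le> phi x" by (simp only: mult_1_right)
  qed
  from tendsto_add[OF Phi_at_bot this]
  show "((\<lambda>x. Phi x + x * phi x / (1 + x\<^sup>2)) \<longlongrightarrow> 0) at_bot" by (simp add: mult.commute)
qed (auto simp: normal_density_nonneg)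

text \<open>Mills' ratio of the lower tail. It solves \<open>y' = 1 + x * y\<close>, so
  \<open>mills'\<close> is its derivative; both branches of the solution of Stein's equation are
  multiples of it, up to reflection.\<close>

definition mills :: "real \<Rightarrow> real" where "mills x = Phi x / phi x"
definition mills' :: "real \<Rightarrow> real" where "mills' x = 1 + x * mills x"

lemma phi_mills': "phi x * mills' x = phi x + x * Phi x"
  using phi_pos[of x] by (simp add: mills'_def mills_def field_simps del: phi_pos)

lemma mills_nonneg: "0 \<le> mills x"
  by (simp add: mills_def normal_density_nonneg)

lemma DERIV_mills: "(mills has_real_derivative mills' x) (at x)"
proof -
  have "(mills has_real_derivative (phi x * phi x - Phi x * (- x * phi x)) / (phi x * phi x)) (at x)"
    unfolding mills_def[abs_def] using phi_pos[of x]
    by (auto intro!: derivative_eq_intros DERIV_phi DERIV_Phi simp del: phi_pos)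
  moreover have "(phi x * phi x - Phi x * (- x * phi x)) / (phi x * phi x) = mills' x"
    using phi_pos[of x] by (simp add: mills'_def mills_def divide_simps del: phi_pos) (simp add: algebra_simps)
  ultimately show ?thesis by simp
qed

lemma DERIV_mills': "(mills' has_real_derivative mills x + x * mills' x) (at x)"
  unfolding mills'_def[abs_def] by (auto intro!: derivative_eq_intros DERIV_mills simp: mills'_def)

lemma mills'_nonneg: "0 \<le> mills' x"
proof (cases "x < 0")
  case True
  then have "0 \<le> phi x * mills' x" unfolding phi_mills' using mills_upper[of x] by simp
  then show ?thesis by (simp add: zero_le_mult_iff normal_density_nonneg less_imp_neq[OF phi_pos, symmetric]) (use phi_pos[of x] in linarith)
next
  case False
  then show ?thesis by (simp add: mills'_def mills_nonneg)
qed

lemma mills'_le_neg: assumes "x \<le> 0" shows "mills' x \<le> 1 / (1 + x\<^sup>2)"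
proof -
  have p: "1 + x\<^sup>2 > 0" by (simp add: add_pos_nonneg)
  have "x * (Phi x + x * phi x / (1 + x\<^sup>2)) \<le> 0" using assms mills_lower[of x] by (simp add: mult_nonpos_nonneg)
  then have "phi x * mills' x \<le> phi x * (1 - x\<^sup>2 / (1 + x\<^sup>2))"
    unfolding phi_mills' by (simp add: algebra_simps power2_eq_square)
  then have "mills' x \<le> 1 - x\<^sup>2 / (1 + x\<^sup>2)" by simp
  also have "\<dots> = 1 / (1 + x\<^sup>2)" using p by (simp add: field_simps)
  finally show ?thesis .
qed

lemma mills'_le_nonneg: "0 \<le> x \<Longrightarrow> phi x * mills' x \<le> 1 + x"
  unfolding phi_mills' using phi_le_1[of x] mult_left_mono[OF Phi_le_1[of x], of x] by simp

lemma one_plus_div_one_plus_square_le: "0 \<le> (x::real) \<Longrightarrow> (1 + x) / (1 + x\<^sup>2) \<le> 2" "0 \<le> x \<Longrightarrow> x * ((1 + x) / (1 + x\<^sup>2)) \<le> 2"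
proof -
  have p: "1 + x\<^sup>2 > 0" by (simp add: add_pos_nonneg)
  have "0 \<le> (x - 1)\<^sup>2" by simp
  then have 2: "2 * x \<le> 1 + x\<^sup>2" by (simp add: power2_eq_square algebra_simps)
  show "0 \<le> x \<Longrightarrow> (1 + x) / (1 + x\<^sup>2) \<le> 2" "0 \<le> x \<Longrightarrow> x * ((1 + x) / (1 + x\<^sup>2)) \<le> 2"
    using p 2 zero_le_power2[of x] by (simp_all add: divide_le_eq distrib_left power2_eq_square[symmetric], linarith+)
qed

text \<open>For \<open>x \<ge> 0\<close> the growth of \<open>mills' x\<close>, at most
  \<open>(1 + x) / phi x\<close>, is offset by the decay \<open>1 / (1 + x\<^sup>2)\<close> of
  \<open>mills' (- x)\<close>. The product is invariant under reflection, which settles the other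
  half-line.\<close>

lemma phi_mills'_mills': "phi x * mills' x * mills' (- x) \<le> 2" "\<bar>x\<bar> * (phi x * mills' x * mills' (- x)) \<le> 2"
proof -
  have *: "phi x * mills' x * mills' (- x) \<le> (1 + x) / (1 + x\<^sup>2)" if "0 \<le> x" for x
    using mult_mono[OF mills'_le_nonneg[OF that] mills'_le_neg[of "- x"]] that mills'_nonneg[of "-x"] by simp
  have **: "phi x * mills' x * mills' (- x) \<le> 2" if "0 \<le> x" for x
    using *[OF that] one_plus_div_one_plus_square_le[OF that] by linarith
  have ***: "x * (phi x * mills' x * mills' (- x)) \<le> 2" if "0 \<le> x" for x
    using mult_left_mono[OF *[OF that] that] one_plus_div_one_plus_square_le[OF that] by linarith
  show "phi x * mills' x * mills' (- x) \<le> 2" using **[of x] **[of "- x"] by (cases "0 \<le> x") (auto simp: mult_ac)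
  show "\<bar>x\<bar> * (phi x * mills' x * mills' (- x)) \<le> 2"
    using ***[of x] ***[of "- x"] by (cases "0 \<le> x") (auto simp: mult_ac)
qed

lemma Phi_mills'_minus: "Phi x * mills' (- x) \<le> 2"
proof (cases "0 \<le> x")
  case True
  have "mills' (- x) \<le> 1 / (1 + x\<^sup>2)" using mills'_le_neg[of "- x"] True by simp
  also have "\<dots> \<le> 1" by (simp add: divide_le_eq add_pos_nonneg)
  finally show ?thesis using mult_mono[of "Phi x" 1 "mills' (- x)" 1] mills'_nonneg[of "- x"] by simp
next
  case False
  have "Phi x * mills' (- x) = Phi x + (- x * Phi x) / phi x * Phi (- x)"
    by (simp add: mills'_def mills_def algebra_simps)
  also have "(- x * Phi x) / phi x \<le> 1" using False mills_upper[of x] by (subst divide_le_eq) simp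
  then have "(- x * Phi x) / phi x * Phi (- x) \<le> 1 * 1"
    using False by (intro mult_mono) (auto intro!: divide_nonneg_pos mult_nonpos_nonneg)
  finally show ?thesis using Phi_le_1[of x] by linarith
qed

text \<open>Together with its reflection this bounds the derivative of Stein's solution by 1. The
  term that could grow is controlled by \<open>mills_upper\<close> for the opposite tail.\<close>

lemma Psi_mills': "Phi (- x) * mills' x \<le> 1"
proof -
  have "Phi (- x) * mills' x = Phi (- x) + x * Phi (- x) / phi x * Phi x"
    by (simp add: mills'_def mills_def algebra_simps)
  also have "x * Phi (- x) / phi x * Phi x \<le> Phi x"
  proof (cases "0 < x")
    case True
    then have "x * Phi (- x) / phi x \<le> 1" using mills_upper[of "- x"] by (simp add: divide_le_eq)
    from mult_right_mono[OF this Phi_nonneg[of x]] show ?thesis by simp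
  next
    case False
    then have "x * Phi (- x) / phi x \<le> 0" by (intro divide_nonpos_pos mult_nonpos_nonneg) auto
    then have "x * Phi (- x) / phi x * Phi x \<le> 0" by (intro mult_nonpos_nonneg) auto
    then show ?thesis using Phi_nonneg[of x] by linarith
  qed
  finally show ?thesis by (simp add: Phi_minus)
qed

text \<open>On \<open>[-1, 1]\<close> the density is at least \<open>phi 1\<close>; outside,
  \<open>mills_upper\<close> makes one of the two tails at most the density.\<close>

lemma Psi_mills: "Phi (- x) * mills x \<le> 1 / phi 1"
proof (cases "\<bar>x\<bar> \<le> 1")
  case True
  have "Phi (- x) * mills x = (Phi (- x) * Phi x) / phi x" by (simp add: mills_def)
  also have "\<dots> \<le> (1 * 1) / phi 1"
    using phi_decreasing[of x 1] True by (intro frac_le mult_mono) auto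
  finally show ?thesis by simp
next
  case False
  have *: "Phi (- x) * Phi x / phi x \<le> 1" if "x < -1" for x
  proof -
    have "1 * Phi x \<le> - x * Phi x" using that by (intro mult_right_mono) auto
    then have "Phi x \<le> phi x" using mills_upper[of x] that by simp
    then have "Phi (- x) * Phi x \<le> 1 * phi x" by (intro mult_mono) auto
    then show ?thesis by (simp add: divide_le_eq)
  qed
  have "x < -1 \<or> - x < -1" using False by auto
  then have "Phi (- x) * mills x \<le> 1" using *[of x] *[of "- x"] by (auto simp: mills_def mult.commute)
  also have "1 \<le> 1 / phi 1" using phi_le_1[of 1] by (simp add: le_divide_eq)
  finally show ?thesis .
qed

section \<open>Stein's equation\<close>

text \<open>The mean excess over \<open>x\<close> of a standard normal variable, that is, the
  integral of its upper tail over \<open>[x, \<infinity>)\<close>, as \<open>nn_integral_Psi\<close>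
  shows. In the form with \<open>mills'\<close>, its products with \<open>mills\<close> and
  \<open>mills'\<close> are visibly bounded.\<close>

definition tail_int :: "real \<Rightarrow> real" where "tail_int x = phi x * mills' (- x)"

lemma tail_int_eq: "tail_int x = phi x - x * Phi (- x)"
  using phi_mills'[of "- x"] by (simp add: tail_int_def)

lemma tail_int_nonneg: "0 \<le> tail_int x"
  by (simp add: tail_int_def mills'_nonneg normal_density_nonneg)

lemma DERIV_Phi_minus: "((\<lambda>x. Phi (- x)) has_real_derivative - phi x) (at x)"
  using DERIV_chain'[OF DERIV_minus[OF DERIV_ident] DERIV_Phi, of x] by simp

lemma DERIV_tail_int: "(tail_int has_real_derivative - Phi (- x)) (at x)"
  unfolding tail_int_eq[abs_def] by (auto intro!: derivative_eq_intros DERIV_phi DERIV_Phi_minus)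

lemma tail_int_antimono: "x \<le> y \<Longrightarrow> tail_int y \<le> tail_int x"
  by (rule DERIV_nonpos_imp_nonincreasing) (auto intro!: exI DERIV_tail_int)

lemma tail_int_at_top: "(tail_int \<longlongrightarrow> 0) at_top"
proof (rule Lim_null_comparison[OF _ phi_at_top])
  show "\<forall>\<^sub>F x in at_top. norm (tail_int x) \<le> phi x"
    using eventually_ge_at_top[of 0] by eventually_elim (use tail_int_nonneg in \<open>auto simp: tail_int_eq\<close>)
qed

lemma nn_integral_Psi: "(\<integral>\<^sup>+a. ennreal (Phi (- a)) * indicator {x..} a \<partial>lborel) = ennreal (tail_int x)"
proof -
  have "(\<integral>\<^sup>+a. ennreal (Phi (- a)) * indicator {x..} a \<partial>lborel) = 0 - (- tail_int x)"
    using tendsto_minus[OF tail_int_at_top]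
    by (intro nn_integral_FTC_atLeast[where F = "\<lambda>x. - tail_int x"]) (auto intro!: derivative_eq_intros DERIV_tail_int)
  then show ?thesis by simp
qed

lemma nn_integral_Phi: "(\<integral>\<^sup>+a. ennreal (Phi a) * indicator {..x} a \<partial>lborel) = ennreal (tail_int (- x))"
proof -
  have "(\<integral>\<^sup>+a. ennreal (Phi a) * indicator {..x} a \<partial>lborel)
     = (\<integral>\<^sup>+a. ennreal (Phi (- a)) * indicator {- x..} a \<partial>lborel)"
    by (subst nn_integral_real_affine[where c = "-1" and t = 0])
       (auto intro!: nn_integral_cong split: split_indicator)
  then show ?thesis by (simp add: nn_integral_Psi)
qed

text \<open>The bound \<open>P\<close> does not involve the level \<open>a\<close> of Stein's
  equation: it can be multiplied by \<open>Phi (- a)\<close>, or by the integral of that factor over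
  \<open>a\<close>, afterwards. The factor \<open>k\<close> is there because the Poisson parameter
  may exceed \<open>\<sigma>\<^sup>2\<close> by a fraction. The point \<open>p\<close> may be either
  end of the interval, since reflection exchanges the ends.\<close>

lemma mills_difference_quotient:
  assumes h: "0 < h" "h \<le> 1" and k: "1 \<le> k" "k \<le> 1 + h\<^sup>2" and p: "l \<le> p" "p \<le> l + h"
  obtains P where "0 \<le> P" "\<bar>mills' p - k * ((mills (l + h) - mills l) / h)\<bar> \<le> P"
    "tail_int (l + h) * P \<le> 6 * h" "Phi (- (l + h)) * P \<le> h * (1 / phi 1 + \<bar>l\<bar> + 2)"
proof -
  obtain v where v: "l < v" "v < l + h" "mills (l + h) - mills l = (l + h - l) * mills' v"
    using MVT2[of l "l + h" mills mills'] h DERIV_mills by auto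
  obtain z where z: "l \<le> z" "z \<le> l + h" "\<bar>mills' p - mills' v\<bar> \<le> h * \<bar>mills z + z * mills' z\<bar>"
  proof -
    \<comment> \<open>A second mean value step, for the derivative of \<open>mills'\<close>; it is
      stated for arbitrary ends because \<open>p\<close> may lie on either side of
      \<open>v\<close>.\<close>
    have *: "\<exists>z. a < z \<and> z < b \<and> \<bar>mills' b - mills' a\<bar> \<le> h * \<bar>mills z + z * mills' z\<bar>"
      if ab: "a < b" "b - a \<le> h" for a b
    proof -
      obtain z where z: "a < z" "z < b" "mills' b - mills' a = (b - a) * (mills z + z * mills' z)"
        using MVT2[of a b mills' "\<lambda>x. mills x + x * mills' x"] ab(1) DERIV_mills' by blast
      have "\<bar>mills' b - mills' a\<bar> \<le> h * \<bar>mills z + z * mills' z\<bar>"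
        unfolding z(3) abs_mult using ab by (intro mult_right_mono) auto
      then show ?thesis using z by blast
    qed
    consider "p = v" | "p < v" | "v < p" by linarith
    then show thesis
    proof cases
      case 1 then show ?thesis using that[of v] v h by simp
    next
      case 2
      then obtain z where "p < z" "z < v" "\<bar>mills' v - mills' p\<bar> \<le> h * \<bar>mills z + z * mills' z\<bar>" using *[of p v] v p by auto
      then show ?thesis using that[of z] v p by (simp add: abs_minus_commute)
    next
      case 3
      then obtain z where "v < z" "z < p" "\<bar>mills' p - mills' v\<bar> \<le> h * \<bar>mills z + z * mills' z\<bar>" using *[of v p] v p by auto
      then show ?thesis using that[of z] v p by simp
    qed
  qed
  define D where "D = mills z + \<bar>z\<bar> * mills' z"
  have D: "\<bar>mills z + z * mills' z\<bar> \<le> D" "0 \<le> D"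
    using mills_nonneg[of z] mills'_nonneg[of z] by (auto simp: D_def abs_mult intro!: order_trans[OF abs_triangle_ineq])
  define P where "P = h * D + h\<^sup>2 * mills' v"
  have P0: "0 \<le> P" using D h mills'_nonneg by (simp add: P_def)
  have h2: "h\<^sup>2 \<le> h" using h by (simp add: power2_eq_square mult_left_le)
  show thesis
  proof
    show "0 \<le> P" by (rule P0)
    have "\<bar>mills' p - k * mills' v\<bar> \<le> \<bar>mills' p - mills' v\<bar> + (k - 1) * mills' v"
      using mult_nonneg_nonneg[of "k - 1" "mills' v"] mills'_nonneg[of v] k by (auto simp: algebra_simps)
    also have "\<bar>mills' p - mills' v\<bar> \<le> h * D" using z(3) mult_left_mono[OF D(1), of h] h by linarith
    also have "(k - 1) * mills' v \<le> h\<^sup>2 * mills' v" using k mills'_nonneg by (intro mult_right_mono) auto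
    finally show "\<bar>mills' p - k * ((mills (l + h) - mills l) / h)\<bar> \<le> P" using v(3) h by (simp add: P_def)
  next
    have 1: "tail_int z * D \<le> 4"
    proof -
      have "tail_int z * mills z = Phi z * mills' (- z)" using phi_pos[of z] by (simp add: tail_int_def mills_def del: phi_pos)
      then have "tail_int z * mills z \<le> 2" using Phi_mills'_minus[of z] by simp
      moreover have "tail_int z * (\<bar>z\<bar> * mills' z) \<le> 2" using phi_mills'_mills'(2)[of z] by (simp add: tail_int_def mult_ac)
      ultimately show ?thesis by (simp add: D_def distrib_left)
    qed
    have 2: "tail_int v * mills' v \<le> 2" using phi_mills'_mills'(1)[of v] by (simp add: tail_int_def mult_ac)
    have "tail_int (l + h) * P = h * (tail_int (l + h) * D) + h\<^sup>2 * (tail_int (l + h) * mills' v)" by (simp add: P_def algebra_simps)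
    also have "\<dots> \<le> h * (tail_int z * D) + h * (tail_int v * mills' v)"
      using h h2 D mills'_nonneg[of v] z v by (intro add_mono mult_mono mult_nonneg_nonneg tail_int_antimono tail_int_nonneg) auto
    also have "\<dots> \<le> h * 4 + h * 2" using h 1 2 by (intro add_mono mult_left_mono) auto
    finally show "tail_int (l + h) * P \<le> 6 * h" by simp
  next
    have 1: "Phi (- z) * D \<le> 1 / phi 1 + \<bar>z\<bar>"
    proof -
      have "Phi (- z) * (\<bar>z\<bar> * mills' z) \<le> \<bar>z\<bar>"
        using mult_left_mono[OF Psi_mills'[of z], of "\<bar>z\<bar>"] by (simp add: mult_ac)
      then show ?thesis using Psi_mills[of z] by (simp add: D_def distrib_left)
    qed
    have "Phi (- (l + h)) * P = h * (Phi (- (l + h)) * D) + h\<^sup>2 * (Phi (- (l + h)) * mills' v)"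
      by (simp add: P_def algebra_simps)
    also have "\<dots> \<le> h * (Phi (- z) * D) + h * (Phi (- v) * mills' v)"
      using h h2 D mills'_nonneg[of v] z v by (intro add_mono mult_mono mult_nonneg_nonneg Phi_mono) auto
    also have "\<dots> \<le> h * (1 / phi 1 + \<bar>z\<bar>) + h * 1" using h 1 Psi_mills'[of v] by (intro add_mono mult_left_mono) auto
    also have "\<dots> = h * (1 / phi 1 + \<bar>z\<bar> + 1)" by (simp add: algebra_simps)
    also have "\<dots> \<le> h * (1 / phi 1 + \<bar>l\<bar> + 2)" using h z by (intro mult_left_mono) auto
    finally show "Phi (- (l + h)) * P \<le> h * (1 / phi 1 + \<bar>l\<bar> + 2)" .
  qed
qed

definition stein :: "real \<Rightarrow> real \<Rightarrow> real" where
  "stein a x = (if x \<le> a then Phi (- a) * mills x else Phi a * mills (- x))"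

text \<open>\<open>stein a\<close> has a kink at \<open>a\<close>; taking the left derivative there
  makes Stein's equation hold at every point, for the indicator of the closed half-line.\<close>

definition stein' :: "real \<Rightarrow> real \<Rightarrow> real" where
  "stein' a x = (if x \<le> a then Phi (- a) * mills' x else - (Phi a * mills' (- x)))"

lemma stein_equation: "stein' a x - x * stein a x = (if x \<le> a then 1 else 0) - Phi a"
  by (simp add: stein_def stein'_def mills'_def Phi_minus algebra_simps)

lemma stein_alt: "a \<le> x \<Longrightarrow> stein a x = Phi a * mills (- x)"
  by (auto simp: stein_def mills_def)

lemma stein_nonneg: "0 \<le> stein a x"
  by (simp add: stein_def mills_nonneg)

lemma stein_le: "stein a x \<le> 1 / phi 1"
proof (cases "x \<le> a")
  case True
  then have "Phi (- a) * mills x \<le> Phi (- x) * mills x" by (intro mult_right_mono Phi_mono mills_nonneg) auto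
  then show ?thesis using Psi_mills[of x] True by (simp add: stein_def)
next
  case False
  then have "Phi a * mills (- x) \<le> Phi x * mills (- x)" by (intro mult_right_mono Phi_mono mills_nonneg) auto
  then show ?thesis using Psi_mills[of "- x"] False by (simp add: stein_def)
qed

lemma Psi_mills'_le: "x \<le> a \<Longrightarrow> Phi (- a) * mills' x \<le> 1"
  using mult_right_mono[OF Phi_mono[of "- a" "- x"] mills'_nonneg[of x]] Psi_mills'[of x] by simp

lemma abs_stein'_le: "\<bar>stein' a x\<bar> \<le> 1"
  using Psi_mills'_le[of x a] Psi_mills'_le[of "- x" "- a"] mult_nonneg_nonneg[OF Phi_nonneg mills'_nonneg, of "- a" x]
    mult_nonneg_nonneg[OF Phi_nonneg mills'_nonneg, of a "- x"]
  by (auto simp: stein'_def)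

lemma stein_lipschitz_left:
  assumes "x \<le> y" "y \<le> a" shows "\<bar>stein a y - stein a x\<bar> \<le> y - x"
proof (cases "x = y")
  case False
  then obtain v where v: "x < v" "v < y" "mills y - mills x = (y - x) * mills' v"
    using MVT2[of x y mills mills'] assms DERIV_mills by auto
  have "stein a y - stein a x = (y - x) * (Phi (- a) * mills' v)"
    using assms v(3) by (simp add: stein_def right_diff_distrib[symmetric])
  moreover have "0 \<le> Phi (- a) * mills' v" "Phi (- a) * mills' v \<le> 1"
    using Psi_mills'_le[of v a] v assms mills'_nonneg by auto
  ultimately show ?thesis using assms by (simp add: abs_mult mult_left_le)
qed auto

lemma stein_lipschitz_right:
  assumes "x \<le> y" "a \<le> x" shows "\<bar>stein a y - stein a x\<bar> \<le> y - x"
proof -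
  have "stein a z = stein (- a) (- z)" if "a \<le> z" for z
    using that by (simp add: stein_alt[OF that] stein_def mills_def mult.commute)
  then show ?thesis
    using stein_lipschitz_left[of "- y" "- x" "- a"] assms by (simp add: abs_minus_commute)
qed

lemma stein_lipschitz:
  assumes "x \<le> y" shows "\<bar>stein a y - stein a x\<bar> \<le> y - x"
  using stein_lipschitz_left[of x y a] stein_lipschitz_right[of x y a]
    stein_lipschitz_left[of x a a] stein_lipschitz_right[of a y a] assms
  by (cases "y \<le> a"; cases "a \<le> x") auto

text \<open>What remains of Stein's equation when the derivative is replaced by a forward difference
  quotient with weight \<open>k\<close>. Its Poisson mean is the error in the distribution function,
  by \<open>pn_stein_err_sums\<close>.\<close>

definition stein_err :: "real \<Rightarrow> real \<Rightarrow> real \<Rightarrow> real \<Rightarrow> real" where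
  "stein_err h k a x = stein' a x - k * ((stein a (x + h) - stein a x) / h)"

lemma stein_err_le_3:
  assumes h: "0 < h" "h \<le> 1" and k: "1 \<le> k" "k \<le> 1 + h\<^sup>2"
  shows "\<bar>stein_err h k a x\<bar> \<le> 3"
proof -
  have "k \<le> 2" using k h power_le_one[of h 2] by simp
  have "\<bar>(stein a (x + h) - stein a x) / h\<bar> \<le> 1"
    using stein_lipschitz[of x "x + h" a] h by (simp add: abs_divide)
  then have "\<bar>k * ((stein a (x + h) - stein a x) / h)\<bar> \<le> 2 * 1"
    unfolding abs_mult using k \<open>k \<le> 2\<close> by (intro mult_mono) auto
  then show ?thesis unfolding stein_err_def using abs_stein'_le[of a x] by linarith
qed

lemma stein_err_bounds:
  assumes h: "0 < h" "h \<le> 1" and k: "1 \<le> k" "k \<le> 1 + h\<^sup>2"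
  obtains P Q where "0 \<le> P" "0 \<le> Q"
    "\<forall>a. x + h \<le> a \<longrightarrow> \<bar>stein_err h k a x\<bar> \<le> Phi (- a) * P"
    "\<forall>a. a < x \<longrightarrow> \<bar>stein_err h k a x\<bar> \<le> Phi a * Q"
    "tail_int (x + h) * P \<le> 6 * h" "tail_int (- x) * Q \<le> 6 * h"
    "Phi (- (x + h)) * P \<le> h * (1 / phi 1 + \<bar>x\<bar> + 3)" "Phi x * Q \<le> h * (1 / phi 1 + \<bar>x\<bar> + 3)"
proof -
  obtain P where P: "0 \<le> P" "\<bar>mills' x - k * ((mills (x + h) - mills x) / h)\<bar> \<le> P"
    "tail_int (x + h) * P \<le> 6 * h" "Phi (- (x + h)) * P \<le> h * (1 / phi 1 + \<bar>x\<bar> + 2)"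
    using mills_difference_quotient[OF h k, of x x] h by auto
  \<comment> \<open>Right of \<open>a\<close> the branch is a reflection, so the forward step from
    \<open>x\<close> becomes the interval from \<open>- x - h\<close> to \<open>- x\<close>, with
    the derivative taken at its right end.\<close>
  obtain Q where Q: "0 \<le> Q" "\<bar>mills' (- x) - k * ((mills (- x) - mills (- x - h)) / h)\<bar> \<le> Q"
    "tail_int (- x) * Q \<le> 6 * h" "Phi x * Q \<le> h * (1 / phi 1 + \<bar>- x - h\<bar> + 2)"
    using mills_difference_quotient[OF h k, of "- x - h" "- x"] h by auto
  show thesis
  proof (rule that[OF P(1) Q(1)])
    show "\<forall>a. x + h \<le> a \<longrightarrow> \<bar>stein_err h k a x\<bar> \<le> Phi (- a) * P"
    proof (intro allI impI)
    fix a assume a: "x + h \<le> a"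
    have "stein_err h k a x = Phi (- a) * (mills' x - k * ((mills (x + h) - mills x) / h))"
      using a h by (simp add: stein_err_def stein_def stein'_def right_diff_distrib diff_divide_distrib mult_ac)
    then show "\<bar>stein_err h k a x\<bar> \<le> Phi (- a) * P" using P(2) by (simp add: abs_mult mult_left_mono)
    qed
    show "\<forall>a. a < x \<longrightarrow> \<bar>stein_err h k a x\<bar> \<le> Phi a * Q"
    proof (intro allI impI)
    fix a assume a: "a < x"
    have "stein_err h k a x = - (Phi a * (mills' (- x) - k * ((mills (- x) - mills (- x - h)) / h)))"
      using a h by (simp add: stein_err_def stein_def stein'_def right_diff_distrib diff_divide_distrib mult_ac)
    then show "\<bar>stein_err h k a x\<bar> \<le> Phi a * Q" using Q(2) by (simp add: abs_mult mult_left_mono)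
    qed
    show "Phi (- (x + h)) * P \<le> h * (1 / phi 1 + \<bar>x\<bar> + 3)"
      using P(4) h by (simp add: algebra_simps)
    have "h * (1 / phi 1 + \<bar>- x - h\<bar> + 2) \<le> h * (1 / phi 1 + \<bar>x\<bar> + 3)" using h by (intro mult_left_mono) auto
    then show "Phi x * Q \<le> h * (1 / phi 1 + \<bar>x\<bar> + 3)" using Q(4) by linarith
  qed (use P Q in auto)
qed

lemma borel_measurable_mills [measurable]: "mills \<in> borel_measurable borel"
  unfolding mills_def[abs_def] by measurable

lemma borel_measurable_stein_err [measurable]: "(\<lambda>a. stein_err h k a x) \<in> borel_measurable borel"
  unfolding stein_err_def stein_def stein'_def by measurable

text \<open>If the step from \<open>x\<close> to \<open>x + h\<close> straddles the kink at
  \<open>a\<close>, only the constant bound 3 is available; that range of \<open>x\<close> is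
  half-open of length \<open>h\<close>, so a lattice of span \<open>h\<close> meets it at most
  once.\<close>

lemma stein_err_pointwise:
  assumes h: "0 < h" "h \<le> 1" and k: "1 \<le> k" "k \<le> 1 + h\<^sup>2"
  shows "\<bar>stein_err h k a x\<bar> \<le> h * (1 / phi 1 + \<bar>x\<bar> + 3) + (if a - h < x \<and> x \<le> a then 3 else 0)"
proof -
  obtain P Q where PQ: "0 \<le> P" "0 \<le> Q"
    "\<forall>a. x + h \<le> a \<longrightarrow> \<bar>stein_err h k a x\<bar> \<le> Phi (- a) * P"
    "\<forall>a. a < x \<longrightarrow> \<bar>stein_err h k a x\<bar> \<le> Phi a * Q"
    "tail_int (x + h) * P \<le> 6 * h" "tail_int (- x) * Q \<le> 6 * h"
    "Phi (- (x + h)) * P \<le> h * (1 / phi 1 + \<bar>x\<bar> + 3)" "Phi x * Q \<le> h * (1 / phi 1 + \<bar>x\<bar> + 3)"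
    by (rule stein_err_bounds[where x = x, OF assms])
  have p: "0 \<le> h * (1 / phi 1 + \<bar>x\<bar> + 3)" using h by (intro mult_nonneg_nonneg add_nonneg_nonneg) auto
  consider "x + h \<le> a" | "a < x" | "a - h < x \<and> x \<le> a" by linarith
  then show ?thesis
  proof cases
    case 1
    have "Phi (- a) * P \<le> Phi (- (x + h)) * P" using 1 PQ by (intro mult_right_mono Phi_mono) auto
    then show ?thesis using PQ(3)[rule_format, OF 1] PQ(7) by auto
  next
    case 2
    have "Phi a * Q \<le> Phi x * Q" using 2 PQ by (intro mult_right_mono Phi_mono) auto
    then show ?thesis using PQ(4)[rule_format, OF 2] PQ(8) by auto
  next
    case 3
    show ?thesis unfolding if_P[OF 3] using stein_err_le_3[OF assms, of a x] p by linarith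
  qed
qed

text \<open>For fixed \<open>x\<close> it is the level \<open>a\<close> that is integrated: the two
  tails contribute \<open>6 * h\<close> each and the interval \<open>[x, x + h]\<close> at most
  \<open>3 * h\<close>.\<close>

lemma nn_integral_stein_err:
  assumes h: "0 < h" "h \<le> 1" and k: "1 \<le> k" "k \<le> 1 + h\<^sup>2"
  shows "(\<integral>\<^sup>+a. ennreal \<bar>stein_err h k a x\<bar> \<partial>lborel) \<le> ennreal (15 * h)"
proof -
  obtain P Q where PQ: "0 \<le> P" "0 \<le> Q"
    "\<forall>a. x + h \<le> a \<longrightarrow> \<bar>stein_err h k a x\<bar> \<le> Phi (- a) * P"
    "\<forall>a. a < x \<longrightarrow> \<bar>stein_err h k a x\<bar> \<le> Phi a * Q"
    "tail_int (x + h) * P \<le> 6 * h" "tail_int (- x) * Q \<le> 6 * h"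
    "Phi (- (x + h)) * P \<le> h * (1 / phi 1 + \<bar>x\<bar> + 3)" "Phi x * Q \<le> h * (1 / phi 1 + \<bar>x\<bar> + 3)"
    by (rule stein_err_bounds[where x = x, OF assms])
  have "(\<integral>\<^sup>+a. ennreal \<bar>stein_err h k a x\<bar> \<partial>lborel) \<le>
    (\<integral>\<^sup>+a. ennreal P * (ennreal (Phi (- a)) * indicator {x + h..} a)
       + (ennreal Q * (ennreal (Phi a) * indicator {..x} a) + 3 * indicator {x..x + h} a) \<partial>lborel)"
  proof (rule nn_integral_mono)
    fix a
    consider "x + h \<le> a" | "a < x" | "x \<le> a" "a < x + h" by linarith
    then show "ennreal \<bar>stein_err h k a x\<bar> \<le> ennreal P * (ennreal (Phi (- a)) * indicator {x + h..} a)
       + (ennreal Q * (ennreal (Phi a) * indicator {..x} a) + 3 * indicator {x..x + h} a)"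
    proof cases
      case 1
      have "ennreal \<bar>stein_err h k a x\<bar> \<le> ennreal P * (ennreal (Phi (- a)) * indicator {x + h..} a)"
        using PQ(3)[rule_format, OF 1] PQ(1) 1 by (simp add: ennreal_mult[symmetric] ennreal_leI mult.commute)
      then show ?thesis by (rule order_trans) simp
    next
      case 2
      have "ennreal \<bar>stein_err h k a x\<bar> \<le> ennreal Q * (ennreal (Phi a) * indicator {..x} a)"
        using PQ(4)[rule_format, OF 2] PQ(2) 2 by (simp add: ennreal_mult[symmetric] ennreal_leI mult.commute)
      then show ?thesis by (rule order_trans) (simp add: add_increasing add_increasing2)
    next
      case 3
      have "ennreal \<bar>stein_err h k a x\<bar> \<le> ennreal 3" using stein_err_le_3[OF assms, of a x] by (rule ennreal_leI)
      also have "\<dots> = 3 * indicator {x..x + h} a" using 3 by simp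
      finally show ?thesis by (rule order_trans) (simp add: add_increasing add_increasing2)
    qed
  qed
  also have "\<dots> = ennreal P * ennreal (tail_int (x + h)) + (ennreal Q * ennreal (tail_int (- x)) + 3 * ennreal h)"
    using h by (simp add: nn_integral_add nn_integral_cmult nn_integral_Psi nn_integral_Phi)
  also have "\<dots> = ennreal (P * tail_int (x + h) + (Q * tail_int (- x) + 3 * h))"
    using PQ h tail_int_nonneg by (simp add: ennreal_mult ennreal_plus)
  also have "\<dots> \<le> ennreal (15 * h)"
    using PQ by (intro ennreal_leI) (simp add: mult.commute)
  finally show ?thesis .
qed

section \<open>Normal approximation of the translated Poisson law\<close>

abbreviation pn :: "real \<Rightarrow> nat \<Rightarrow> real" where "pn a n \<equiv> pois a (int n)"

lemma pn_Suc: "real (Suc n) * pn a (Suc n) = a * pn a n"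
  by (simp add: pois_def nat_add_distrib divide_simps)

text \<open>The Stein-Chen identity of the Poisson law, from the recursion \<open>pn_Suc\<close>;
  the term \<open>n = 0\<close> vanishes, so shifting the series loses nothing.\<close>

lemma pn_stein_sums:
  assumes "(\<lambda>n. pn a n * g (Suc n)) sums s"
  shows "(\<lambda>n. real n * pn a n * g n) sums (a * s)"
proof -
  have "(\<lambda>n. a * (pn a n * g (Suc n))) sums (a * s)" by (intro sums_mult assms)
  also have "(\<lambda>n. a * (pn a n * g (Suc n))) = (\<lambda>n. real (Suc n) * pn a (Suc n) * g (Suc n))"
    unfolding pn_Suc by (simp add: mult.assoc)
  finally show ?thesis by (subst (asm) sums_Suc_iff) simp
qed

text \<open>Two applications of the Stein-Chen identity, with \<open>g = 1\<close> and with
  \<open>g n = n\<close>.\<close>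

lemma pn_variance_sums:
  assumes "0 \<le> a" shows "(\<lambda>n. pn a n * (real n - a)\<^sup>2) sums a"
proof -
  have 1: "(\<lambda>n. pn a n * 1) sums 1" using pois_sums[of a] by simp
  have 2: "(\<lambda>n. real n * pn a n * 1) sums (a * 1)" by (rule pn_stein_sums) (rule 1)
  have "(\<lambda>n. real n * pn a n + pn a n) sums (a * 1 + 1)"
    using sums_add[OF 2 1] by simp
  then have "(\<lambda>n. pn a n * real (Suc n)) sums (a + 1)" by (simp add: algebra_simps)
  then have 3: "(\<lambda>n. real n * pn a n * real n) sums (a * (a + 1))" by (rule pn_stein_sums)
  have "(\<lambda>n. real n * pn a n * real n - 2 * a * (real n * pn a n * 1) + a\<^sup>2 * (pn a n * 1))
     sums (a * (a + 1) - 2 * a * (a * 1) + a\<^sup>2 * 1)"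
    by (intro sums_add sums_diff sums_mult 1 2 3)
  moreover have "a * (a + 1) - 2 * a * (a * 1) + a\<^sup>2 * 1 = a"
    by (simp add: power2_eq_square algebra_simps)
  ultimately show ?thesis by (simp add: power2_eq_square algebra_simps)
qed

lemma pn_bounded_summable:
  assumes "0 \<le> a" "\<And>n. \<bar>g n\<bar> \<le> C" shows "summable (\<lambda>n. pn a n * g n)"
proof (rule summable_comparison_test')
  show "summable (\<lambda>n. pn a n * C)" using pois_sums[of a] by (intro summable_mult2) (rule sums_summable)
  show "norm (pn a n * g n) \<le> pn a n * C" for n
    using assms pois_nonneg[OF assms(1), of n] by (simp add: abs_mult mult_left_mono)
qed

text \<open>For a Poisson variable with mean \<open>l\<close>, centred and scaled by
  \<open>h\<close> to \<open>X\<close>, the Stein-Chen identity turns the mean of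
  \<open>X * f X\<close> into \<open>l * h\<close> times that of \<open>f (X + h) - f X\<close>.
  Hence the weight \<open>l * h\<^sup>2\<close> in \<open>stein_err\<close>.\<close>

lemma pn_stein_err_sums:
  assumes h: "0 < h" "h \<le> 1" and l: "0 \<le> l" and k: "1 \<le> l * h\<^sup>2" "l * h\<^sup>2 \<le> 1 + h\<^sup>2"
  shows "(\<lambda>n. pn l n * stein_err h (l * h\<^sup>2) a ((real n - l) * h))
    sums ((\<Sum>n. if (real n - l) * h \<le> a then pn l n else 0) - Phi a)"
proof -
  define X where "X n = (real n - l) * h" for n
  define f where "f n = stein a (X n)" for n
  have X: "X (Suc n) = X n + h" for n by (simp add: X_def algebra_simps)
  have fb: "\<bar>f n\<bar> \<le> 1 / phi 1" for n using stein_nonneg stein_le by (simp add: f_def)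
  define s where "s = (\<Sum>n. pn l n * f n)"
  define t where "t = (\<Sum>n. pn l n * f (Suc n))"
  have s: "(\<lambda>n. pn l n * f n) sums s"
    unfolding s_def by (intro summable_sums pn_bounded_summable[OF l fb])
  have t: "(\<lambda>n. pn l n * f (Suc n)) sums t"
    unfolding t_def by (intro summable_sums pn_bounded_summable[OF l fb])
  have nt: "(\<lambda>n. real n * pn l n * f n) sums (l * t)" by (rule pn_stein_sums[OF t])
  define u where "u = (\<Sum>n. if X n \<le> a then pn l n else 0)"
  have u: "(\<lambda>n. if X n \<le> a then pn l n else 0) sums u"
  proof -
    have "summable (\<lambda>n. pn l n * (if X n \<le> a then 1 else 0))"
      by (rule pn_bounded_summable[OF l, where C = 1]) auto
    then show ?thesis unfolding u_def by (intro summable_sums) (simp add: if_distrib cong: if_cong)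
  qed
  have "(\<lambda>n. (if X n \<le> a then pn l n else 0) - Phi a * pn l n
       + h * (real n * pn l n * f n - l * (pn l n * f n)) - l * h * (pn l n * f (Suc n) - pn l n * f n))
     sums (u - Phi a * 1 + h * (l * t - l * s) - l * h * (t - s))"
    by (intro sums_add sums_diff sums_mult u s t nt pois_sums)
  moreover have "(if X n \<le> a then pn l n else 0) - Phi a * pn l n
       + h * (real n * pn l n * f n - l * (pn l n * f n)) - l * h * (pn l n * f (Suc n) - pn l n * f n)
     = pn l n * stein_err h (l * h\<^sup>2) a (X n)" for n
  proof -
    have "stein' a (X n) = X n * f n + (if X n \<le> a then 1 else 0) - Phi a"
      using stein_equation[of a "X n"] by (simp add: f_def)
    then have "stein_err h (l * h\<^sup>2) a (X n) = X n * f n + (if X n \<le> a then 1 else 0) - Phi a - l * h * (f (Suc n) - f n)"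
      using h by (simp add: stein_err_def f_def X power2_eq_square)
    then have "pn l n * stein_err h (l * h\<^sup>2) a (X n)
      = pn l n * (X n * f n + (if X n \<le> a then 1 else 0) - Phi a - l * h * (f (Suc n) - f n))" by simp
    also have "\<dots> = (if X n \<le> a then pn l n else 0) - Phi a * pn l n
       + h * (real n * pn l n * f n - l * (pn l n * f n)) - l * h * (pn l n * f (Suc n) - pn l n * f n)"
      by (cases "X n \<le> a") (auto simp: X_def algebra_simps)
    finally show ?thesis by simp
  qed
  moreover have "u - Phi a * 1 + h * (l * t - l * s) - l * h * (t - s) = u - Phi a" by (simp add: algebra_simps)
  ultimately have "(\<lambda>n. pn l n * stein_err h (l * h\<^sup>2) a (X n)) sums (u - Phi a)" by (simp only:)
  then show ?thesis by (simp only: X_def u_def)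
qed

definition pois_df :: "real \<Rightarrow> real \<Rightarrow> real \<Rightarrow> real" where
  "pois_df l h a = (\<Sum>n. if (real n - l) * h \<le> a then pn l n else 0)"

text \<open>The first difference has 1-norm of order \<open>1 / sqrt l\<close>, and
  \<open>l1bnd_sup_le_fdiff\<close> makes this a bound on the atoms.\<close>

lemma pn_le: assumes "1 \<le> l" shows "pn l n \<le> sqrt (16 * exp 2 / l)"
proof -
  have "l1bnd 1 (sqrt (16 * real 1 * exp 2 / l) ^ 1) (pois l)"
  proof (rule l1bnd_sup_le_fdiff)
    show "l1bnd n 1 (pois l)" for n
      using pois_has_sum[of l] pois_nonneg[of l] assms by (intro l1bnd_if_has_sum) auto
    fix n
    have "l1bnd (max n 1) (sqrt (16 * real 1 * exp 2 / l) ^ 1) ((fdiff ^^ 1) (pois l))"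
      using assms by (intro l1bnd_fdiff_pow_pois) auto
    then show "l1bnd n (sqrt (16 * real 1 * exp 2 / l) ^ 1) (fdiff (pois l))"
      by (simp add: l1bnd_le_n)
  qed
  from l1bnd_pointwise[OF this, of "int n"] show ?thesis by auto
qed

text \<open>The factor \<open>\<bar>x\<bar>\<close> of the pointwise error is bounded by
  \<open>1 + x\<^sup>2\<close> and averaged by means of the variance; the constant error at the kink
  concerns at most one atom, of mass at most \<open>4 * exp 1 * h\<close> by
  \<open>pn_le\<close>.\<close>

lemma pois_df_Phi_sup:
  assumes h: "0 < h" "h \<le> 1" and l: "0 \<le> l" and k: "1 \<le> l * h\<^sup>2" "l * h\<^sup>2 \<le> 1 + h\<^sup>2"
  shows "\<bar>pois_df l h a - Phi a\<bar> \<le> (1 / phi 1 + 6 + 12 * exp 1) * h"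
proof -
  define X where "X n = (real n - l) * h" for n
  have l1: "1 \<le> l"
  proof -
    have "l * h\<^sup>2 \<le> l * 1" using l h by (intro mult_left_mono power_le_one) auto
    then show ?thesis using k by simp
  qed
  have 1: "(\<lambda>n. pn l n * stein_err h (l * h\<^sup>2) a (X n)) sums (pois_df l h a - Phi a)"
    using pn_stein_err_sums[OF assms] by (simp add: X_def pois_df_def)
  define ind where "ind n = (if a - h < X n \<and> X n \<le> a then 1 else (0::real))" for n
  define b where "b n = h * ((1 / phi 1 + 4) * pn l n + h\<^sup>2 * (pn l n * (real n - l)\<^sup>2)) + 3 * (pn l n * ind n)" for n
  have at: "ind n \<noteq> 0 \<Longrightarrow> ind m \<noteq> 0 \<Longrightarrow> m = n" for m n
  proof -
    assume "ind n \<noteq> 0" "ind m \<noteq> 0"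
    then have "\<bar>X m - X n\<bar> < h" by (auto simp: ind_def split: if_splits)
    moreover have "X m - X n = (real m - real n) * h" by (simp add: X_def algebra_simps)
    ultimately have "\<bar>real m - real n\<bar> * h < 1 * h" using h by (simp add: abs_mult)
    then have "\<bar>real m - real n\<bar> < 1" using h by simp
    then show "m = n" by linarith
  qed
  obtain s where s: "(\<lambda>n. pn l n * ind n) sums s" "s \<le> 4 * exp 1 * h"
  proof -
    have p: "pn l n \<le> 4 * exp 1 * h" for n
    proof -
      have "sqrt (16 * exp 2 / l) \<le> sqrt ((4 * exp 1 * h)\<^sup>2)"
      proof (rule real_sqrt_le_mono)
        have "1 / l \<le> h\<^sup>2" using k l1 by (simp add: divide_le_eq mult.commute)
        then have "16 * exp 2 * (1 / l) \<le> 16 * exp 2 * h\<^sup>2" by (intro mult_left_mono) auto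
        also have "16 * exp 2 * h\<^sup>2 = (4 * exp 1 * h)\<^sup>2"
          using exp_double[of "1::real"] by (simp add: power_mult_distrib)
        also have "16 * exp 2 * (1 / l) = 16 * exp 2 / l" by simp
        finally show "16 * exp 2 / l \<le> (4 * exp 1 * h)\<^sup>2" .
      qed
      also have "\<dots> = 4 * exp 1 * h" using h by simp
      finally show ?thesis using pn_le[OF l1, of n] by simp
    qed
    show thesis
    proof (cases "\<exists>n. ind n \<noteq> 0")
      case True
      then obtain n where n: "ind n \<noteq> 0" by blast
      have "(\<lambda>m. pn l m * ind m) sums (\<Sum>m\<in>{n}. pn l m * ind m)"
        using at[OF n] by (intro sums_finite) auto
      moreover have "pn l n * ind n \<le> 4 * exp 1 * h" using n p[of n] by (simp add: ind_def split: if_splits)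
      ultimately show ?thesis using that by simp
    next
      case False
      then show ?thesis using that[of 0] h by simp
    qed
  qed
  have bs: "b sums (h * ((1 / phi 1 + 4) * 1 + h\<^sup>2 * l) + 3 * s)"
    unfolding b_def[abs_def]
    by (intro sums_add sums_mult pois_sums pn_variance_sums l s)
  have le: "norm (pn l n * stein_err h (l * h\<^sup>2) a (X n)) \<le> b n" for n
  proof -
    have "\<bar>X n\<bar> \<le> 1 + (X n)\<^sup>2"
      using zero_le_power2[of "\<bar>X n\<bar> - 1 / 2"] by (simp add: power2_eq_square algebra_simps)
    then have "h * (1 / phi 1 + \<bar>X n\<bar> + 3) \<le> h * (1 / phi 1 + (1 + (X n)\<^sup>2) + 3)" using h by (intro mult_left_mono) auto
    then have "\<bar>stein_err h (l * h\<^sup>2) a (X n)\<bar> \<le> h * (1 / phi 1 + 4 + (X n)\<^sup>2) + 3 * ind n"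
      using stein_err_pointwise[OF h k, of a "X n"] by (auto simp: ind_def algebra_simps split: if_splits)
    then have "pn l n * \<bar>stein_err h (l * h\<^sup>2) a (X n)\<bar> \<le> pn l n * (h * (1 / phi 1 + 4 + (X n)\<^sup>2) + 3 * ind n)"
      using pois_nonneg[OF l] by (intro mult_left_mono) auto
    also have "\<dots> = b n" unfolding b_def X_def power_mult_distrib by (simp add: algebra_simps)
    finally show ?thesis using pois_nonneg[OF l, of n] by (simp add: abs_mult)
  qed
  have "norm (\<Sum>n. pn l n * stein_err h (l * h\<^sup>2) a (X n)) \<le> (\<Sum>n. b n)"
    using bs le by (intro norm_suminf_le) (auto intro: sums_summable)
  then have "\<bar>pois_df l h a - Phi a\<bar> \<le> h * ((1 / phi 1 + 4) * 1 + h\<^sup>2 * l) + 3 * s"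
    using sums_unique[OF 1] sums_unique[OF bs] by simp
  also have "\<dots> \<le> h * ((1 / phi 1 + 4) * 1 + 2) + 3 * (4 * exp 1 * h)"
  proof -
    have "h\<^sup>2 * l \<le> 2" using k h power_le_one[of h 2] by (simp add: mult.commute)
    then show ?thesis using s(2) h by (intro add_mono mult_left_mono) auto
  qed
  finally show ?thesis by (simp add: algebra_simps)
qed

text \<open>The error is first integrated over \<open>a\<close> for each fixed atom; that bound is
  uniform in the atom, so the Poisson weights simply add up to 1.\<close>

lemma pois_df_Phi_nn_integral:
  assumes h: "0 < h" "h \<le> 1" and l: "0 \<le> l" and k: "1 \<le> l * h\<^sup>2" "l * h\<^sup>2 \<le> 1 + h\<^sup>2"
  shows "(\<integral>\<^sup>+a. ennreal \<bar>pois_df l h a - Phi a\<bar> \<partial>lborel) \<le> ennreal (15 * h)"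
proof -
  define X where "X n = (real n - l) * h" for n
  have "(\<integral>\<^sup>+a. ennreal \<bar>pois_df l h a - Phi a\<bar> \<partial>lborel)
     \<le> (\<integral>\<^sup>+a. (\<Sum>n. ennreal (pn l n) * ennreal \<bar>stein_err h (l * h\<^sup>2) a (X n)\<bar>) \<partial>lborel)"
  proof (rule nn_integral_mono)
    fix a
    have 1: "(\<lambda>n. pn l n * stein_err h (l * h\<^sup>2) a (X n)) sums (pois_df l h a - Phi a)"
      using pn_stein_err_sums[OF assms] by (simp add: X_def pois_df_def)
    have sm: "summable (\<lambda>n. pn l n * \<bar>stein_err h (l * h\<^sup>2) a (X n)\<bar>)"
      by (rule pn_bounded_summable[OF l, where C = 3]) (use stein_err_le_3[OF h k] in auto)
    have "norm (\<Sum>n. pn l n * stein_err h (l * h\<^sup>2) a (X n)) \<le> (\<Sum>n. pn l n * \<bar>stein_err h (l * h\<^sup>2) a (X n)\<bar>)"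
      using sm pois_nonneg[OF l] by (intro norm_suminf_le) (auto simp: abs_mult)
    then have "ennreal \<bar>pois_df l h a - Phi a\<bar> \<le> ennreal (\<Sum>n. pn l n * \<bar>stein_err h (l * h\<^sup>2) a (X n)\<bar>)"
      using sums_unique[OF 1] by (intro ennreal_leI) simp
    also have "\<dots> = (\<Sum>n. ennreal (pn l n * \<bar>stein_err h (l * h\<^sup>2) a (X n)\<bar>))"
      using sm pois_nonneg[OF l] by (intro suminf_ennreal2[symmetric]) auto
    finally show "ennreal \<bar>pois_df l h a - Phi a\<bar> \<le> (\<Sum>n. ennreal (pn l n) * ennreal \<bar>stein_err h (l * h\<^sup>2) a (X n)\<bar>)"
      using pois_nonneg[OF l] by (simp add: ennreal_mult)
  qed
  also have "\<dots> = (\<Sum>n. ennreal (pn l n) * (\<integral>\<^sup>+a. ennreal \<bar>stein_err h (l * h\<^sup>2) a (X n)\<bar> \<partial>lborel))"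
    by (subst nn_integral_suminf) (auto simp: nn_integral_cmult)
  also have "\<dots> \<le> (\<Sum>n. ennreal (pn l n) * ennreal (15 * h))"
    by (intro suminf_le mult_left_mono nn_integral_stein_err h k) auto
  also have "\<dots> = (\<Sum>n. ennreal (pn l n)) * ennreal (15 * h)"
    by (rule ennreal_suminf_multc)
  also have "(\<Sum>n. ennreal (pn l n)) = 1"
    using pois_sums[of l] pois_nonneg[OF l] by (subst suminf_ennreal2) (auto simp: sums_iff)
  finally show ?thesis by simp
qed

lemma TP_df_eq:
  fixes \<mu> s2 :: real
  defines "c \<equiv> \<lfloor>\<mu> - s2\<rfloor>" and "l \<equiv> s2 + (\<mu> - s2 - of_int \<lfloor>\<mu> - s2\<rfloor>)"
  assumes s2: "0 < s2"
  shows "TP_df \<mu> s2 j = (\<Sum>n. if int n + c \<le> j then pn l n else 0)"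
    and "fdiff (TP_df \<mu> s2) j = pois l (j + (1 - c))"
proof -
  have l: "0 < l" using s2 unfolding l_def by linarith
  let ?P = "poisson_pmf l" and ?f = "\<lambda>n. int n + c"
  have TP: "TP_pmf \<mu> s2 = map_pmf ?f ?P" by (simp add: TP_pmf_def Let_def c_def l_def)
  have "(\<lambda>n. measure_pmf.prob ?P (if ?f n \<le> j then {n} else {})) sums
     measure_pmf.prob ?P (\<Union>n. if ?f n \<le> j then {n} else {})"
    by (intro measure_pmf.finite_measure_UNION) (auto simp: disjoint_family_on_def)
  also have "(\<Union>n. if ?f n \<le> j then {n} else {}) = ?f -` {..j}" by (auto split: if_splits)
  also have "measure_pmf.prob ?P (?f -` {..j}) = TP_df \<mu> s2 j" by (simp add: TP_df_def TP)
  also have "(\<lambda>n. measure_pmf.prob ?P (if ?f n \<le> j then {n} else {})) = (\<lambda>n. if int n + c \<le> j then pn l n else 0)"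
    using l by (auto simp: measure_pmf_single pois_def)
  finally show "TP_df \<mu> s2 j = (\<Sum>n. if int n + c \<le> j then pn l n else 0)" by (rule sums_unique)
  \<comment> \<open>A forward difference at \<open>j\<close> is the mass at \<open>j + 1\<close>,
    hence the shift by \<open>1 - c\<close>.\<close>
  have "fdiff (TP_df \<mu> s2) j = measure_pmf.prob (TP_pmf \<mu> s2) ({..j + 1} - {..j})"
    unfolding fdiff_def TP_df_def by (subst measure_pmf.finite_measure_Diff) auto
  also have "{..j + 1} - {..j} = {j + 1}" by auto
  also have "measure_pmf.prob (TP_pmf \<mu> s2) {j + 1} = measure_pmf.prob ?P (?f -` {j + 1})" by (simp add: TP)
  also have "\<dots> = pois l (j + (1 - c))"
  proof (cases "0 \<le> j + 1 - c")
    case True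
    then have "?f -` {j + 1} = {nat (j + 1 - c)}" by auto
    then show ?thesis using True l by (simp add: measure_pmf_single pois_def algebra_simps)
  next
    case False
    then have "?f -` {j + 1} = {}" by auto
    then show ?thesis using False by (simp add: pois_def)
  qed
  finally show "fdiff (TP_df \<mu> s2) j = pois l (j + (1 - c))" .
qed

text \<open>Since \<open>\<lfloor>\<mu> - \<sigma>\<^sup>2\<rfloor> + l = \<mu>\<close>, centring
  the translated variable at \<open>\<mu>\<close> centres the Poisson variable at its own mean. The
  scale is \<open>\<sigma>\<close> although the variance is \<open>l\<close>; the excess of at most
  1 is what the range \<open>k \<le> 1 + h\<^sup>2\<close> allows for.\<close>

lemma TP_df_scaled:
  fixes \<sigma> \<mu> x :: real
  assumes \<sigma>: "1 \<le> \<sigma>"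
  defines "l \<equiv> \<sigma>\<^sup>2 + (\<mu> - \<sigma>\<^sup>2 - of_int \<lfloor>\<mu> - \<sigma>\<^sup>2\<rfloor>)"
  shows "TP_df \<mu> (\<sigma>\<^sup>2) \<lfloor>\<mu> + \<sigma> * x\<rfloor> = pois_df l (1 / \<sigma>) x"
proof -
  have "int n + \<lfloor>\<mu> - \<sigma>\<^sup>2\<rfloor> \<le> \<lfloor>\<mu> + \<sigma> * x\<rfloor> \<longleftrightarrow> (real n - l) * (1 / \<sigma>) \<le> x" for n
    using \<sigma> unfolding l_def le_floor_iff by (simp add: field_simps)
  then show ?thesis using \<sigma> unfolding pois_df_def l_def by (subst TP_df_eq(1)) auto
qed

lemma TP_params:
  fixes \<sigma> \<mu> :: real
  assumes \<sigma>: "1 \<le> \<sigma>"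
  defines "l \<equiv> \<sigma>\<^sup>2 + (\<mu> - \<sigma>\<^sup>2 - of_int \<lfloor>\<mu> - \<sigma>\<^sup>2\<rfloor>)"
  shows "0 < 1 / \<sigma>" "1 / \<sigma> \<le> 1" "\<sigma>\<^sup>2 \<le> l" "0 \<le> l" "1 \<le> l * (1 / \<sigma>)\<^sup>2" "l * (1 / \<sigma>)\<^sup>2 \<le> 1 + (1 / \<sigma>)\<^sup>2"
proof -
  show 1: "\<sigma>\<^sup>2 \<le> l" unfolding l_def by linarith
  have 2: "l \<le> \<sigma>\<^sup>2 + 1" unfolding l_def by linarith
  show "0 \<le> l" using 1 zero_le_power2[of \<sigma>] by linarith
  show "0 < 1 / \<sigma>" "1 / \<sigma> \<le> 1" using \<sigma> by auto
  show "1 \<le> l * (1 / \<sigma>)\<^sup>2" "l * (1 / \<sigma>)\<^sup>2 \<le> 1 + (1 / \<sigma>)\<^sup>2"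
    using \<sigma> 1 2 by (auto simp: power_divide field_simps)
qed

section \<open>Conditional laws given a subalgebra\<close>

lemma has_sum_if_nn_integral:
  fixes q :: "'i \<Rightarrow> real"
  assumes "\<And>i. 0 \<le> q i" "0 \<le> s" "(\<integral>\<^sup>+i. ennreal (q i) \<partial>count_space UNIV) = ennreal s"
  shows "(q has_sum s) UNIV"
proof -
  have "integrable (count_space UNIV) q"
    using assms by (intro integrableI_nonneg) auto
  then have a: "Infinite_Set_Sum.abs_summable_on q UNIV" by (simp add: Infinite_Set_Sum.abs_summable_on_def)
  then have "Infinite_Sum.abs_summable_on q UNIV" using abs_summable_equivalent by blast
  then have "q summable_on UNIV" by (rule Infinite_Sum.abs_summable_summable)
  moreover have "infsum q UNIV = s"
    using infsetsum_infsum[OF a] assms by (simp add: infsetsum_def integral_eq_nn_integral)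
  ultimately show ?thesis by (simp add: has_sum_iff)
qed

lemma nn_integral_if_has_sum:
  fixes q :: "'i \<Rightarrow> real"
  assumes "\<And>i. 0 \<le> q i" "(q has_sum s) UNIV"
  shows "(\<integral>\<^sup>+i. ennreal (q i) \<partial>count_space UNIV) = ennreal s"
proof -
  have s: "q summable_on UNIV" using assms(2) has_sum_imp_summable by blast
  then have "Infinite_Sum.abs_summable_on q UNIV" by (rule summable_on_iff_abs_summable_on_real[THEN iffD1])
  then have a: "Infinite_Set_Sum.abs_summable_on q UNIV" using abs_summable_equivalent by blast
  then have i: "integrable (count_space UNIV) q" by (simp add: Infinite_Set_Sum.abs_summable_on_def)
  have "(\<integral>\<^sup>+i. ennreal (q i) \<partial>count_space UNIV) = ennreal (\<integral>i. q i \<partial>count_space UNIV)"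
    by (rule nn_integral_eq_integral[OF i]) (use assms in auto)
  also have "(\<integral>i. q i \<partial>count_space UNIV) = s"
    using infsetsum_infsum[OF a] assms(2) by (simp add: infsetsum_def infsumI)
  finally show ?thesis .
qed

lemma tconv_nn_integral:
  assumes q: "\<And>i. 0 \<le> q i" "q summable_on UNIV" and x: "\<And>i. 0 \<le> x i" "l1bnd 1 c x"
  shows "ennreal (tconv q x j) = (\<integral>\<^sup>+i. ennreal (q i) * ennreal (x (j - i)) \<partial>count_space UNIV)"
proof -
  have "((\<lambda>i. q i * x (j - i)) has_sum tconv q x j) UNIV"
    unfolding tconv_def by (intro has_sum_infsum tconv_summable[OF q x(2)])
  from nn_integral_if_has_sum[OF _ this] show ?thesis using q x by (simp add: ennreal_mult)
qed

lemma tconv_nonneg: "(\<And>i. 0 \<le> q i) \<Longrightarrow> (\<And>i. 0 \<le> x i) \<Longrightarrow> 0 \<le> tconv q x j"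
  unfolding tconv_def by (intro infsum_nonneg) auto

text \<open>A version of the conditional probability is chosen for each \<open>j\<close> separately.
  As the integers are countable, statements about the whole family still hold off a single null
  set.\<close>

definition cmass :: "'a measure \<Rightarrow> 'a measure \<Rightarrow> ('a \<Rightarrow> int) \<Rightarrow> 'a \<Rightarrow> int \<Rightarrow> real" where
  "cmass M F X w j = real_cond_exp M F (\<lambda>w. indicator {j} (X w)) w"

locale prob_subalgebra = prob_space M for M :: "'a measure" +
  fixes F :: "'a measure"
  assumes sub: "subalgebra M F"
begin

sublocale fms: finite_measure_subalgebra M F
  by standard (rule sub)

lemma measurable_cmass [measurable]: "(\<lambda>w. cmass M F X w j) \<in> borel_measurable M"
  unfolding cmass_def by simp

lemma measurable_indicator_comp:
  "X \<in> measurable M (count_space UNIV) \<Longrightarrow> (\<lambda>w. indicator A (X w) :: real) \<in> borel_measurable M"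
  by (rule measurable_compose) auto

lemma integrable_indicator_comp:
  assumes X: "X \<in> measurable M (count_space UNIV)"
  shows "integrable M (\<lambda>w. indicator A (X w) :: real)"
  by (rule integrable_const_bound[where B = 1]) (use measurable_indicator_comp[OF X] in \<open>auto split: split_indicator\<close>)

lemma AE_cmass_nonneg:
  assumes X: "X \<in> measurable M (count_space UNIV)"
  shows "AE w in M. \<forall>j. 0 \<le> cmass M F X w j"
  unfolding AE_all_countable cmass_def by (intro allI fms.real_cond_exp_pos measurable_indicator_comp[OF X]) auto

lemma nn_integral_cmass:
  assumes X [measurable]: "X \<in> measurable M (count_space UNIV)"
  shows "(\<integral>\<^sup>+w. ennreal (cmass M F X w j) \<partial>M) = emeasure M {w \<in> space M. X w = j}"
proof -
  have "(\<integral>\<^sup>+w. ennreal (cmass M F X w j) \<partial>M) = ennreal (\<integral>w. cmass M F X w j \<partial>M)"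
    unfolding cmass_def using AE_cmass_nonneg[OF X]
    by (intro nn_integral_eq_integral fms.real_cond_exp_int integrable_indicator_comp X)
       (auto simp: cmass_def AE_all_countable)
  also have "(\<integral>w. cmass M F X w j \<partial>M) = (\<integral>w. indicator {j} (X w) \<partial>M)"
    unfolding cmass_def by (intro fms.real_cond_exp_int integrable_indicator_comp X)
  also have "\<dots> = (\<integral>w. indicator {w \<in> space M. X w = j} w \<partial>M)"
    by (intro Bochner_Integration.integral_cong) (auto split: split_indicator)
  finally show ?thesis by (simp add: emeasure_eq_measure)
qed

text \<open>Finite partial sums are almost surely at most 1, hence so is the total \<open>S\<close>;
  and \<open>S\<close> has mean 1 by countable additivity. A variable bounded by 1 with mean 1
  equals 1 almost surely.\<close>

lemma AE_cmass_has_sum: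
  assumes X [measurable]: "X \<in> measurable M (count_space UNIV)"
  shows "AE w in M. (cmass M F X w has_sum 1) UNIV"
proof -
  define S where "S w = (\<integral>\<^sup>+j. ennreal (cmass M F X w j) \<partial>count_space UNIV)" for w
  have S_meas [measurable]: "S \<in> borel_measurable M"
    unfolding S_def by (subst nn_integral_bij_count_space[OF bij_int_decode, symmetric], subst nn_integral_count_space_nat) measurable
  have "(\<integral>\<^sup>+w. S w \<partial>M) = (\<integral>\<^sup>+j. \<integral>\<^sup>+w. ennreal (cmass M F X w j) \<partial>M \<partial>count_space UNIV)"
    unfolding S_def by (rule nn_integral_count_space_nn_integral) auto
  also have "\<dots> = (\<integral>\<^sup>+j. emeasure M {w \<in> space M. X w = j} \<partial>count_space UNIV)"
    by (simp add: nn_integral_cmass)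
  also have "\<dots> = emeasure M (\<Union>j. {w \<in> space M. X w = j})"
    by (rule emeasure_UN_countable[symmetric]) (auto simp: disjoint_family_on_def)
  also have "(\<Union>j. {w \<in> space M. X w = j}) = space M" by auto
  finally have int: "(\<integral>\<^sup>+w. S w \<partial>M) = 1" by (simp add: emeasure_space_1)
  have fin: "AE w in M. \<forall>n::nat. (\<Sum>j\<in>{-int n..int n}. cmass M F X w j) \<le> 1"
    unfolding AE_all_countable
  proof
    fix n :: nat
    have "AE w in M. real_cond_exp M F (\<lambda>w. \<Sum>j\<in>{-int n..int n}. indicator {j} (X w)) w
       = (\<Sum>j\<in>{-int n..int n}. cmass M F X w j)"
      unfolding cmass_def by (rule fms.real_cond_exp_sum) (rule integrable_indicator_comp[OF X])
    moreover have "AE w in M. real_cond_exp M F (\<lambda>w. \<Sum>j\<in>{-int n..int n}. indicator {j} (X w)) w \<le> 1"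
    proof (rule fms.real_cond_exp_le_c)
      show "AE w in M. (\<Sum>j\<in>{-int n..int n}. indicator {j} (X w)) \<le> (1::real)"
        using card_mono[of "{_}" "{- int n..int n} \<inter> {_}"] by (intro AE_I2) (auto simp: indicator_def)
    qed (intro Bochner_Integration.integrable_sum integrable_indicator_comp X)
    ultimately show "AE w in M. (\<Sum>j\<in>{-int n..int n}. cmass M F X w j) \<le> 1" by eventually_elim simp
  qed
  have S_le: "AE w in M. S w \<le> 1"
    using fin AE_cmass_nonneg[OF X]
  proof eventually_elim
    case (elim w)
    have "l1bnd n 1 (cmass M F X w)" for n
      unfolding l1bnd_def
    proof (intro allI impI)
      fix A :: "int set" assume A: "finite A \<and> card A \<le> n"
      obtain m where "\<And>x. x \<in> A \<Longrightarrow> \<bar>x\<bar> \<le> int m"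
        using finite_nat_set_iff_bounded_le[of "(\<lambda>x. nat \<bar>x\<bar>) ` A"] A by (auto simp: nat_le_iff)
      then have "A \<subseteq> {-int m..int m}" by (force simp: abs_le_iff)
      then have "(\<Sum>j\<in>A. \<bar>cmass M F X w j\<bar>) \<le> (\<Sum>j\<in>{-int m..int m}. cmass M F X w j)"
        using elim(2) by (simp add: sum_mono2)
      then show "(\<Sum>j\<in>A. \<bar>cmass M F X w j\<bar>) \<le> 1" using elim(1) by (meson order_trans)
    qed
    then have "(cmass M F X w has_sum infsum (cmass M F X w) UNIV) UNIV" "infsum (cmass M F X w) UNIV \<le> 1"
      using summable_if_l1bnd[of 1 "cmass M F X w"] infsum_le_if_l1bnd[of 1 "cmass M F X w"] elim(2) by auto
    then have "S w = ennreal (infsum (cmass M F X w) UNIV)"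
      unfolding S_def using elim(2) by (intro nn_integral_if_has_sum) auto
    then show "S w \<le> 1" using \<open>infsum (cmass M F X w) UNIV \<le> 1\<close> by (simp add: ennreal_le_1)
  qed
  have "(\<integral>\<^sup>+w. 1 - S w \<partial>M) = (\<integral>\<^sup>+w. 1 \<partial>M) - (\<integral>\<^sup>+w. S w \<partial>M)"
    by (rule nn_integral_diff) (use int S_le in auto)
  also have "\<dots> = 0" by (simp add: int emeasure_space_1)
  finally have "AE w in M. 1 - S w = 0" by (subst (asm) nn_integral_0_iff_AE) auto
  with S_le AE_cmass_nonneg[OF X] show ?thesis
  proof eventually_elim
    case (elim w)
    have "S w = 1" using elim(1) ennreal_minus_eq_0[OF elim(3)] by (rule antisym)
    then have "(\<integral>\<^sup>+j. ennreal (cmass M F X w j) \<partial>count_space UNIV) = ennreal 1" by (simp add: S_def)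
    then show ?case using elim(2) by (intro has_sum_if_nn_integral) auto
  qed
qed

lemma AE_fdiff_cond_df:
  assumes X [measurable]: "X \<in> measurable M (count_space UNIV)"
  shows "AE w in M. \<forall>j. fdiff (cond_df M F X w) j = cmass M F X w (j + 1)"
  unfolding AE_all_countable
proof
  fix j
  let ?I = "\<lambda>j. indicator {w \<in> space M. X w \<le> j} :: 'a \<Rightarrow> real"
  have [simp]: "integrable M (?I j)" for j by (rule integrable_real_indicator) (auto simp: less_top[symmetric])
  have "AE w in M. real_cond_exp M F (\<lambda>w. ?I (j + 1) w - ?I j w) w
      = real_cond_exp M F (?I (j + 1)) w - real_cond_exp M F (?I j) w"
    by (rule fms.real_cond_exp_diff) auto
  moreover have "AE w in M. real_cond_exp M F (\<lambda>w. ?I (j + 1) w - ?I j w) w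
      = real_cond_exp M F (\<lambda>w. indicator {j + 1} (X w)) w"
    by (rule fms.real_cond_exp_cong)
       (auto intro: measurable_indicator_comp[OF X] split: split_indicator)
  ultimately show "AE w in M. fdiff (cond_df M F X w) j = cmass M F X w (j + 1)"
    by eventually_elim (simp add: fdiff_def cond_df_def cmass_def)
qed

lemma AE_D1_eq:
  assumes X [measurable]: "X \<in> measurable M (count_space UNIV)"
  shows "AE w in M. D1_df (cond_df M F X w) = (\<Sum>\<^sub>\<infinity>i. \<bar>fdiff (cmass M F X w) i\<bar>)"
  using AE_fdiff_cond_df[OF X]
proof eventually_elim
  case (elim w)
  have "D1_df (cond_df M F X w) = (\<Sum>\<^sub>\<infinity>i. \<bar>fdiff (cmass M F X w) (i + 1)\<bar>)"
    unfolding D1_df_def by (intro infsum_cong) (simp add: fdiff_def[of "fdiff _"] elim, simp add: fdiff_def)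
  also have "\<dots> = (\<Sum>\<^sub>\<infinity>i. \<bar>fdiff (cmass M F X w) i\<bar>)"
    by (rule infsum_reindex_bij_betw) (auto simp: bij_betw_def intro!: image_eqI[of _ _ "_ - 1"])
  finally show ?case .
qed

end

text \<open>The iterated convolution of the conditional masses. Values in \<open>ennreal\<close>
  make it measurable, and allow sums and integrals to be interchanged, even on the null set where
  the masses do not form a law.\<close>

primrec csum_law :: "'a measure \<Rightarrow> 'a measure \<Rightarrow> (nat \<Rightarrow> 'a \<Rightarrow> int) \<Rightarrow> nat \<Rightarrow> int \<Rightarrow> 'a \<Rightarrow> ennreal" where
  "csum_law M F X 0 = (\<lambda>s w. ennreal (cmass M F (X 0) w s))"
| "csum_law M F X (Suc m) = (\<lambda>s w. \<integral>\<^sup>+b. ennreal (cmass M F (X (Suc m)) w b) * csum_law M F X m (s - b) w \<partial>count_space UNIV)"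

lemma borel_measurable_nn_integral_int:
  assumes [measurable]: "\<And>j. f j \<in> borel_measurable M"
  shows "(\<lambda>w. \<integral>\<^sup>+j. f (j :: int) w \<partial>count_space UNIV) \<in> borel_measurable M"
  by (subst nn_integral_bij_count_space[OF bij_int_decode, symmetric], subst nn_integral_count_space_nat) measurable

lemma measurable_sum_count_space:
  fixes X :: "'i \<Rightarrow> 'a \<Rightarrow> int"
  assumes "\<And>i. i \<in> I \<Longrightarrow> X i \<in> measurable M (count_space UNIV)"
  shows "(\<lambda>w. \<Sum>i\<in>I. X i w) \<in> measurable M (count_space UNIV)"
  using assms
proof (induction I rule: infinite_finite_induct)
  case (insert i I)
  have "(\<lambda>w. (\<lambda>a w. a + (\<Sum>i\<in>I. X i w)) (X i w) w) \<in> measurable M (count_space UNIV)"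
    by (rule measurable_compose_countable)
       (use insert in \<open>auto intro: measurable_compose[where N = "count_space UNIV"]\<close>)
  then show ?case using insert by simp
qed auto

context prob_subalgebra
begin

lemma measurable_csum_law [measurable]: "csum_law M F X m s \<in> borel_measurable M"
proof (induction m arbitrary: s)
  case (Suc m)
  note [measurable] = Suc
  show ?case unfolding csum_law.simps by (rule borel_measurable_nn_integral_int) measurable
qed (unfold csum_law.simps, measurable)

lemma tuple_law:
  assumes X [measurable]: "\<And>i. X i \<in> measurable M (count_space UNIV)"
    and E: "E \<in> sets F" and ci: "cond_indep_on M F E X n"
  shows "emeasure M {w \<in> E. \<forall>i\<le>n. X i w = a i}
    = (\<integral>\<^sup>+w. indicator E w * (\<Prod>i\<le>n. ennreal (cmass M F (X i) w (a i))) \<partial>M)"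
proof -
  have EM [measurable]: "E \<in> sets M" using E sub by (auto simp: subalgebra_def)
  have Esp: "E \<subseteq> space M" using sets.sets_into_space[OF EM] .
  define f where "f w = (\<Prod>i\<le>n. indicator {a i} (X i w) :: real)" for w
  have f_eq: "f w = (if \<forall>i\<le>n. X i w = a i then 1 else 0)" for w
    by (auto simp: f_def indicator_def)
  have f_meas [measurable]: "f \<in> borel_measurable M"
    unfolding f_def by (intro borel_measurable_prod measurable_indicator_comp X)
  have f_int: "integrable M f"
    by (rule integrable_const_bound[where B = 1]) (auto simp: f_eq)
  have nn: "AE w in M. \<forall>i. \<forall>j. 0 \<le> cmass M F (X i) w j"
    by (subst AE_all_countable) (intro allI AE_cmass_nonneg X)
  have ci': "AE w in M. w \<in> E \<longrightarrow> real_cond_exp M F f w = (\<Prod>i\<le>n. cmass M F (X i) w (a i))"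
    using ci[unfolded cond_indep_on_def, rule_format, of "\<lambda>i. {a i}"] unfolding f_def cmass_def by simp
  have "emeasure M {w \<in> E. \<forall>i\<le>n. X i w = a i} = ennreal (\<integral>w. indicator {w \<in> E. \<forall>i\<le>n. X i w = a i} w \<partial>M)"
  proof -
    have "{w \<in> E. \<forall>i\<le>n. X i w = a i} = E \<inter> {w \<in> space M. \<forall>i\<le>n. X i w = a i}" using Esp by auto
    also have "\<dots> \<in> sets M" by measurable
    finally show ?thesis by (simp add: emeasure_eq_measure)
  qed
  also have "(\<integral>w. indicator {w \<in> E. \<forall>i\<le>n. X i w = a i} w \<partial>M) = (\<integral>w\<in>E. f w \<partial>M)"
    unfolding set_lebesgue_integral_def
    by (intro Bochner_Integration.integral_cong) (auto simp: f_eq indicator_def)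
  also have "\<dots> = (\<integral>w\<in>E. real_cond_exp M F f w \<partial>M)" by (rule fms.real_cond_exp_intA[OF f_int E])
  also have "ennreal \<dots> = (\<integral>\<^sup>+w. ennreal (indicator E w * real_cond_exp M F f w) \<partial>M)"
    unfolding set_lebesgue_integral_def real_scaleR_def
  proof (rule nn_integral_eq_integral[symmetric])
    show "integrable M (\<lambda>w. indicator E w * real_cond_exp M F f w)"
      using integrable_mult_indicator[OF EM fms.real_cond_exp_int(1)[OF f_int]] by simp
    have "AE w in M. 0 \<le> real_cond_exp M F f w"
      by (rule fms.real_cond_exp_pos) (auto simp: f_eq)
    then show "AE w in M. 0 \<le> indicator E w * real_cond_exp M F f w" by eventually_elim simp
  qed
  also have "\<dots> = (\<integral>\<^sup>+w. indicator E w * (\<Prod>i\<le>n. ennreal (cmass M F (X i) w (a i))) \<partial>M)"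
  proof (rule nn_integral_cong_AE)
    show "AE w in M. ennreal (indicator E w * real_cond_exp M F f w)
       = indicator E w * (\<Prod>i\<le>n. ennreal (cmass M F (X i) w (a i)))"
      using nn ci'
    proof eventually_elim
      case (elim w)
      then show ?case by (cases "w \<in> E") (auto simp: prod_ennreal)
    qed
  qed
  finally show ?thesis .
qed

text \<open>The tuple law is summed out one coordinate at a time: the first \<open>m + 1\<close>
  coordinates enter through their sum, the others stay fixed at \<open>a\<close>. They are carried
  along because conditional independence is given for the whole tuple of length
  \<open>n + 1\<close>.\<close>

lemma partial_sum_law:
  assumes X [measurable]: "\<And>i. X i \<in> measurable M (count_space UNIV)"
    and E: "E \<in> sets F" and ci: "cond_indep_on M F E X n" and "m \<le> n"
  shows "emeasure M {w \<in> E. (\<Sum>i\<le>m. X i w) = s \<and> (\<forall>i\<in>{m<..n}. X i w = a i)}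
    = (\<integral>\<^sup>+w. indicator E w * (csum_law M F X m s w * (\<Prod>i\<in>{m<..n}. ennreal (cmass M F (X i) w (a i)))) \<partial>M)"
  using \<open>m \<le> n\<close>
proof (induction m arbitrary: s a)
  case 0
  \<comment> \<open>At \<open>m = 0\<close> the prescribed sum is the value of coordinate 0.\<close>
  let ?a = "a(0 := s)"
  have *: "{..n} = insert 0 {0<..n}" by auto
  have "{w \<in> E. (\<Sum>i\<le>0. X i w) = s \<and> (\<forall>i\<in>{0<..n}. X i w = a i)} = {w \<in> E. \<forall>i\<le>n. X i w = ?a i}"
    by (auto split: if_splits)
  moreover have "(\<Prod>i\<le>n. ennreal (cmass M F (X i) w (?a i)))
     = csum_law M F X 0 s w * (\<Prod>i\<in>{0<..n}. ennreal (cmass M F (X i) w (a i)))" for w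
    unfolding * by (subst prod.insert) (auto intro!: prod.cong arg_cong2[where f = "(*)"])
  ultimately show ?case using tuple_law[OF X E ci, of ?a] by simp
next
  case (Suc m)
  have EM [measurable]: "E \<in> sets M" using E sub by (auto simp: subalgebra_def)
  have Esp: "E \<subseteq> space M" using sets.sets_into_space[OF EM] .
  note [measurable] = measurable_sum_count_space[OF X]
  \<comment> \<open>The coordinate about to join the sum takes the value \<open>b\<close>, leaving
    \<open>s - b\<close> for the sum before it.\<close>
  let ?a = "\<lambda>b. a(Suc m := b)"
  let ?A = "\<lambda>b. {w \<in> E. (\<Sum>i\<le>m. X i w) = s - b \<and> (\<forall>i\<in>{m<..n}. X i w = ?a b i)}"
  have ins: "{m<..n} = insert (Suc m) {Suc m<..n}" using Suc.prems by auto
  have "{w \<in> E. (\<Sum>i\<le>Suc m. X i w) = s \<and> (\<forall>i\<in>{Suc m<..n}. X i w = a i)} = (\<Union>b. ?A b)"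
    unfolding ins by (auto split: if_splits)
  also have "emeasure M \<dots> = (\<integral>\<^sup>+b. emeasure M (?A b) \<partial>count_space UNIV)"
  proof (rule emeasure_UN_countable)
    show "disjoint_family ?A" unfolding ins by (auto simp: disjoint_family_on_def)
    fix b
    have "?A b = E \<inter> {w \<in> space M. (\<Sum>i\<le>m. X i w) = s - b \<and> (\<forall>i\<in>{m<..n}. X i w = ?a b i)}"
      using Esp by auto
    also have "\<dots> \<in> sets M" by (simp del: fun_upd_apply)
    finally show "?A b \<in> sets M" .
  qed auto
  also have "\<dots> = (\<integral>\<^sup>+b. \<integral>\<^sup>+w. indicator E w * (csum_law M F X m (s - b) w *
      (\<Prod>i\<in>{m<..n}. ennreal (cmass M F (X i) w (?a b i)))) \<partial>M \<partial>count_space UNIV)"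
    using Suc.IH Suc.prems by (intro nn_integral_cong) simp
  also have "\<dots> = (\<integral>\<^sup>+w. \<integral>\<^sup>+b. indicator E w * (csum_law M F X m (s - b) w *
      (\<Prod>i\<in>{m<..n}. ennreal (cmass M F (X i) w (?a b i)))) \<partial>count_space UNIV \<partial>M)"
    by (rule nn_integral_count_space_nn_integral[symmetric]) (auto simp del: fun_upd_apply)
  also have "\<dots> = (\<integral>\<^sup>+w. indicator E w * (csum_law M F X (Suc m) s w *
      (\<Prod>i\<in>{Suc m<..n}. ennreal (cmass M F (X i) w (a i)))) \<partial>M)"
  proof (rule nn_integral_cong)
    fix w
    let ?p = "\<Prod>i\<in>{Suc m<..n}. ennreal (cmass M F (X i) w (a i))"
    have "(\<Prod>i\<in>{m<..n}. ennreal (cmass M F (X i) w (?a b i))) = ennreal (cmass M F (X (Suc m)) w b) * ?p" for b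
      unfolding ins by (subst prod.insert) (auto intro!: prod.cong arg_cong2[where f = "(*)"])
    then have "(\<integral>\<^sup>+b. indicator E w * (csum_law M F X m (s - b) w *
      (\<Prod>i\<in>{m<..n}. ennreal (cmass M F (X i) w (?a b i)))) \<partial>count_space UNIV)
      = (\<integral>\<^sup>+b. (indicator E w * ?p) * (ennreal (cmass M F (X (Suc m)) w b) * csum_law M F X m (s - b) w) \<partial>count_space UNIV)"
      by (intro nn_integral_cong) (simp add: mult_ac)
    also have "\<dots> = (indicator E w * ?p) * csum_law M F X (Suc m) s w"
      by (subst nn_integral_cmult) auto
    finally show "(\<integral>\<^sup>+b. indicator E w * (csum_law M F X m (s - b) w *
      (\<Prod>i\<in>{m<..n}. ennreal (cmass M F (X i) w (?a b i)))) \<partial>count_space UNIV)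
      = indicator E w * (csum_law M F X (Suc m) s w * ?p)" by (simp add: mult_ac)
  qed
  finally show ?case .
qed

lemma sum_law:
  assumes X: "\<And>i. X i \<in> measurable M (count_space UNIV)"
    and E: "E \<in> sets F" and ci: "cond_indep_on M F E X n"
  shows "emeasure M {w \<in> E. (\<Sum>i\<le>n. X i w) = s} = (\<integral>\<^sup>+w. indicator E w * csum_law M F X n s w \<partial>M)"
  using partial_sum_law[OF X E ci order_refl, of s undefined] by simp

text \<open>The event is cut along \<open>N = n\<close>: on each piece the number of summands is
  constant, and conditional independence of that many variables is available there. The pieces lie
  in \<open>F\<close>, so each is an instance of \<open>sum_law\<close>.\<close>

lemma random_sum_law:
  assumes X [measurable]: "\<And>i. X i \<in> measurable M (count_space UNIV)"
    and N: "N \<in> measurable F (count_space UNIV)"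
    and ci: "\<And>n. cond_indep_on M F {w \<in> space M. N w = n} X n"
  shows "emeasure M {w \<in> space M. L \<le> real (N w) \<and> (\<Sum>i\<le>N w. X i w) = s}
    = (\<integral>\<^sup>+w. (if L \<le> real (N w) then csum_law M F X (N w) s w else 0) \<partial>M)"
proof -
  have NM [measurable]: "N \<in> measurable M (count_space UNIV)"
    using measurable_from_subalg[OF sub N] .
  note [measurable] = measurable_sum_count_space[OF X]
  have spF: "space F = space M" using sub by (simp add: subalgebra_def)
  have E: "{w \<in> space M. N w = n} \<in> sets F" for n
    using measurable_sets[OF N, of "{n}"] by (simp add: spF vimage_def Int_def conj_commute)
  let ?A = "\<lambda>n. if L \<le> real n then {w \<in> {w \<in> space M. N w = n}. (\<Sum>i\<le>n. X i w) = s} else {}"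
  have "{w \<in> space M. L \<le> real (N w) \<and> (\<Sum>i\<le>N w. X i w) = s} = (\<Union>n. ?A n)"
    by (auto split: if_splits)
  also have "emeasure M \<dots> = (\<Sum>n. emeasure M (?A n))"
    by (rule suminf_emeasure[symmetric]) (auto simp: disjoint_family_on_def)
  also have "\<dots> = (\<Sum>n. \<integral>\<^sup>+w. (if L \<le> real n then indicator {w \<in> space M. N w = n} w * csum_law M F X n s w else 0) \<partial>M)"
    using sum_law[OF X E ci] by (intro suminf_cong) simp
  also have "\<dots> = (\<integral>\<^sup>+w. (\<Sum>n. if L \<le> real n then indicator {w \<in> space M. N w = n} w * csum_law M F X n s w else 0) \<partial>M)"
    by (rule nn_integral_suminf[symmetric]) measurable
  also have "\<dots> = (\<integral>\<^sup>+w. (if L \<le> real (N w) then csum_law M F X (N w) s w else 0) \<partial>M)"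
  proof (rule nn_integral_cong)
    fix w assume w: "w \<in> space M"
    have "(\<Sum>n. if L \<le> real n then indicator {w \<in> space M. N w = n} w * csum_law M F X n s w else 0)
      = (\<Sum>n\<in>{N w}. if L \<le> real n then indicator {w \<in> space M. N w = n} w * csum_law M F X n s w else 0)"
      by (rule suminf_finite) auto
    then show "(\<Sum>n. if L \<le> real n then indicator {w \<in> space M. N w = n} w * csum_law M F X n s w else 0)
      = (if L \<le> real (N w) then csum_law M F X (N w) s w else 0)" using w by simp
  qed
  finally show ?thesis .
qed

text \<open>At a single good outcome the \<open>ennreal\<close> recursion is a real convolution. The
  list is reversed because \<open>csum_law\<close> adds its last summand outermost; index 0 is the
  starting function, so that all smoothing comes from the other indices.\<close>

lemma csum_law_eq_foldr:
  assumes "\<And>i. i \<le> n \<Longrightarrow> (\<forall>j. 0 \<le> cmass M F (X i) w j) \<and> (cmass M F (X i) w has_sum 1) UNIV"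
  shows "csum_law M F X n s w = ennreal (foldr tconv (map (\<lambda>i. cmass M F (X i) w) (rev [1..<Suc n])) (cmass M F (X 0) w) s)
     \<and> 0 \<le> foldr tconv (map (\<lambda>i. cmass M F (X i) w) (rev [1..<Suc n])) (cmass M F (X 0) w) s
     \<and> l1bnd k 1 (foldr tconv (map (\<lambda>i. cmass M F (X i) w) (rev [1..<Suc n])) (cmass M F (X 0) w))"
  using assms
proof (induction n arbitrary: s k)
  case 0
  then have "0 \<le> cmass M F (X 0) w j" "(cmass M F (X 0) w has_sum 1) UNIV" for j by auto
  then show ?case using l1bnd_if_has_sum[of "cmass M F (X 0) w" 1 k] by simp
next
  case (Suc n)
  define y where "y = foldr tconv (map (\<lambda>i. cmass M F (X i) w) (rev [1..<Suc n])) (cmass M F (X 0) w)"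
  define q where "q = cmass M F (X (Suc n)) w"
  have q: "\<And>j. 0 \<le> q j" "(q has_sum 1) UNIV" using Suc.prems[of "Suc n"] by (auto simp: q_def)
  have qs: "q summable_on UNIV" using q(2) by (rule has_sum_imp_summable)
  have IH: "csum_law M F X n s w = ennreal (y s) \<and> 0 \<le> y s \<and> l1bnd k 1 y" for s k
    unfolding y_def by (rule Suc.IH) (use Suc.prems in auto)
  have eq: "foldr tconv (map (\<lambda>i. cmass M F (X i) w) (rev [1..<Suc (Suc n)])) (cmass M F (X 0) w) = tconv q y"
    by (simp add: y_def q_def)
  have "l1bnd (max k 1) (1 * 1) (tconv q y)"
    by (rule l1bnd_tconv[OF q]) (use IH in auto)
  then have b: "l1bnd k 1 (tconv q y)" by (simp add: l1bnd_le_n)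
  have "csum_law M F X (Suc n) s w = (\<integral>\<^sup>+b. ennreal (q b) * ennreal (y (s - b)) \<partial>count_space UNIV)"
    using IH by (simp add: q_def)
  also have "\<dots> = ennreal (tconv q y s)"
    by (rule tconv_nn_integral[symmetric, where c = 1]) (use q qs IH in auto)
  finally show ?case unfolding eq using b tconv_nonneg[of q y s] q IH by simp
qed

end

section \<open>Smoothness of random sums\<close>

context prob_subalgebra
begin

text \<open>The conditional bound holds for almost every outcome with the same constant and passes
  to the mean, because iterated differences and sums over finite sets commute with expectation.
  Outcomes with \<open>N < L\<close> contribute 0.\<close>

lemma l1bnd_random_sum_law:
  assumes X [measurable]: "\<And>i. X i \<in> measurable M (count_space UNIV)"
    and N: "N \<in> measurable F (count_space UNIV)"
    and ci: "\<And>n. cond_indep_on M F {w \<in> space M. N w = n} X n"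
    and sm: "AE w in M. \<forall>i\<in>{1..N w}. u \<le> 1 - D1_df (cond_df M F (X i) w) / 2"
    and u: "0 < u" and L: "0 < L" and n: "1 \<le> n"
  defines "p \<equiv> \<lambda>s. measure M {w \<in> space M. L \<le> real (N w) \<and> (\<Sum>i\<le>N w. X i w) = s}"
  shows "l1bnd n (sqrt (8 * real r / (u * L)) ^ r) ((fdiff ^^ r) p)"
proof -
  have NM [measurable]: "N \<in> measurable M (count_space UNIV)"
    using measurable_from_subalg[OF sub N] .
  define G where "G s w = (if L \<le> real (N w) then csum_law M F X (N w) s w else 0)" for s w
  have G_meas [measurable]: "G s \<in> borel_measurable M" for s
    unfolding G_def by measurable
  define H where "H s w = enn2real (G s w)" for s w
  have H_meas [measurable]: "H s \<in> borel_measurable M" for s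
    unfolding H_def by measurable
  define c where "c = sqrt (8 * real r / (u * L)) ^ r"
  have c0: "0 \<le> c" using u L by (simp add: c_def)
  have good: "AE w in M. (\<forall>s. G s w = ennreal (H s w) \<and> 0 \<le> H s w \<and> H s w \<le> 1)
      \<and> l1bnd n c ((fdiff ^^ r) (\<lambda>s. H s w))"
  proof -
    have "AE w in M. \<forall>i. \<forall>j. 0 \<le> cmass M F (X i) w j"
      by (subst AE_all_countable) (intro allI AE_cmass_nonneg X)
    moreover have "AE w in M. \<forall>i. (cmass M F (X i) w has_sum 1) UNIV"
      by (subst AE_all_countable) (intro allI AE_cmass_has_sum X)
    moreover have "AE w in M. \<forall>i. D1_df (cond_df M F (X i) w) = (\<Sum>\<^sub>\<infinity>j. \<bar>fdiff (cmass M F (X i) w) j\<bar>)"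
      by (subst AE_all_countable) (intro allI AE_D1_eq X)
    ultimately show ?thesis using sm
    proof eventually_elim
      case (elim w)
      show ?case
      proof (cases "L \<le> real (N w)")
        case False
        have "(fdiff ^^ r) (\<lambda>s. 0) = (\<lambda>s. 0)" by (induction r) (auto simp: fdiff_def)
        then show ?thesis using False c0 l1bnd_mono[OF l1bnd_zero c0] by (simp add: H_def G_def)
      next
        case True
        define qs where "qs = map (\<lambda>i. cmass M F (X i) w) (rev [1..<Suc (N w)])"
        define y where "y = foldr tconv qs (cmass M F (X 0) w)"
        have sm': "overlap u q" if q: "q \<in> set qs" for q
        proof -
          have "q \<in> (\<lambda>i. cmass M F (X i) w) ` {1..N w}"
            using q unfolding qs_def set_map set_rev set_upt by (simp only: atLeastLessThanSuc_atLeastAtMost)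
          then obtain i where i: "i \<in> {1..N w}" "q = cmass M F (X i) w" by blast
          then have "u \<le> 1 - (\<Sum>\<^sub>\<infinity>j. \<bar>fdiff q j\<bar>) / 2" using elim(3,4) by metis
          then show ?thesis using i elim(1,2) by (simp add: overlap_def)
        qed
        have len: "length qs = N w" by (simp add: qs_def)
        \<comment> \<open>\<open>0 < L \<le> N\<close> yields at least one summand, and a law cannot
          overlap its translate by more than its total mass; this is where \<open>u \<le> 1\<close>
          comes from.\<close>
        have "0 < N w" using True L by (cases "N w") auto
        then have "hd qs \<in> set qs" using len by (intro hd_in_set) auto
        then have u1: "u \<le> 1" by (rule overlap_le_1[OF sm'])
        have csum_law: "csum_law M F X (N w) s w = ennreal (y s) \<and> 0 \<le> y s \<and> l1bnd 1 1 y" for s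
          unfolding y_def qs_def by (rule csum_law_eq_foldr) (use elim(1,2) in auto)
        have G: "G s w = ennreal (y s)" for s using True csum_law by (simp add: G_def)
        have H: "H s w = y s" for s using csum_law by (simp add: H_def G)
        have 0: "l1bnd n 1 (cmass M F (X 0) w)"
          using l1bnd_if_has_sum[of "cmass M F (X 0) w" 1 n] elim(1,2) by simp
        have "l1bnd n (c * 1) ((fdiff ^^ r) y)"
          unfolding c_def y_def by (rule l1bnd_fdiff_pow_foldr_length[OF sm' u u1 0 n L]) (use True len in auto)
        moreover have "y s \<le> 1" for s using l1bnd_pointwise[of 1 1 y s] csum_law by auto
        ultimately show ?thesis using csum_law by (simp add: G H)
      qed
    qed
  qed
  have H_int: "integrable M (H s)" for s
    by (rule integrable_const_bound[where B = 1]) (use good in \<open>auto elim!: eventually_mono\<close>)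
  have p_eq: "p s = (\<integral>w. H s w \<partial>M)" for s
  proof -
    have "ennreal (p s) = (\<integral>\<^sup>+w. G s w \<partial>M)"
      using random_sum_law[OF X N ci, of L s] by (simp add: p_def G_def emeasure_eq_measure)
    also have "\<dots> = (\<integral>\<^sup>+w. ennreal (H s w) \<partial>M)"
      by (rule nn_integral_cong_AE) (use good in \<open>auto elim!: eventually_mono\<close>)
    also have "\<dots> = ennreal (\<integral>w. H s w \<partial>M)"
      by (rule nn_integral_eq_integral[OF H_int]) (use good in \<open>auto elim!: eventually_mono\<close>)
    finally have e: "ennreal (p s) = ennreal (\<integral>w. H s w \<partial>M)" .
    have "0 \<le> p s" by (simp add: p_def)
    moreover have "0 \<le> (\<integral>w. H s w \<partial>M)" by (simp add: H_def)
    ultimately show ?thesis using e by simp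
  qed
  have diff: "integrable M (\<lambda>w. (fdiff ^^ k) (\<lambda>s. H s w) j)
     \<and> (fdiff ^^ k) p j = (\<integral>w. (fdiff ^^ k) (\<lambda>s. H s w) j \<partial>M)" for k j
  proof (induction k arbitrary: j)
    case 0
    show ?case using H_int p_eq by simp
  next
    case (Suc k)
    have e: "(fdiff ^^ Suc k) g j = (fdiff ^^ k) g (j + 1) - (fdiff ^^ k) g j" for g :: "int \<Rightarrow> real"
      by (simp add: fdiff_def)
    show ?case unfolding e using Suc by simp
  qed
  show ?thesis unfolding c_def[symmetric] l1bnd_def
  proof (intro allI impI)
    fix A :: "int set" assume A: "finite A \<and> card A \<le> n"
    have "(\<Sum>j\<in>A. \<bar>(fdiff ^^ r) p j\<bar>) \<le> (\<Sum>j\<in>A. \<integral>w. \<bar>(fdiff ^^ r) (\<lambda>s. H s w) j\<bar> \<partial>M)"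
      using diff integral_abs_bound by (intro sum_mono) auto
    also have "\<dots> = (\<integral>w. (\<Sum>j\<in>A. \<bar>(fdiff ^^ r) (\<lambda>s. H s w) j\<bar>) \<partial>M)"
      using diff by (intro Bochner_Integration.integral_sum[symmetric]) auto
    also have "\<dots> \<le> (\<integral>w. c \<partial>M)"
    proof (rule integral_mono_AE)
      show "integrable M (\<lambda>w. \<Sum>j\<in>A. \<bar>(fdiff ^^ r) (\<lambda>s. H s w) j\<bar>)"
        using diff by (intro Bochner_Integration.integrable_sum) auto
      show "AE w in M. (\<Sum>j\<in>A. \<bar>(fdiff ^^ r) (\<lambda>s. H s w) j\<bar>) \<le> c"
        using good by eventually_elim (use A l1bndD in blast)
    qed simp
    finally show "(\<Sum>j\<in>A. \<bar>(fdiff ^^ r) p j\<bar>) \<le> c" by (simp add: prob_space)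
  qed
qed

end

section \<open>Lower bounds for the distance between a lattice law and the normal law\<close>

lemma nn_integral_Phi_cell:
  assumes w: "0 \<le> w" and c: "\<And>x. x0 \<le> x \<Longrightarrow> x \<le> x0 + w \<Longrightarrow> c \<le> phi x" and c0: "0 \<le> c"
  shows "ennreal (c * w\<^sup>2 / 16) \<le> (\<integral>\<^sup>+x. ennreal \<bar>v - Phi x\<bar> * indicator {x0..<x0 + w} x \<partial>lborel)"
proof -
  have inc: "c * (y - x) \<le> Phi y - Phi x" if xy: "x0 \<le> x" "x \<le> y" "y \<le> x0 + w" for x y
  proof (cases "x = y")
    case False
    then obtain z where "x < z" "z < y" "Phi y - Phi x = (y - x) * phi z"
      using MVT2[of x y Phi phi] xy DERIV_Phi by auto
    then show ?thesis using mult_left_mono[OF c[of z], of "y - x"] xy by (simp add: mult.commute)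
  qed auto
  have main: "ennreal (c * w\<^sup>2 / 16) \<le> (\<integral>\<^sup>+x. ennreal \<bar>v - Phi x\<bar> * indicator {x0..<x0 + w} x \<partial>lborel)"
    if l: "x0 \<le> l" "l + w / 4 \<le> x0 + w" and lb: "\<And>x. l \<le> x \<Longrightarrow> x < l + w / 4 \<Longrightarrow> c * (w / 4) \<le> \<bar>v - Phi x\<bar>" for l
  proof -
    have "ennreal (c * w\<^sup>2 / 16) = ennreal (c * (w / 4)) * ennreal (w / 4)"
      using w c0 by (simp add: ennreal_mult[symmetric] power2_eq_square)
    also have "\<dots> = (\<integral>\<^sup>+x. ennreal (c * (w / 4)) * indicator {l..<l + w / 4} x \<partial>lborel)"
      using w by (subst nn_integral_cmult_indicator) auto
    also have "\<dots> \<le> (\<integral>\<^sup>+x. ennreal \<bar>v - Phi x\<bar> * indicator {x0..<x0 + w} x \<partial>lborel)"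
      using l lb by (intro nn_integral_mono) (auto split: split_indicator intro: ennreal_leI)
    finally show ?thesis .
  qed
  show ?thesis
  \<comment> \<open>Whichever side of \<open>v\<close> the midpoint value of \<open>Phi\<close> lies
    on, \<open>Phi\<close> stays at least \<open>c * (w / 4)\<close> away from \<open>v\<close> on
    the outer quarter of the cell at that side.\<close>
  proof (cases "Phi (x0 + w / 2) \<le> v")
    case True
    show ?thesis
    proof (rule main[of x0])
      fix x assume x: "x0 \<le> x" "x < x0 + w / 4"
      have "c * (w / 4) \<le> c * (x0 + w / 2 - x)" using x c0 by (intro mult_left_mono) auto
      also have "\<dots> \<le> Phi (x0 + w / 2) - Phi x" using inc[of x "x0 + w / 2"] x w by simp
      finally show "c * (w / 4) \<le> \<bar>v - Phi x\<bar>" using True by linarith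
    qed (use w in auto)
  next
    case False
    show ?thesis
    proof (rule main[of "x0 + 3 * w / 4"])
      fix x assume x: "x0 + 3 * w / 4 \<le> x" "x < x0 + 3 * w / 4 + w / 4"
      have "c * (w / 4) \<le> c * (x - (x0 + w / 2))" using x c0 by (intro mult_left_mono) auto
      also have "\<dots> \<le> Phi x - Phi (x0 + w / 2)" using inc[of "x0 + w / 2" x] x w by simp
      finally show "c * (w / 4) \<le> \<bar>v - Phi x\<bar>" using False by linarith
    qed (use w in auto)
  qed
qed

lemma floor_cell:
  fixes \<sigma> \<mu> x :: real
  assumes "0 < \<sigma>"
  shows "\<lfloor>\<mu> + \<sigma> * x\<rfloor> = j \<longleftrightarrow> x \<in> {(of_int j - \<mu>) / \<sigma>..<(of_int j - \<mu>) / \<sigma> + 1 / \<sigma>}"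
  using assms by (auto simp: floor_eq_iff field_simps)

lemma sum_nn_integral_cells_le:
  fixes \<sigma> \<mu> :: real and g :: "int \<Rightarrow> real \<Rightarrow> ennreal"
  assumes \<sigma>: "0 < \<sigma>" and J: "finite J" and [measurable]: "\<And>j. g j \<in> borel_measurable lborel"
  shows "(\<Sum>j\<in>J. \<integral>\<^sup>+x. g j x * indicator {(of_int j - \<mu>) / \<sigma>..<(of_int j - \<mu>) / \<sigma> + 1 / \<sigma>} x \<partial>lborel)
    \<le> (\<integral>\<^sup>+x. g \<lfloor>\<mu> + \<sigma> * x\<rfloor> x \<partial>lborel)"
proof -
  let ?C = "\<lambda>j::int. {(of_int j - \<mu>) / \<sigma>..<(of_int j - \<mu>) / \<sigma> + 1 / \<sigma>}"
  have "(\<Sum>j\<in>J. \<integral>\<^sup>+x. g j x * indicator (?C j) x \<partial>lborel) = (\<integral>\<^sup>+x. (\<Sum>j\<in>J. g j x * indicator (?C j) x) \<partial>lborel)"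
    by (rule nn_integral_sum[symmetric]) measurable
  also have "\<dots> \<le> (\<integral>\<^sup>+x. g \<lfloor>\<mu> + \<sigma> * x\<rfloor> x \<partial>lborel)"
  proof (rule nn_integral_mono)
    fix x
    have cell: "x \<in> ?C j \<longleftrightarrow> j = \<lfloor>\<mu> + \<sigma> * x\<rfloor>" for j
      using floor_cell[of \<sigma> \<mu> x j] \<sigma> by auto
    have "(\<Sum>j\<in>J. g j x * indicator (?C j) x) = (\<Sum>j\<in>J \<inter> {\<lfloor>\<mu> + \<sigma> * x\<rfloor>}. g j x)"
      using J cell by (intro sum.mono_neutral_cong_right) (auto simp: indicator_def simp del: atLeastLessThan_iff)
    also have "\<dots> \<le> (\<Sum>j\<in>{\<lfloor>\<mu> + \<sigma> * x\<rfloor>}. g j x)"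
      by (intro sum_mono2) auto
    finally show "(\<Sum>j\<in>J. g j x * indicator (?C j) x) \<le> g \<lfloor>\<mu> + \<sigma> * x\<rfloor> x" by simp
  qed
  finally show ?thesis .
qed

text \<open>On the cell containing 0 the lattice function is constant, while \<open>Phi\<close>
  grows by at least \<open>phi 1 / (2 * \<sigma>)\<close> over its first half, which lies in
  \<open>[-1, 1]\<close>; one of the two ends of that half must miss by half the growth.\<close>

lemma lattice_Phi_sup:
  fixes G :: "int \<Rightarrow> real"
  assumes \<sigma>: "1 \<le> \<sigma>" and D: "\<And>x. \<bar>G \<lfloor>\<mu> + \<sigma> * x\<rfloor> - Phi x\<bar> \<le> D"
  shows "phi 1 / 4 / \<sigma> \<le> D"
proof -
  define x0 where "x0 = (of_int \<lfloor>\<mu>\<rfloor> - \<mu>) / \<sigma>"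
  define x1 where "x1 = x0 + 1 / (2 * \<sigma>)"
  have f: "\<lfloor>\<mu> + \<sigma> * x0\<rfloor> = \<lfloor>\<mu>\<rfloor>" "\<lfloor>\<mu> + \<sigma> * x1\<rfloor> = \<lfloor>\<mu>\<rfloor>"
    using \<sigma> by (subst floor_cell, simp, simp add: x0_def x1_def field_simps)+
  have "of_int \<lfloor>\<mu>\<rfloor> - \<mu> \<le> 0" "-1 \<le> of_int \<lfloor>\<mu>\<rfloor> - \<mu>" by linarith+
  then have "x0 \<le> 0" "- (1 / \<sigma>) \<le> x0" using \<sigma> by (auto simp: x0_def divide_le_0_iff le_divide_eq)
  moreover have "1 / \<sigma> \<le> 1" "0 < 1 / (2 * \<sigma>)" "1 / (2 * \<sigma>) \<le> 1" using \<sigma> by auto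
  ultimately have r: "-1 \<le> x0" "x1 \<le> 1" "x0 < x1" unfolding x1_def by linarith+
  obtain z where z: "x0 < z" "z < x1" "Phi x1 - Phi x0 = (x1 - x0) * phi z"
    using MVT2[of x0 x1 Phi phi] r DERIV_Phi by auto
  have "phi 1 \<le> phi z" using z r by (intro phi_decreasing) auto
  then have "1 / (2 * \<sigma>) * phi 1 \<le> Phi x1 - Phi x0"
    unfolding z(3) using \<sigma> by (simp add: x1_def mult_left_mono divide_right_mono)
  also have "\<dots> \<le> 2 * D" using D[of x0] D[of x1] unfolding f by linarith
  finally show ?thesis using \<sigma> by (simp add: field_simps)
qed

text \<open>At least \<open>\<sigma> / 2\<close> cells lie in \<open>[0, 2]\<close>, and by
  \<open>nn_integral_Phi_cell\<close> each contributes at least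
  \<open>phi 2 / (16 * \<sigma>\<^sup>2)\<close>.\<close>

lemma lattice_Phi_L1:
  fixes G :: "int \<Rightarrow> real"
  assumes \<sigma>: "1 \<le> \<sigma>"
  shows "ennreal (phi 2 / 32 / \<sigma>) \<le> (\<integral>\<^sup>+x. ennreal \<bar>G \<lfloor>\<mu> + \<sigma> * x\<rfloor> - Phi x\<bar> \<partial>lborel)"
proof -
  define n where "n = nat \<lfloor>\<sigma>\<rfloor>"
  have n: "real n \<le> \<sigma>" "\<sigma> / 2 \<le> real n"
    using \<sigma> one_le_floor[of \<sigma>] unfolding n_def by linarith+
  let ?x = "\<lambda>j::int. (of_int j - \<mu>) / \<sigma>"
  let ?C = "\<lambda>j::int. {?x j..<?x j + 1 / \<sigma>}"
  define J where "J = (\<lambda>i. \<lceil>\<mu>\<rceil> + int i) ` {..<n}"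
  have cardJ: "card J = n" unfolding J_def by (subst card_image) (auto simp: inj_on_def)
  have finJ: "finite J" by (simp add: J_def)
  have "ennreal (phi 2 / 32 / \<sigma>) \<le> ennreal (real n * (phi 2 * (1 / \<sigma>)\<^sup>2 / 16))"
  proof (rule ennreal_leI)
    have "\<sigma> / 2 * (phi 2 * (1 / \<sigma>)\<^sup>2 / 16) \<le> real n * (phi 2 * (1 / \<sigma>)\<^sup>2 / 16)"
      using n by (intro mult_right_mono) (auto simp: normal_density_nonneg)
    moreover have "\<sigma> / 2 * (phi 2 * (1 / \<sigma>)\<^sup>2 / 16) = phi 2 / 32 / \<sigma>"
      using \<sigma> by (simp add: power2_eq_square field_simps)
    ultimately show "phi 2 / 32 / \<sigma> \<le> real n * (phi 2 * (1 / \<sigma>)\<^sup>2 / 16)" by (simp only:)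
  qed
  also have "\<dots> = (\<Sum>j\<in>J. ennreal (phi 2 * (1 / \<sigma>)\<^sup>2 / 16))"
    unfolding sum_constant cardJ ennreal_of_nat_eq_real_of_nat
    by (rule ennreal_mult) (auto simp: normal_density_nonneg)
  also have "\<dots> \<le> (\<Sum>j\<in>J. \<integral>\<^sup>+x. ennreal \<bar>G j - Phi x\<bar> * indicator (?C j) x \<partial>lborel)"
  proof (rule sum_mono)
    fix j assume "j \<in> J"
    then obtain i where i: "i < n" "j = \<lceil>\<mu>\<rceil> + int i" by (auto simp: J_def)
    have 1: "0 \<le> of_int j - \<mu>" unfolding i by linarith
    have "of_int j - \<mu> \<le> real i + 1" unfolding i by linarith
    also have "\<dots> \<le> \<sigma>" using i n(1) by linarith
    finally have 2: "of_int j - \<mu> \<le> \<sigma>" .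
    have "0 \<le> ?x j" "?x j + 1 / \<sigma> \<le> 2" using 1 2 \<sigma> by (auto simp: field_simps)
    then show "ennreal (phi 2 * (1 / \<sigma>)\<^sup>2 / 16) \<le> (\<integral>\<^sup>+x. ennreal \<bar>G j - Phi x\<bar> * indicator (?C j) x \<partial>lborel)"
      using \<sigma> by (intro nn_integral_Phi_cell phi_decreasing) (auto simp: normal_density_nonneg)
  qed
  also have "\<dots> \<le> (\<integral>\<^sup>+x. ennreal \<bar>G \<lfloor>\<mu> + \<sigma> * x\<rfloor> - Phi x\<bar> \<partial>lborel)"
    using \<sigma> finJ by (intro sum_nn_integral_cells_le) auto
  finally show ?thesis .
qed

text \<open>A cell has length \<open>1 / \<sigma>\<close>, so a sum over integers is
  \<open>\<sigma>\<close> times the integral of the corresponding step function.\<close>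

lemma l1bnd_if_step_nn_integral:
  fixes f :: "int \<Rightarrow> real"
  assumes \<sigma>: "0 < \<sigma>" and I: "(\<integral>\<^sup>+x. ennreal \<bar>f \<lfloor>\<mu> + \<sigma> * x\<rfloor>\<bar> \<partial>lborel) \<le> ennreal I" and "0 \<le> I"
  shows "l1bnd n (\<sigma> * I) f"
  unfolding l1bnd_def
proof (intro allI impI)
  fix A :: "int set" assume A: "finite A \<and> card A \<le> n"
  let ?x = "\<lambda>j::int. (of_int j - \<mu>) / \<sigma>"
  let ?C = "\<lambda>j::int. {?x j..<?x j + 1 / \<sigma>}"
  have "ennreal ((\<Sum>j\<in>A. \<bar>f j\<bar>) / \<sigma>) = (\<Sum>j\<in>A. ennreal \<bar>f j\<bar> * ennreal (1 / \<sigma>))"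
    using \<sigma> by (simp add: sum_divide_distrib ennreal_mult[symmetric] sum_ennreal)
  also have "\<dots> = (\<Sum>j\<in>A. \<integral>\<^sup>+x. ennreal \<bar>f j\<bar> * indicator (?C j) x \<partial>lborel)"
    using \<sigma> by (intro sum.cong refl) (simp add: nn_integral_cmult_indicator)
  also have "\<dots> \<le> (\<integral>\<^sup>+x. ennreal \<bar>f \<lfloor>\<mu> + \<sigma> * x\<rfloor>\<bar> \<partial>lborel)"
    using \<sigma> A by (intro sum_nn_integral_cells_le) auto
  also note I
  finally have "(\<Sum>j\<in>A. \<bar>f j\<bar>) / \<sigma> \<le> I" using \<open>0 \<le> I\<close> by (simp add: ennreal_le_iff)
  then show "(\<Sum>j\<in>A. \<bar>f j\<bar>) \<le> \<sigma> * I" using \<sigma> by (simp add: divide_le_eq mult.commute)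
qed

section \<open>Comparison with the normal distribution\<close>

lemma nn_integral_Phi_step: "(\<integral>\<^sup>+x. ennreal \<bar>Phi x - indicator {0..} x\<bar> \<partial>lborel) < \<infinity>"
proof -
  have "(\<integral>\<^sup>+x. ennreal \<bar>Phi x - indicator {0..} x\<bar> \<partial>lborel)
     \<le> (\<integral>\<^sup>+x. ennreal (Phi (- x)) * indicator {0..} x + ennreal (Phi x) * indicator {..0} x \<partial>lborel)"
    by (intro nn_integral_mono) (auto split: split_indicator simp: Phi_minus)
  also have "\<dots> = ennreal (tail_int 0) + ennreal (tail_int 0)"
    by (subst nn_integral_add) (auto simp: nn_integral_Psi nn_integral_Phi)
  also have "\<dots> < \<infinity>" by simp
  finally show ?thesis .
qed

context prob_space
begin

lemma real_df_mono: "X \<in> borel_measurable M \<Longrightarrow> mono (real_df M X)"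
  unfolding mono_def real_df_def by (intro allI impI finite_measure_mono) auto

lemma borel_measurable_real_df: "X \<in> borel_measurable M \<Longrightarrow> real_df M X \<in> borel_measurable borel"
  by (rule borel_measurable_mono) (rule real_df_mono)

text \<open>By Fubini the integral is the mean length of the interval between 0 and
  \<open>X\<close>.\<close>

lemma nn_integral_df_step:
  assumes X: "integrable M X"
  shows "(\<integral>\<^sup>+x. ennreal \<bar>real_df M X x - indicator {0..} x\<bar> \<partial>lborel) < \<infinity>"
proof -
  have [measurable]: "X \<in> borel_measurable M" using X by simp
  interpret pair_sigma_finite lborel M ..
  let ?I = "\<lambda>x w. (if (x < 0 \<and> X w \<le> x) \<or> (0 \<le> x \<and> x < X w) then 1 else 0) :: ennreal"
  have eq: "ennreal \<bar>real_df M X x - indicator {0..} x\<bar> = (\<integral>\<^sup>+w. ?I x w \<partial>M)" for x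
  proof (cases "x < 0")
    case True
    have "(\<integral>\<^sup>+w. ?I x w \<partial>M) = (\<integral>\<^sup>+w. indicator {w \<in> space M. X w \<le> x} w \<partial>M)"
      using True by (intro nn_integral_cong) (auto split: split_indicator)
    also have "\<dots> = ennreal (real_df M X x)" by (simp add: real_df_def emeasure_eq_measure)
    finally show ?thesis using True by (simp add: real_df_def)
  next
    case False
    have "(\<integral>\<^sup>+w. ?I x w \<partial>M) = (\<integral>\<^sup>+w. indicator (space M - {w \<in> space M. X w \<le> x}) w \<partial>M)"
      using False by (intro nn_integral_cong) (auto split: split_indicator)
    also have "\<dots> = ennreal (1 - real_df M X x)"
      by (simp add: real_df_def emeasure_eq_measure prob_compl)
    finally show ?thesis using False by (simp add: real_df_def)
  qed
  have "(\<integral>\<^sup>+x. ennreal \<bar>real_df M X x - indicator {0..} x\<bar> \<partial>lborel) = (\<integral>\<^sup>+x. \<integral>\<^sup>+w. ?I x w \<partial>M \<partial>lborel)"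
    by (simp only: eq)
  also have "\<dots> = (\<integral>\<^sup>+w. \<integral>\<^sup>+x. ?I x w \<partial>lborel \<partial>M)"
    by (rule Fubini'[symmetric]) measurable
  also have "\<dots> \<le> (\<integral>\<^sup>+w. ennreal \<bar>X w\<bar> \<partial>M)"
  proof (rule nn_integral_mono)
    fix w
    have "(\<integral>\<^sup>+x. ?I x w \<partial>lborel) = (\<integral>\<^sup>+x. indicator ({X w..<0} \<union> {0..<X w}) x \<partial>lborel)"
      by (intro nn_integral_cong) (auto split: split_indicator)
    also have "\<dots> = emeasure lborel ({X w..<0} \<union> {0..<X w})" by (rule nn_integral_indicator) auto
    also have "\<dots> = ennreal \<bar>X w\<bar>" by (cases "X w < 0") auto
    finally show "(\<integral>\<^sup>+x. ?I x w \<partial>lborel) \<le> ennreal \<bar>X w\<bar>" by simp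
  qed
  also have "\<dots> < \<infinity>" using X by (simp add: integrable_iff_bounded)
  finally show ?thesis .
qed

text \<open>\<open>dW_df\<close> is a Bochner integral and would be 0 for a non-integrable
  difference. Comparing both distribution functions with the step function at 0 rules this out when
  \<open>X\<close> has a first moment.\<close>

lemma dW_df_eq:
  assumes X: "integrable M X"
  shows "(\<integral>\<^sup>+x. ennreal \<bar>real_df M X x - Phi x\<bar> \<partial>lborel) = ennreal (dW_df (real_df M X) Phi)"
proof -
  have [measurable]: "real_df M X \<in> borel_measurable borel"
    using X by (intro borel_measurable_real_df) auto
  have "(\<integral>\<^sup>+x. ennreal \<bar>real_df M X x - Phi x\<bar> \<partial>lborel) \<le>
    (\<integral>\<^sup>+x. ennreal \<bar>real_df M X x - indicator {0..} x\<bar> + ennreal \<bar>Phi x - indicator {0..} x\<bar> \<partial>lborel)"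
    by (intro nn_integral_mono) (auto simp: ennreal_plus[symmetric] simp del: ennreal_plus intro!: ennreal_leI)
  also have "\<dots> < \<infinity>"
    using nn_integral_df_step[OF X] nn_integral_Phi_step by (subst nn_integral_add) auto
  finally have "integrable lborel (\<lambda>x. \<bar>real_df M X x - Phi x\<bar>)"
    by (intro integrableI_nonneg) auto
  then show ?thesis unfolding dW_df_def by (intro nn_integral_eq_integral) auto
qed

lemma dK_df_bounds:
  "\<bar>real_df M X x - Phi x\<bar> \<le> dK_df (real_df M X) Phi" "dK_df (real_df M X) Phi \<le> 1"
proof -
  have b: "\<bar>real_df M X x - Phi x\<bar> \<le> 1" for x
    using Phi_nonneg[of x] Phi_le_1[of x] prob_le_1[of "{w \<in> space M. X w \<le> x}"]
      measure_nonneg[of M "{w \<in> space M. X w \<le> x}"] unfolding real_df_def abs_le_iff by linarith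
  then show "dK_df (real_df M X) Phi \<le> 1" unfolding dK_df_def by (intro cSUP_least) auto
  show "\<bar>real_df M X x - Phi x\<bar> \<le> dK_df (real_df M X) Phi"
    unfolding dK_df_def by (rule cSUP_upper) (use b in \<open>auto intro!: bdd_aboveI2\<close>)
qed

text \<open>The integral of a non-integrable function is 0 by convention, so a nonzero variance
  certifies that the square of the centred variable is integrable.\<close>

lemma integrable_if_variance:
  fixes X :: "'a \<Rightarrow> real"
  assumes [measurable]: "X \<in> borel_measurable M" and v: "variance X \<noteq> 0"
  shows "integrable M X"
proof -
  have "integrable M (\<lambda>w. (X w - expectation X)\<^sup>2)"
    using v not_integrable_integral_eq by blast
  then have "integrable M (\<lambda>w. X w - expectation X)"
    by (rule square_integrable_imp_integrable[rotated]) measurable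
  then have "integrable M (\<lambda>w. (X w - expectation X) + expectation X)"
    by (intro Bochner_Integration.integrable_add) auto
  then show ?thesis by simp
qed

text \<open>The factors \<open>4 / phi 1\<close> and \<open>32 / phi 2\<close> are the reciprocals
  of the constants in the two lower bounds: they convert the \<open>1 / \<sigma>\<close> paid for
  the Poisson law into a multiple of the distance itself.\<close>

lemma lattice_comparison:
  fixes W :: "'a \<Rightarrow> int" and \<sigma> \<mu> :: real
  assumes W [measurable]: "W \<in> measurable M (count_space UNIV)"
    and int: "integrable M (\<lambda>w. real_of_int (W w))" and \<sigma>: "1 \<le> \<sigma>"
  defines "R \<equiv> real_df M (\<lambda>w. (real_of_int (W w) - \<mu>) / \<sigma>)"
    and "f \<equiv> \<lambda>j. int_df M W j - TP_df \<mu> (\<sigma>\<^sup>2) j"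
    and "CK \<equiv> 1 / phi 1 + 6 + 12 * exp 1"
  shows "phi 1 / 4 / \<sigma> \<le> dK_df R Phi"
    and "phi 2 / 32 / \<sigma> \<le> dW_df R Phi"
    and "l1bnd 1 ((1 + CK * (4 / phi 1)) * dK_df R Phi) f"
    and "l1bnd n (\<sigma> * ((1 + 15 * (32 / phi 2)) * dW_df R Phi)) f"
proof -
  have R: "R x = int_df M W \<lfloor>\<mu> + \<sigma> * x\<rfloor>" for x
    unfolding R_def real_df_def int_df_def using \<sigma>
    by (intro arg_cong[where f = "measure M"]) (auto simp: le_floor_iff field_simps)
  define l where "l = \<sigma>\<^sup>2 + (\<mu> - \<sigma>\<^sup>2 - of_int \<lfloor>\<mu> - \<sigma>\<^sup>2\<rfloor>)"
  note par = TP_params(1,2)[OF \<sigma>] TP_params(3-6)[OF \<sigma>, of \<mu>, folded l_def]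
  have TP: "TP_df \<mu> (\<sigma>\<^sup>2) \<lfloor>\<mu> + \<sigma> * x\<rfloor> = pois_df l (1 / \<sigma>) x" for x
    unfolding l_def by (rule TP_df_scaled[OF \<sigma>])
  have KW: "\<bar>R x - Phi x\<bar> \<le> dK_df R Phi" for x unfolding R_def by (rule dK_df_bounds)
  have K0: "0 \<le> dK_df R Phi" using KW[of 0] by linarith
  have CK0: "0 < CK" unfolding CK_def by (intro add_nonneg_pos) (auto simp: normal_density_nonneg)
  show lowK: "phi 1 / 4 / \<sigma> \<le> dK_df R Phi"
    by (rule lattice_Phi_sup[OF \<sigma>, of "int_df M W" \<mu>]) (use KW in \<open>simp add: R\<close>)
  have intX: "integrable M (\<lambda>w. (real_of_int (W w) - \<mu>) / \<sigma>)"
    using int by (intro integrable_divide Bochner_Integration.integrable_diff) auto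
  have W_nn: "(\<integral>\<^sup>+x. ennreal \<bar>R x - Phi x\<bar> \<partial>lborel) = ennreal (dW_df R Phi)"
    unfolding R_def by (rule dW_df_eq[OF intX])
  have W0: "0 \<le> dW_df R Phi" unfolding dW_df_def by simp
  show lowW: "phi 2 / 32 / \<sigma> \<le> dW_df R Phi"
  proof -
    have "ennreal (phi 2 / 32 / \<sigma>) \<le> (\<integral>\<^sup>+x. ennreal \<bar>int_df M W \<lfloor>\<mu> + \<sigma> * x\<rfloor> - Phi x\<bar> \<partial>lborel)"
      by (rule lattice_Phi_L1[OF \<sigma>])
    also have "\<dots> = ennreal (dW_df R Phi)" unfolding W_nn[symmetric] R ..
    finally show ?thesis using W0 by (simp add: ennreal_le_iff)
  qed
  show "l1bnd 1 ((1 + CK * (4 / phi 1)) * dK_df R Phi) f"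
  proof (rule l1bnd_1I)
    show "0 \<le> (1 + CK * (4 / phi 1)) * dK_df R Phi"
      using K0 CK0 by (intro mult_nonneg_nonneg add_nonneg_nonneg) (auto simp: normal_density_nonneg)
    fix j
    define x where "x = (of_int j - \<mu>) / \<sigma>"
    have j: "\<lfloor>\<mu> + \<sigma> * x\<rfloor> = j" using \<sigma> by (simp add: x_def)
    have "\<bar>f j\<bar> \<le> \<bar>R x - Phi x\<bar> + \<bar>pois_df l (1 / \<sigma>) x - Phi x\<bar>"
      unfolding f_def R TP[symmetric] j by linarith
    also have "\<dots> \<le> dK_df R Phi + CK * (1 / \<sigma>)"
      unfolding CK_def by (intro add_mono KW pois_df_Phi_sup par)
    also have "CK * (1 / \<sigma>) \<le> CK * (4 / phi 1 * dK_df R Phi)"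
      using lowK CK0 \<sigma> phi_pos[of 1] by (intro mult_left_mono) (auto simp: field_simps simp del: phi_pos)
    finally show "\<bar>f j\<bar> \<le> (1 + CK * (4 / phi 1)) * dK_df R Phi" by (simp add: algebra_simps)
  qed
  show "l1bnd n (\<sigma> * ((1 + 15 * (32 / phi 2)) * dW_df R Phi)) f"
  proof (rule l1bnd_if_step_nn_integral[where \<mu> = \<mu>])
    show "0 < \<sigma>" using \<sigma> by simp
    show "0 \<le> (1 + 15 * (32 / phi 2)) * dW_df R Phi"
      using W0 by (intro mult_nonneg_nonneg add_nonneg_nonneg) (auto simp: normal_density_nonneg)
    have [measurable]: "R \<in> borel_measurable borel"
      unfolding R_def using intX by (intro borel_measurable_real_df) auto
    have [measurable]: "pois_df l (1 / \<sigma>) \<in> borel_measurable borel"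
    proof (rule borel_measurable_mono)
      have "mono (TP_df \<mu> (\<sigma>\<^sup>2))"
        unfolding mono_def TP_df_def by (intro allI impI measure_pmf.finite_measure_mono) auto
      then show "mono (pois_df l (1 / \<sigma>))"
        unfolding mono_def TP[symmetric] using \<sigma>
        by (intro allI impI) (simp add: floor_mono)
    qed
    have "(\<integral>\<^sup>+x. ennreal \<bar>f \<lfloor>\<mu> + \<sigma> * x\<rfloor>\<bar> \<partial>lborel)
       \<le> (\<integral>\<^sup>+x. ennreal \<bar>R x - Phi x\<bar> + ennreal \<bar>pois_df l (1 / \<sigma>) x - Phi x\<bar> \<partial>lborel)"
      unfolding f_def R[symmetric] TP
      by (intro nn_integral_mono) (auto simp: ennreal_plus[symmetric] simp del: ennreal_plus intro!: ennreal_leI)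
    also have "\<dots> \<le> ennreal (dW_df R Phi) + ennreal (15 * (1 / \<sigma>))"
      by (subst nn_integral_add) (auto simp: W_nn simp del: ennreal_plus intro!: add_mono pois_df_Phi_nn_integral[THEN order_trans] par)
    also have "\<dots> = ennreal (dW_df R Phi + 15 * (1 / \<sigma>))" using W0 \<sigma> by simp
    also have "\<dots> \<le> ennreal ((1 + 15 * (32 / phi 2)) * dW_df R Phi)"
    proof (rule ennreal_leI)
      have "1 / \<sigma> \<le> 32 / phi 2 * dW_df R Phi"
        using lowW \<sigma> phi_pos[of 2] by (auto simp: field_simps simp del: phi_pos)
      then have "15 * (1 / \<sigma>) \<le> 15 * (32 / phi 2 * dW_df R Phi)" by simp
      then show "dW_df R Phi + 15 * (1 / \<sigma>) \<le> (1 + 15 * (32 / phi 2)) * dW_df R Phi"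
        by (simp only: distrib_right mult_1 mult.assoc)
    qed
    finally show "(\<integral>\<^sup>+x. ennreal \<bar>f \<lfloor>\<mu> + \<sigma> * x\<rfloor>\<bar> \<partial>lborel)
      \<le> ennreal ((1 + 15 * (32 / phi 2)) * dW_df R Phi)" .
  qed
qed

end

section \<open>Choice of the window length\<close>

lemma rate_optimisation:
  fixes x C c D \<sigma> s \<theta> :: real and r e :: nat
  assumes bound: "\<And>m::nat. 0 < m \<Longrightarrow> x \<le> C * ((real m / \<sigma>) ^ r + \<sigma> powr (- s) + D * (\<sigma> / real m) ^ e)"
    and C: "0 \<le> C" and \<sigma>: "1 \<le> \<sigma>" and c: "0 < c" "c / \<sigma> \<le> D" and D: "D \<le> 1" and e: "0 < e"
    and \<theta>: "\<theta> \<le> real r / (real r + real e)" "\<theta> \<le> s" and s: "0 \<le> s"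
  shows "x \<le> C * ((1 + 1 / c) ^ r + (1 / c) powr s + 1) * D powr \<theta>"
proof -
  have D0: "0 < D" using c \<sigma> by (intro less_le_trans[OF _ c(2)]) auto
  \<comment> \<open>\<open>t\<close> is the ideal value of \<open>m / \<sigma>\<close>, the solution
    of \<open>t ^ r = D / t ^ e\<close>.\<close>
  define t where "t = D powr (1 / (real r + real e))"
  have t0: "0 < t" using D0 by (simp add: t_def)
  have tD: "D \<le> t"
  proof -
    have "D powr 1 \<le> t" unfolding t_def using D D0 e by (intro powr_mono') auto
    then show ?thesis using D0 by simp
  qed
  have st: "c \<le> \<sigma> * t"
  proof -
    have "c \<le> \<sigma> * D" using c \<sigma> by (simp add: field_simps)
    also have "\<dots> \<le> \<sigma> * t" using tD \<sigma> by simp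
    finally show ?thesis .
  qed
  \<comment> \<open>Rounding up adds at most \<open>1 \<le> \<sigma> * t / c\<close>, by
    \<open>c / \<sigma> \<le> D \<le> t\<close>; hence the factor \<open>1 + 1 / c\<close>
    below.\<close>
  define m where "m = nat \<lceil>\<sigma> * t\<rceil>"
  have "0 < \<sigma> * t" using st c by simp
  then have m: "0 < m" "\<sigma> * t \<le> real m" "real m \<le> \<sigma> * t + 1" unfolding m_def by linarith+
  have m2: "real m / \<sigma> \<le> t * (1 + 1 / c)"
  proof -
    have "1 \<le> \<sigma> * t / c" using st c by simp
    then have "real m \<le> \<sigma> * (t * (1 + 1 / c))" using m(3) by (simp add: algebra_simps)
    then show ?thesis using \<sigma> by (simp add: divide_le_eq mult.commute)
  qed
  have tr: "t ^ r = D powr (real r / (real r + real e))"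
    unfolding t_def using D0 by (simp add: powr_realpow[symmetric] powr_powr)
  have te: "D / t ^ e = D powr (real r / (real r + real e))"
  proof -
    have "t ^ e = D powr (real e / (real r + real e))"
      unfolding t_def using D0 by (simp add: powr_realpow[symmetric] powr_powr)
    then have "D / t ^ e = D powr (1 - real e / (real r + real e))" using D0 by (simp add: powr_diff)
    also have "1 - real e / (real r + real e) = real r / (real r + real e)" using e by (simp add: field_simps)
    finally show ?thesis .
  qed
  have \<theta>r: "D powr (real r / (real r + real e)) \<le> D powr \<theta>" using \<theta> D D0 by (intro powr_mono') auto
  have 1: "(real m / \<sigma>) ^ r \<le> (1 + 1 / c) ^ r * D powr \<theta>"
  proof -
    have "(real m / \<sigma>) ^ r \<le> (t * (1 + 1 / c)) ^ r" using m2 \<sigma> by (intro power_mono) auto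
    also have "\<dots> = (1 + 1 / c) ^ r * D powr (real r / (real r + real e))" by (simp add: power_mult_distrib tr)
    also have "\<dots> \<le> (1 + 1 / c) ^ r * D powr \<theta>" using \<theta>r c by (intro mult_left_mono) auto
    finally show ?thesis .
  qed
  have 2: "\<sigma> powr (- s) \<le> (1 / c) powr s * D powr \<theta>"
  proof -
    have "1 / \<sigma> \<le> 1 / c * D" using c \<sigma> by (simp add: field_simps)
    then have "(1 / \<sigma>) powr s \<le> (1 / c * D) powr s" using s \<sigma> by (intro powr_mono2) auto
    also have "\<dots> = (1 / c) powr s * D powr s" by (rule powr_mult)
    also have "\<dots> \<le> (1 / c) powr s * D powr \<theta>" using \<theta> D D0 by (intro mult_left_mono powr_mono') auto
    also have "(1 / \<sigma>) powr s = \<sigma> powr (- s)" using \<sigma> by (simp add: powr_divide powr_minus_divide)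
    finally show ?thesis .
  qed
  have 3: "D * (\<sigma> / real m) ^ e \<le> D powr \<theta>"
  proof -
    have "\<sigma> / real m \<le> 1 / t" using m t0 by (simp add: field_simps)
    then have "(\<sigma> / real m) ^ e \<le> (1 / t) ^ e" using \<sigma> by (intro power_mono) auto
    then have "D * (\<sigma> / real m) ^ e \<le> D * (1 / t) ^ e" using D0 by (intro mult_left_mono) auto
    also have "\<dots> = D powr (real r / (real r + real e))" using te by (simp add: power_divide)
    finally show ?thesis using \<theta>r by simp
  qed
  have "x \<le> C * ((real m / \<sigma>) ^ r + \<sigma> powr (- s) + D * (\<sigma> / real m) ^ e)" by (rule bound[OF m(1)])
  also have "\<dots> \<le> C * ((1 + 1 / c) ^ r * D powr \<theta> + (1 / c) powr s * D powr \<theta> + D powr \<theta>)"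
    using C 1 2 3 by (intro mult_left_mono add_mono) auto
  finally show ?thesis by (simp add: algebra_simps)
qed

section \<open>Rates of convergence\<close>

lemma fdiff_pow_shift: "(fdiff ^^ r) (\<lambda>j. g (j + a)) = (\<lambda>j. (fdiff ^^ r) g (j + a))"
proof (induction r)
  case (Suc r)
  then show ?case by (auto simp: fdiff_def ac_simps)
qed auto

lemma fdiff_pow_diff: "(fdiff ^^ r) (\<lambda>j. g j - h j) = (\<lambda>j. (fdiff ^^ r) g j - (fdiff ^^ r) h j)"
proof (induction r)
  case (Suc r)
  then show ?case by (auto simp: fdiff_def)
qed auto

text \<open>The first term belongs to a random sum with at least
  \<open>\<beta> * \<sigma>\<^sup>2\<close> summands, the second to a Poisson law with parameter at
  least \<open>\<sigma>\<^sup>2\<close>; from both a factor \<open>1 / \<sigma> ^ r\<close> has been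
  taken out.\<close>

definition smoothing_const :: "real \<Rightarrow> real \<Rightarrow> nat \<Rightarrow> real" where
  "smoothing_const u \<beta> r = sqrt (8 * real r / (u * \<beta>)) ^ r + sqrt (16 * real r * exp 2) ^ r"

context prob_subalgebra
begin

text \<open>\<open>h\<close> collects the point masses on the event
  \<open>N \<ge> \<beta> * \<sigma>\<^sup>2\<close>, minus those of the Poisson law;
  \<open>p\<close> collects the masses on the complement, which are controlled through their total
  alone. Both parts of the law stay unnormalised, so that they simply add up.\<close>

lemma l1bnd_split_df:
  assumes Y [measurable]: "Y \<in> measurable M (count_space UNIV)"
    and Z: "\<And>i. Z i \<in> measurable M (count_space UNIV)"
    and W [measurable]: "W \<in> measurable M (count_space UNIV)"
    and N: "N \<in> measurable F (count_space UNIV)"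
    and dec: "\<And>w. w \<in> space M \<Longrightarrow> W w = Y w + (\<Sum>i=1..N w. Z i w)"
    and ci: "\<And>n. cond_indep_on M F {w \<in> space M. N w = n} (\<lambda>i. if i = 0 then Y else Z i) n"
    and sm: "AE w in M. \<forall>i\<in>{1..N w}. u \<le> 1 - D1_df (cond_df M F (Z i) w) / 2"
    and u: "0 < u" and \<beta>: "0 < \<beta>" and \<sigma>: "1 \<le> \<sigma>"
  obtains h p where "\<forall>j. fdiff (\<lambda>j. int_df M W j - TP_df \<mu> (\<sigma>\<^sup>2) j) j = h j + p j"
    "\<forall>r n. 1 \<le> n \<longrightarrow> l1bnd n (smoothing_const u \<beta> r / \<sigma> ^ r) ((fdiff ^^ r) h)"
    "\<forall>n. l1bnd n (measure M {w \<in> space M. real (N w) < \<beta> * \<sigma>\<^sup>2}) p"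
proof -
  define X where "X i = (if i = 0 then Y else Z i)" for i :: nat
  have X [measurable]: "X i \<in> measurable M (count_space UNIV)" for i using Z by (simp add: X_def)
  have NM [measurable]: "N \<in> measurable M (count_space UNIV)"
    using measurable_from_subalg[OF sub N] .
  define L where "L = \<beta> * \<sigma>\<^sup>2"
  have L: "0 < L" using \<beta> \<sigma> by (simp add: L_def)
  have sumX: "(\<Sum>i\<le>N w. X i w) = W w" if "w \<in> space M" for w
  proof -
    have "{..N w} = insert 0 {1..N w}" by auto
    then show ?thesis using dec[OF that] by (simp add: X_def)
  qed
  define l where "l = \<sigma>\<^sup>2 + (\<mu> - \<sigma>\<^sup>2 - of_int \<lfloor>\<mu> - \<sigma>\<^sup>2\<rfloor>)"
  have l: "\<sigma>\<^sup>2 \<le> l" "1 \<le> l"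
    using TP_params(3)[OF \<sigma>, of \<mu>] one_le_power[OF \<sigma>, of 2] unfolding l_def by linarith+
  define p1 where "p1 s = measure M {w \<in> space M. L \<le> real (N w) \<and> (\<Sum>i\<le>N w. X i w) = s}" for s
  define p2 where "p2 s = measure M {w \<in> space M. real (N w) < L \<and> W w = s}" for s
  have p1_eq: "p1 s = measure M {w \<in> space M. L \<le> real (N w) \<and> W w = s}" for s
    unfolding p1_def by (intro arg_cong[where f = "measure M"]) (auto simp: sumX)
  have split: "fdiff (int_df M W) j = p1 (j + 1) + p2 (j + 1)" for j
  proof -
    have "fdiff (int_df M W) j = measure M ({w \<in> space M. W w \<le> j + 1} - {w \<in> space M. W w \<le> j})"
      unfolding fdiff_def int_df_def by (subst finite_measure_Diff) auto
    also have "{w \<in> space M. W w \<le> j + 1} - {w \<in> space M. W w \<le> j}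
       = {w \<in> space M. L \<le> real (N w) \<and> W w = j + 1} \<union> {w \<in> space M. real (N w) < L \<and> W w = j + 1}" by auto
    also have "measure M \<dots> = p1 (j + 1) + p2 (j + 1)"
      unfolding p1_eq p2_def by (rule finite_measure_Union) auto
    finally show ?thesis .
  qed
  define h where "h j = p1 (j + 1) - pois l (j + (1 - \<lfloor>\<mu> - \<sigma>\<^sup>2\<rfloor>))" for j
  show thesis
  proof (rule that[of h "\<lambda>j. p2 (j + 1)"]; intro allI impI)
    fix j
    have "fdiff (\<lambda>j. int_df M W j - TP_df \<mu> (\<sigma>\<^sup>2) j) j = fdiff (int_df M W) j - fdiff (TP_df \<mu> (\<sigma>\<^sup>2)) j"
      by (simp add: fdiff_def)
    also have "\<dots> = h j + p2 (j + 1)"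
      using \<sigma> by (subst TP_df_eq(2)) (auto simp: split h_def l_def)
    finally show "fdiff (\<lambda>j. int_df M W j - TP_df \<mu> (\<sigma>\<^sup>2) j) j = h j + p2 (j + 1)" .
  next
    fix r n :: nat assume n: "1 \<le> n"
    have sm': "AE w in M. \<forall>i\<in>{1..N w}. u \<le> 1 - D1_df (cond_df M F (X i) w) / 2"
      using sm by eventually_elim (auto simp: X_def)
    have "l1bnd n (sqrt (8 * real r / (u * L)) ^ r) ((fdiff ^^ r) p1)"
      using l1bnd_random_sum_law[OF X N _ sm' u L n, of r] ci unfolding p1_def X_def by blast
    moreover have "sqrt (8 * real r / (u * L)) = sqrt (8 * real r / (u * \<beta>)) / \<sigma>"
      using \<sigma> by (simp add: L_def real_sqrt_divide real_sqrt_mult)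
    ultimately have 1: "l1bnd n (sqrt (8 * real r / (u * \<beta>)) ^ r / \<sigma> ^ r) ((fdiff ^^ r) p1)"
      by (simp add: power_divide)
    have 2: "l1bnd n (sqrt (16 * real r * exp 2) ^ r / \<sigma> ^ r) ((fdiff ^^ r) (pois l))"
    proof (rule l1bnd_mono[OF l1bnd_fdiff_pow_pois[OF l(2) n]])
      have "sqrt (16 * real r * exp 2 / l) \<le> sqrt (16 * real r * exp 2 / \<sigma>\<^sup>2)"
        using l \<sigma> by (intro real_sqrt_le_mono divide_left_mono) auto
      also have "\<dots> = sqrt (16 * real r * exp 2) / \<sigma>" using \<sigma> by (simp add: real_sqrt_divide)
      finally show "sqrt (16 * real r * exp 2 / l) ^ r \<le> sqrt (16 * real r * exp 2) ^ r / \<sigma> ^ r"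
        using l unfolding power_divide[symmetric] by (intro power_mono) auto
    qed
    show "l1bnd n (smoothing_const u \<beta> r / \<sigma> ^ r) ((fdiff ^^ r) h)"
      unfolding h_def[abs_def] fdiff_pow_diff fdiff_pow_shift smoothing_const_def add_divide_distrib
      by (intro l1bnd_diff l1bnd_shift 1 2)
  next
    fix n
    have "l1bnd n (measure M {w \<in> space M. real (N w) < L}) p2"
      unfolding l1bnd_def
    proof (intro allI impI)
      fix A :: "int set" assume A: "finite A \<and> card A \<le> n"
      have "(\<Sum>s\<in>A. \<bar>p2 s\<bar>) = (\<Sum>s\<in>A. measure M {w \<in> space M. real (N w) < L \<and> W w = s})"
        by (simp add: p2_def)
      also have "\<dots> = measure M (\<Union>s\<in>A. {w \<in> space M. real (N w) < L \<and> W w = s})"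
        using A by (intro finite_measure_finite_Union[symmetric]) (auto simp: disjoint_family_on_def)
      also have "\<dots> \<le> measure M {w \<in> space M. real (N w) < L}"
        by (intro finite_measure_mono) auto
      finally show "(\<Sum>s\<in>A. \<bar>p2 s\<bar>) \<le> measure M {w \<in> space M. real (N w) < L}" .
    qed
    then show "l1bnd n (measure M {w \<in> space M. real (N w) < \<beta> * \<sigma>\<^sup>2}) (\<lambda>j. p2 (j + 1))"
      unfolding L_def by (rule l1bnd_shift)
  qed
qed

end

definition rate_const :: "nat \<Rightarrow> real \<Rightarrow> real \<Rightarrow> real" where
  "rate_const r c s = (1 + 1 / c) ^ r + (1 / c) powr s + 1"

text \<open>The analytic core, free of probability: \<open>DK\<close> and \<open>DW\<close> stand for the Kolmogorov and
  Wasserstein distances and \<open>f\<close> for the difference of the two distribution functions.\<close>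
lemma rates_of_convergence:
  fixes \<sigma> k A B P0 P cK cW aK aW DK DW :: real and f h p :: "int \<Rightarrow> real" and r :: nat
  assumes \<sigma>: "1 \<le> \<sigma>" and k: "1 \<le> k" and r: "k \<le> real r"
    and split: "\<And>j. fdiff f j = h j + p j"
    and h0: "\<And>n. 1 \<le> n \<Longrightarrow> l1bnd n B h"
    and hr: "\<And>n. 1 \<le> n \<Longrightarrow> l1bnd n (A / \<sigma> ^ r) ((fdiff ^^ r) h)"
    and hr1: "\<And>n. 1 \<le> n \<Longrightarrow> l1bnd n (A / \<sigma> ^ Suc r) ((fdiff ^^ Suc r) h)"
    and p: "\<And>n. l1bnd n P p" "P \<le> P0 * \<sigma> powr (- k)" "P \<le> 1"
    and fK: "l1bnd 1 (aK * DK) f" and fW: "\<And>n. l1bnd n (\<sigma> * (aW * DW)) f"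
    and cK: "0 < cK" "cK / \<sigma> \<le> DK" "DK \<le> 1" and cW: "0 < cW" "cW / \<sigma> \<le> DW"
    and nonneg: "0 \<le> A" "0 \<le> P0" "0 \<le> aK" "0 \<le> aW"
  defines "C \<equiv> 2 ^ r * (A + P0 + 2 * aK + 2 * aW)"
  shows "\<bar>fdiff f j\<bar> \<le> C * rate_const r cK (k - 1) * (DK powr (1 - 1 / k) / \<sigma>)"
    and "\<bar>fdiff f j\<bar> \<le> C * (rate_const r cW (k - 1) + rate_const r cK (k - 1)) * (DW powr (1 - 2 / (k + 1)) / \<sigma>)"
    and "l1bnd n ((C * rate_const r cW k + (B + 1)) * DW powr (k / (k + 1))) (fdiff f)"
proof -
  have \<sigma>0: "0 < \<sigma>" using \<sigma> by simp
  have C0: "0 \<le> C" using nonneg by (simp add: C_def)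
  have opt1: "1 \<le> rate_const r c s" if "0 < c" for c s using that by (simp add: rate_const_def)
  have DK0: "0 < DK" using cK \<sigma>0 by (intro less_le_trans[OF _ cK(2)]) auto
  have DW0: "0 < DW" using cW \<sigma>0 by (intro less_le_trans[OF _ cW(2)]) auto
  have B0: "0 \<le> B" using h0[of 1] l1bnd_nonneg by blast
  \<comment> \<open>\<open>c\<close> carries a Kolmogorov term and \<open>d\<close> a Wasserstein
    term; each use sets one of them to 0.\<close>
  have comb: "2 ^ r * (a * A + b * P0 + c * (2 * aK) + d * (2 * aW)) \<le> C * (a + b + e)"
    if "0 \<le> a" "0 \<le> b" "0 \<le> c" "0 \<le> d" "c + d \<le> e" for a b c d e :: real
  proof -
    have "a * A + b * P0 + c * (2 * aK) + d * (2 * aW) \<le> (A + P0 + 2 * aK + 2 * aW) * (a + b + e)"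
    proof -
      have "a * A \<le> A * (a + b + e)" "b * P0 \<le> P0 * (a + b + e)"
        "c * (2 * aK) \<le> 2 * aK * (a + b + e)" "d * (2 * aW) \<le> 2 * aW * (a + b + e)"
        using that nonneg by (auto simp: mult.commute[of _ "a + b + e"] intro!: mult_right_mono)
      then show ?thesis by (simp add: distrib_right)
    qed
    then show ?thesis unfolding C_def mult.assoc by (intro mult_left_mono) auto
  qed
  \<comment> \<open>The 1-norm of difference \<open>r + 1\<close> bounds the supremum of difference
    \<open>r\<close>: this extra \<open>1 / \<sigma>\<close> matches the one in the local
    rates.\<close>
  have hs: "l1bnd 1 (A / \<sigma> ^ Suc r) ((fdiff ^^ r) h)"
  proof (rule l1bnd_sup_le_fdiff)
    show "l1bnd n (A / \<sigma> ^ r) ((fdiff ^^ r) h)" for n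
      using hr[of "max n 1"] l1bnd_le_n[of "max n 1" _ _ n] by simp
    show "l1bnd n (A / \<sigma> ^ Suc r) (fdiff ((fdiff ^^ r) h))" for n
      using hr1[of "max n 1"] l1bnd_le_n[of "max n 1" _ _ n] by simp
  qed
  \<comment> \<open>The exceptional event has the same bound in supremum norm as in 1-norm, so after
    multiplication by \<open>\<sigma>\<close> only the power \<open>k - 1\<close> is left.\<close>
  have powk: "\<sigma> * \<sigma> powr (- k) = \<sigma> powr (- (k - 1))"
    using \<sigma>0 powr_add[of \<sigma> 1 "- k"] by simp
  have supbound: "\<sigma> * \<bar>fdiff f j\<bar> \<le> 2 ^ r * ((real m / \<sigma>) ^ r * A + \<sigma> powr (- (k - 1)) * P0 + \<sigma> * b)"
    if m: "0 < m" and b: "l1bnd 1 b (fdiff (avg m (avg m f)))" for m b j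
  proof -
    have "\<bar>fdiff f j\<bar> \<le> (2 * real m) ^ r * (A / \<sigma> ^ Suc r) + 2 ^ r * (P0 * \<sigma> powr (- k)) + 2 ^ r * b"
      by (rule l1bnd_pointwise[OF l1bnd_fdiff_interpolation[OF m split hs l1bnd_mono[OF p(1,2)] b]]) simp
    then have "\<sigma> * \<bar>fdiff f j\<bar> \<le> \<sigma> * ((2 * real m) ^ r * (A / \<sigma> ^ Suc r) + 2 ^ r * (P0 * \<sigma> powr (- k)) + 2 ^ r * b)"
      using \<sigma>0 by (intro mult_left_mono) auto
    also have "\<dots> = 2 ^ r * ((real m / \<sigma>) ^ r * A + \<sigma> * \<sigma> powr (- k) * P0 + \<sigma> * b)"
      using \<sigma>0 by (simp add: power_mult_distrib power_divide field_simps)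
    finally show ?thesis unfolding powk .
  qed
  have K: "\<sigma> * \<bar>fdiff f j\<bar> \<le> C * ((real m / \<sigma>) ^ r + \<sigma> powr (- (k - 1)) + DK * (\<sigma> / real m) ^ 1)" if m: "0 < m" for m j
  proof -
    have "l1bnd 1 (2 * (aK * DK) / real m) (fdiff (avg m (avg m f)))"
      by (intro l1bnd_fdiff_avg l1bnd_avg fK)
    from supbound[OF m this, of j] have "\<sigma> * \<bar>fdiff f j\<bar> \<le> 2 ^ r * ((real m / \<sigma>) ^ r * A + \<sigma> powr (- (k - 1)) * P0
        + (DK * (\<sigma> / real m) ^ 1) * (2 * aK) + 0 * (2 * aW))" by (simp add: mult_ac)
    also have "\<dots> \<le> C * ((real m / \<sigma>) ^ r + \<sigma> powr (- (k - 1)) + DK * (\<sigma> / real m) ^ 1)"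
      using \<sigma>0 DK0 by (intro comb) auto
    finally show ?thesis .
  qed
  have W: "\<sigma> * \<bar>fdiff f j\<bar> \<le> C * ((real m / \<sigma>) ^ r + \<sigma> powr (- (k - 1)) + DW * (\<sigma> / real m) ^ 2)" if m: "0 < m" for m j
  proof -
    have "l1bnd n (2 * (\<sigma> * (aW * DW)) / real m) (fdiff (avg m f))" for n
      by (intro l1bnd_fdiff_avg fW)
    then have "l1bnd 1 (2 * (\<sigma> * (aW * DW)) / real m / real m) (avg m (fdiff (avg m f)))"
      by (rule l1bnd_avg_sup)
    then have "l1bnd 1 (2 * (\<sigma> * (aW * DW)) / real m / real m) (fdiff (avg m (avg m f)))"
      by (simp only: fdiff_avg)
    from supbound[OF m this, of j] have "\<sigma> * \<bar>fdiff f j\<bar> \<le> 2 ^ r * ((real m / \<sigma>) ^ r * A + \<sigma> powr (- (k - 1)) * P0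
        + 0 * (2 * aK) + (DW * (\<sigma> / real m) ^ 2) * (2 * aW))" by (simp add: power2_eq_square mult_ac)
    also have "\<dots> \<le> C * ((real m / \<sigma>) ^ r + \<sigma> powr (- (k - 1)) + DW * (\<sigma> / real m) ^ 2)"
      using \<sigma>0 DW0 by (intro comb) auto
    finally show ?thesis .
  qed
  have T: "(\<Sum>j\<in>S. \<bar>fdiff f j\<bar>) \<le> C * ((real m / \<sigma>) ^ r + \<sigma> powr (- k) + DW * (\<sigma> / real m) ^ 1)"
    if m: "0 < m" and S: "finite S" for m S
  proof -
    let ?n = "Suc (card S)"
    have "l1bnd ?n (2 * (\<sigma> * (aW * DW)) / real m) (fdiff (avg m (avg m f)))"
      by (intro l1bnd_fdiff_avg l1bnd_avg fW)
    then have "l1bnd ?n ((2 * real m) ^ r * (A / \<sigma> ^ r) + 2 ^ r * (P0 * \<sigma> powr (- k))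
       + 2 ^ r * (2 * (\<sigma> * (aW * DW)) / real m)) (fdiff f)"
      by (intro l1bnd_fdiff_interpolation[OF m split] hr l1bnd_mono[OF p(1,2)]) auto
    from l1bndD[OF this S] have "(\<Sum>j\<in>S. \<bar>fdiff f j\<bar>) \<le> (2 * real m) ^ r * (A / \<sigma> ^ r) + 2 ^ r * (P0 * \<sigma> powr (- k))
       + 2 ^ r * (2 * (\<sigma> * (aW * DW)) / real m)" by simp
    also have "\<dots> = 2 ^ r * ((real m / \<sigma>) ^ r * A + \<sigma> powr (- k) * P0 + 0 * (2 * aK) + (DW * (\<sigma> / real m) ^ 1) * (2 * aW))"
      by (simp add: power_mult_distrib power_divide field_simps)
    also have "\<dots> \<le> C * ((real m / \<sigma>) ^ r + \<sigma> powr (- k) + DW * (\<sigma> / real m) ^ 1)"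
      using \<sigma>0 DW0 by (intro comb) auto
    finally show ?thesis .
  qed
  \<comment> \<open>For \<open>r \<ge> k\<close> the balanced exponents are at least the claimed
    ones, and a distance of at most 1 only decreases when its exponent grows.\<close>
  have "1 - 1 / k \<le> 1 - 1 / (real r + 1)" using k r by (simp add: frac_le)
  then have \<theta>1: "1 - 1 / k \<le> real r / (real r + real 1)" by (simp add: field_simps)
  have "1 - 2 / (k + 1) \<le> 1 - 2 / (real r + 2)" using k r by (simp add: frac_le)
  then have \<theta>2: "1 - 2 / (k + 1) \<le> real r / (real r + real 2)" by (simp add: field_simps)
  have "1 - 1 / (k + 1) \<le> 1 - 1 / (real r + 1)" using k r by (simp add: frac_le)
  then have \<theta>3: "k / (k + 1) \<le> real r / (real r + real 1)" using k by (simp add: field_simps)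
  have "(k - 1) / k \<le> (k - 1) / 1" "(k - 1) / (k + 1) \<le> (k - 1) / 1" "k / (k + 1) \<le> k / 1"
    using k divide_left_mono[of 1 k "k - 1"] divide_left_mono[of 1 "k + 1" "k - 1"]
      divide_left_mono[of 1 "k + 1" k] by auto
  moreover have "1 - 1 / k = (k - 1) / k" "1 - 2 / (k + 1) = (k - 1) / (k + 1)"
    using k by (auto simp: field_simps)
  ultimately have s: "1 - 1 / k \<le> k - 1" "1 - 2 / (k + 1) \<le> k - 1" "k / (k + 1) \<le> k"
    by simp_all
  have 1: "\<sigma> * \<bar>fdiff f j\<bar> \<le> C * rate_const r cK (k - 1) * DK powr (1 - 1 / k)" for j
    unfolding rate_const_def
    by (rule rate_optimisation[OF K C0 \<sigma> cK _ \<theta>1 s(1)]) (use k in auto)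
  then show "\<bar>fdiff f j\<bar> \<le> C * rate_const r cK (k - 1) * (DK powr (1 - 1 / k) / \<sigma>)"
    using \<sigma>0 by (simp add: field_simps)
  have 2: "\<sigma> * \<bar>fdiff f j\<bar> \<le> C * (rate_const r cW (k - 1) + rate_const r cK (k - 1)) * DW powr (1 - 2 / (k + 1))"
  proof (cases "DW \<le> 1")
    case True
    have "\<sigma> * \<bar>fdiff f j\<bar> \<le> C * rate_const r cW (k - 1) * DW powr (1 - 2 / (k + 1))"
      unfolding rate_const_def
      by (rule rate_optimisation[OF W C0 \<sigma> cW True _ \<theta>2 s(2)]) (use k in auto)
    also have "\<dots> \<le> C * (rate_const r cW (k - 1) + rate_const r cK (k - 1)) * DW powr (1 - 2 / (k + 1))"
      using C0 opt1[OF cK(1), of "k - 1"] by (intro mult_right_mono mult_left_mono) auto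
    finally show ?thesis .
  next
    \<comment> \<open>Unlike \<open>DK\<close>, the Wasserstein distance may exceed 1. The
      Kolmogorov estimate with \<open>DK \<le> 1\<close> then gives a constant, while a nonnegative
      power of \<open>DW\<close> is at least 1.\<close>
    case False
    have "DK powr (1 - 1 / k) \<le> 1 powr (1 - 1 / k)" using DK0 cK k by (intro powr_mono2) auto
    then have a: "DK powr (1 - 1 / k) \<le> 1" by simp
    have "1 powr (1 - 2 / (k + 1)) \<le> DW powr (1 - 2 / (k + 1))" using False k by (intro powr_mono2) auto
    then have b: "1 \<le> DW powr (1 - 2 / (k + 1))" by simp
    have "\<sigma> * \<bar>fdiff f j\<bar> \<le> C * rate_const r cK (k - 1) * 1"
      using 1[of j] mult_left_mono[OF a, of "C * rate_const r cK (k - 1)"] C0 opt1[OF cK(1), of "k - 1"] by auto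
    also have "\<dots> \<le> C * (rate_const r cW (k - 1) + rate_const r cK (k - 1)) * DW powr (1 - 2 / (k + 1))"
      using C0 opt1[OF cK(1), of "k - 1"] opt1[OF cW(1), of "k - 1"] b
      by (intro mult_mono mult_left_mono) auto
    finally show ?thesis .
  qed
  then show "\<bar>fdiff f j\<bar> \<le> C * (rate_const r cW (k - 1) + rate_const r cK (k - 1)) * (DW powr (1 - 2 / (k + 1)) / \<sigma>)"
    using \<sigma>0 by (simp add: field_simps)
  show "l1bnd n ((C * rate_const r cW k + (B + 1)) * DW powr (k / (k + 1))) (fdiff f)"
    unfolding l1bnd_def
  proof (intro allI impI)
    fix S :: "int set" assume S: "finite S \<and> card S \<le> n"
    show "(\<Sum>j\<in>S. \<bar>fdiff f j\<bar>) \<le> (C * rate_const r cW k + (B + 1)) * DW powr (k / (k + 1))"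
    proof (cases "DW \<le> 1")
      case True
      have "(\<Sum>j\<in>S. \<bar>fdiff f j\<bar>) \<le> C * rate_const r cW k * DW powr (k / (k + 1))"
        unfolding rate_const_def
        by (rule rate_optimisation[OF T C0 \<sigma> cW True _ \<theta>3 s(3)]) (use k S in auto)
      also have "\<dots> \<le> (C * rate_const r cW k + (B + 1)) * DW powr (k / (k + 1))"
        using B0 by (intro mult_right_mono) auto
      finally show ?thesis .
    next
      \<comment> \<open>Again \<open>DW > 1\<close>, and a constant suffices: \<open>B\<close>
        bounds the 1-norm of \<open>h\<close> and 1 that of \<open>p\<close>.\<close>
      case False
      have "1 powr (k / (k + 1)) \<le> DW powr (k / (k + 1))" using False k by (intro powr_mono2) auto
      then have b: "1 \<le> DW powr (k / (k + 1))" by simp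
      have "l1bnd (Suc n) (B + 1) (fdiff f)"
        unfolding split[abs_def] by (intro l1bnd_add h0 l1bnd_mono[OF p(1,3)]) auto
      then have "(\<Sum>j\<in>S. \<bar>fdiff f j\<bar>) \<le> (B + 1) * 1" using l1bndD[of "Suc n" "B + 1" "fdiff f" S] S by simp
      also have "\<dots> \<le> (C * rate_const r cW k + (B + 1)) * DW powr (k / (k + 1))"
        using b B0 C0 opt1[OF cW(1), of k] by (intro mult_mono) auto
      finally show ?thesis .
    qed
  qed
qed

theorem theorem5:
  fixes S :: "real set"
    and M F :: "real \<Rightarrow> 'a measure"
    and W Y :: "real \<Rightarrow> 'a \<Rightarrow> int"
    and Z :: "real \<Rightarrow> nat \<Rightarrow> 'a \<Rightarrow> int"
    and N :: "real \<Rightarrow> 'a \<Rightarrow> nat"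
    and u \<beta> k :: real
  assumes S_pos: "\<And>\<sigma>. \<sigma> \<in> S \<Longrightarrow> \<sigma> > 0"
    and prob: "\<And>\<sigma>. \<sigma> \<in> S \<Longrightarrow> prob_space (M \<sigma>)"
    and sub: "\<And>\<sigma>. \<sigma> \<in> S \<Longrightarrow> subalgebra (M \<sigma>) (F \<sigma>)"
    and W_meas: "\<And>\<sigma>. \<sigma> \<in> S \<Longrightarrow> W \<sigma> \<in> measurable (M \<sigma>) (count_space UNIV)"
    and Y_meas: "\<And>\<sigma>. \<sigma> \<in> S \<Longrightarrow> Y \<sigma> \<in> measurable (M \<sigma>) (count_space UNIV)"
    and Z_meas: "\<And>\<sigma> i. \<sigma> \<in> S \<Longrightarrow> Z \<sigma> i \<in> measurable (M \<sigma>) (count_space UNIV)"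
    and N_meas: "\<And>\<sigma>. \<sigma> \<in> S \<Longrightarrow> N \<sigma> \<in> measurable (F \<sigma>) (count_space UNIV)"
    and var: "\<And>\<sigma>. \<sigma> \<in> S \<Longrightarrow>
       prob_space.variance (M \<sigma>) (\<lambda>\<omega>. real_of_int (W \<sigma> \<omega>)) = \<sigma>\<^sup>2"
    and decomp: "\<And>\<sigma> \<omega>. \<sigma> \<in> S \<Longrightarrow> \<omega> \<in> space (M \<sigma>) \<Longrightarrow>
       W \<sigma> \<omega> = Y \<sigma> \<omega> + (\<Sum>i=1..N \<sigma> \<omega>. Z \<sigma> i \<omega>)"
    and cindep: "\<And>\<sigma> n. \<sigma> \<in> S \<Longrightarrow>
       cond_indep_on (M \<sigma>) (F \<sigma>) {\<omega> \<in> space (M \<sigma>). N \<sigma> \<omega> = n}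
         (\<lambda>i. if i = 0 then Y \<sigma> else Z \<sigma> i) n"
    and u_pos: "0 < u"
    and \<beta>_pos: "0 < \<beta>"
    and smooth: "\<And>\<sigma>. \<sigma> \<in> S \<Longrightarrow>
       AE \<omega> in M \<sigma>. \<forall>i\<in>{1..N \<sigma> \<omega>}.
          u \<le> 1 - D1_df (cond_df (M \<sigma>) (F \<sigma>) (Z \<sigma> i) \<omega>) / 2"
    and k_ge: "k \<ge> 1"
    and tail: "(\<lambda>\<sigma>. measure (M \<sigma>) {\<omega> \<in> space (M \<sigma>). real (N \<sigma> \<omega>) < \<beta> * \<sigma>\<^sup>2})
       \<in> O[at_top \<sqinter> principal S](\<lambda>\<sigma>. \<sigma> powr (- k))"
  defines "EW \<equiv> \<lambda>\<sigma>. integral\<^sup>L (M \<sigma>) (\<lambda>\<omega>. real_of_int (W \<sigma> \<omega>))"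
    and "Wt \<equiv> \<lambda>\<sigma> \<omega>. (real_of_int (W \<sigma> \<omega>) - integral\<^sup>L (M \<sigma>) (\<lambda>\<omega>. real_of_int (W \<sigma> \<omega>))) / \<sigma>"
  shows "(k \<ge> 2 \<longrightarrow>
      (\<lambda>\<sigma>. dloc_df (int_df (M \<sigma>) (W \<sigma>)) (TP_df (EW \<sigma>) (\<sigma>\<^sup>2)))
        \<in> O[at_top \<sqinter> principal S](\<lambda>\<sigma>. dK_df (real_df (M \<sigma>) (Wt \<sigma>)) Phi powr (1 - 1 / k) / \<sigma>)
    \<and> (\<lambda>\<sigma>. dloc_df (int_df (M \<sigma>) (W \<sigma>)) (TP_df (EW \<sigma>) (\<sigma>\<^sup>2)))
        \<in> O[at_top \<sqinter> principal S](\<lambda>\<sigma>. dW_df (real_df (M \<sigma>) (Wt \<sigma>)) Phi powr (1 - 2 / (k + 1)) / \<sigma>))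
   \<and> (\<lambda>\<sigma>. dTV_df (int_df (M \<sigma>) (W \<sigma>)) (TP_df (EW \<sigma>) (\<sigma>\<^sup>2)))
        \<in> O[at_top \<sqinter> principal S](\<lambda>\<sigma>. dW_df (real_df (M \<sigma>) (Wt \<sigma>)) Phi powr (k / (k + 1)))"
proof -
  define CK where "CK = 1 / phi 1 + 6 + 12 * exp 1"
  define aK where "aK = 1 + CK * (4 / phi 1)"
  define aW where "aW = 1 + 15 * (32 / phi 2)"
  define r where "r = nat \<lceil>k\<rceil>"
  \<comment> \<open>A sum, so that one constant serves the differences of orders \<open>r\<close>
    and \<open>r + 1\<close>.\<close>
  define A where "A = smoothing_const u \<beta> r + smoothing_const u \<beta> (Suc r)"
  define DK where "DK \<sigma> = dK_df (real_df (M \<sigma>) (Wt \<sigma>)) Phi" for \<sigma>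
  define DW where "DW \<sigma> = dW_df (real_df (M \<sigma>) (Wt \<sigma>)) Phi" for \<sigma>
  define f where "f \<sigma> = (\<lambda>j. int_df (M \<sigma>) (W \<sigma>) j - TP_df (EW \<sigma>) (\<sigma>\<^sup>2) j)" for \<sigma>
  have r: "k \<le> real r" unfolding r_def using k_ge by linarith
  have CK0: "0 \<le> CK" unfolding CK_def by (intro add_nonneg_nonneg) (auto simp: normal_density_nonneg)
  have sm0: "0 \<le> smoothing_const u \<beta> r" for r unfolding smoothing_const_def using u_pos \<beta>_pos by simp
  have nonneg: "0 \<le> A" "0 \<le> aK" "0 \<le> aW"
    using sm0 CK0 by (auto simp: A_def aK_def aW_def normal_density_nonneg intro!: add_nonneg_nonneg mult_nonneg_nonneg divide_nonneg_nonneg)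
  obtain P0 where P0: "0 < P0" "\<forall>\<^sub>F \<sigma> in at_top \<sqinter> principal S.
     norm (measure (M \<sigma>) {\<omega> \<in> space (M \<sigma>). real (N \<sigma> \<omega>) < \<beta> * \<sigma>\<^sup>2}) \<le> P0 * norm (\<sigma> powr (- k))"
    by (rule landau_o.bigE[OF tail])
  define C where "C = 2 ^ r * (A + P0 + 2 * aK + 2 * aW)"
  define c1 where "c1 = C * rate_const r (phi 1 / 4) (k - 1)"
  define c2 where "c2 = C * (rate_const r (phi 2 / 32) (k - 1) + rate_const r (phi 1 / 4) (k - 1))"
  \<comment> \<open>\<open>smoothing_const u \<beta> 0\<close> equals 2, both of its terms being
    zeroth powers: the trivial bound by total mass.\<close>
  define c3 where "c3 = C * rate_const r (phi 2 / 32) k + (smoothing_const u \<beta> 0 + 1)"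
  have main: "(\<forall>j. \<bar>fdiff (f \<sigma>) j\<bar> \<le> c1 * (DK \<sigma> powr (1 - 1 / k) / \<sigma>))
    \<and> (\<forall>j. \<bar>fdiff (f \<sigma>) j\<bar> \<le> c2 * (DW \<sigma> powr (1 - 2 / (k + 1)) / \<sigma>))
    \<and> (\<forall>n. l1bnd n (c3 * DW \<sigma> powr (k / (k + 1))) (fdiff (f \<sigma>)))"
    if s: "\<sigma> \<in> S" and s1: "1 \<le> \<sigma>"
      and P: "measure (M \<sigma>) {\<omega> \<in> space (M \<sigma>). real (N \<sigma> \<omega>) < \<beta> * \<sigma>\<^sup>2} \<le> P0 * \<sigma> powr (- k)" for \<sigma>
  proof -
    interpret prob_space "M \<sigma>" by (rule prob[OF s])
    interpret prob_subalgebra "M \<sigma>" "F \<sigma>" by unfold_locales (rule sub[OF s])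
    obtain h p where "\<forall>j. fdiff (\<lambda>j. int_df (M \<sigma>) (W \<sigma>) j - TP_df (EW \<sigma>) (\<sigma>\<^sup>2) j) j = h j + p j"
      and hp': "\<forall>r n. 1 \<le> n \<longrightarrow> l1bnd n (smoothing_const u \<beta> r / \<sigma> ^ r) ((fdiff ^^ r) h)"
        "\<forall>n. l1bnd n (measure (M \<sigma>) {\<omega> \<in> space (M \<sigma>). real (N \<sigma> \<omega>) < \<beta> * \<sigma>\<^sup>2}) p"
      by (rule l1bnd_split_df[OF Y_meas[OF s] Z_meas[OF s] W_meas[OF s] N_meas[OF s] decomp[OF s] cindep[OF s]
          smooth[OF s] u_pos \<beta>_pos s1, of "EW \<sigma>"])
    then have hp1: "fdiff (f \<sigma>) j = h j + p j" for j by (simp only: f_def)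
    note hp = hp1 hp'(1)[rule_format] hp'(2)[rule_format]
    have W': "(\<lambda>\<omega>. real_of_int (W \<sigma> \<omega>)) \<in> borel_measurable (M \<sigma>)"
      using W_meas[OF s] by measurable
    have int: "integrable (M \<sigma>) (\<lambda>\<omega>. real_of_int (W \<sigma> \<omega>))"
      by (rule integrable_if_variance[OF W']) (use var[OF s] s1 in simp)
    note cmp = lattice_comparison[OF W_meas[OF s] int s1, where \<mu> = "EW \<sigma>"]
    have Wt: "Wt \<sigma> = (\<lambda>\<omega>. (real_of_int (W \<sigma> \<omega>) - EW \<sigma>) / \<sigma>)"
      by (simp add: Wt_def EW_def)
    have low: "phi 1 / 4 / \<sigma> \<le> DK \<sigma>" "phi 2 / 32 / \<sigma> \<le> DW \<sigma>"
      unfolding DK_def DW_def Wt by (rule cmp(1), rule cmp(2))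
    have fb: "l1bnd 1 (aK * DK \<sigma>) (f \<sigma>)" "l1bnd n (\<sigma> * (aW * DW \<sigma>)) (f \<sigma>)" for n
      unfolding DK_def DW_def Wt f_def aK_def aW_def CK_def by (rule cmp(3), rule cmp(4))
    have DK1: "DK \<sigma> \<le> 1" unfolding DK_def by (rule dK_df_bounds)
    have hr: "l1bnd n (A / \<sigma> ^ r) ((fdiff ^^ r) h)" "l1bnd n (A / \<sigma> ^ Suc r) ((fdiff ^^ Suc r) h)"
      "l1bnd n (smoothing_const u \<beta> 0) h" if "1 \<le> n" for n
      using l1bnd_mono[OF hp(2)[OF that, of r], of "A / \<sigma> ^ r"] hp(2)[OF that, of 0]
        l1bnd_mono[OF hp(2)[OF that, of "Suc r"], of "A / \<sigma> ^ Suc r"] sm0 s1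
      by (auto simp: A_def divide_right_mono simp del: funpow.simps(2))
    have pos: "0 < phi 1 / 4" "0 < phi 2 / 32" by simp_all
    note R = rates_of_convergence[OF s1 k_ge r hp(1) hr(3) hr(1) hr(2) hp(3) P prob_le_1 fb(1) fb(2)
        pos(1) low(1) DK1 pos(2) low(2) nonneg(1) less_imp_le[OF P0(1)] nonneg(2,3), folded C_def]
    show ?thesis unfolding c1_def c2_def c3_def by (intro conjI allI R)
  qed
  have ev: "\<forall>\<^sub>F \<sigma> in at_top \<sqinter> principal S. \<sigma> \<in> S \<and> 1 \<le> \<sigma> \<and>
      measure (M \<sigma>) {\<omega> \<in> space (M \<sigma>). real (N \<sigma> \<omega>) < \<beta> * \<sigma>\<^sup>2} \<le> P0 * \<sigma> powr (- k)"
  proof -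
    have "\<forall>\<^sub>F \<sigma> in at_top \<sqinter> principal S. \<sigma> \<in> S \<and> 1 \<le> \<sigma>"
      unfolding eventually_inf_principal using eventually_ge_at_top[of 1] by eventually_elim simp
    with P0(2) show ?thesis by eventually_elim simp
  qed
  have diff: "fdiff (int_df (M \<sigma>) (W \<sigma>)) j - fdiff (TP_df (EW \<sigma>) (\<sigma>\<^sup>2)) j = fdiff (f \<sigma>) j" for \<sigma> j
    by (simp add: fdiff_def f_def)
  have dloc: "norm (dloc_df (int_df (M \<sigma>) (W \<sigma>)) (TP_df (EW \<sigma>) (\<sigma>\<^sup>2))) \<le> c"
    if "\<forall>j. \<bar>fdiff (f \<sigma>) j\<bar> \<le> c" for \<sigma> c
  proof -
    have "(SUP j. \<bar>fdiff (f \<sigma>) j\<bar>) \<le> c" by (rule cSUP_least) (use that in auto)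
    \<comment> \<open>A real supremum is meaningful only for a bounded family; \<open>c\<close>
      serves as that bound as well as the estimate.\<close>
    moreover have "0 \<le> (SUP j. \<bar>fdiff (f \<sigma>) j\<bar>)"
      by (rule cSUP_upper2[of _ _ 0]) (use that in \<open>auto intro!: bdd_aboveI2[where M = c]\<close>)
    ultimately show ?thesis unfolding dloc_df_def diff by simp
  qed
  have "(\<lambda>\<sigma>. dloc_df (int_df (M \<sigma>) (W \<sigma>)) (TP_df (EW \<sigma>) (\<sigma>\<^sup>2)))
        \<in> O[at_top \<sqinter> principal S](\<lambda>\<sigma>. dK_df (real_df (M \<sigma>) (Wt \<sigma>)) Phi powr (1 - 1 / k) / \<sigma>)"
    by (rule bigoI[of _ c1], rule eventually_mono[OF ev]) (use dloc main in \<open>simp add: DK_def\<close>)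
  moreover have "(\<lambda>\<sigma>. dloc_df (int_df (M \<sigma>) (W \<sigma>)) (TP_df (EW \<sigma>) (\<sigma>\<^sup>2)))
        \<in> O[at_top \<sqinter> principal S](\<lambda>\<sigma>. dW_df (real_df (M \<sigma>) (Wt \<sigma>)) Phi powr (1 - 2 / (k + 1)) / \<sigma>)"
    by (rule bigoI[of _ c2], rule eventually_mono[OF ev]) (use dloc main in \<open>simp add: DW_def\<close>)
  moreover have "(\<lambda>\<sigma>. dTV_df (int_df (M \<sigma>) (W \<sigma>)) (TP_df (EW \<sigma>) (\<sigma>\<^sup>2)))
        \<in> O[at_top \<sqinter> principal S](\<lambda>\<sigma>. dW_df (real_df (M \<sigma>) (Wt \<sigma>)) Phi powr (k / (k + 1)))"
  proof (rule bigoI[of _ c3], use ev in eventually_elim)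
    case (elim \<sigma>)
    have "(\<Sum>\<^sub>\<infinity>j. \<bar>fdiff (f \<sigma>) j\<bar>) \<le> c3 * DW \<sigma> powr (k / (k + 1))"
      using main[of \<sigma>] elim by (intro infsum_le_if_l1bnd) auto
    moreover have "0 \<le> (\<Sum>\<^sub>\<infinity>j. \<bar>fdiff (f \<sigma>) j\<bar>)" by (intro infsum_nonneg) auto
    ultimately show ?case unfolding dTV_df_def diff by (simp add: DW_def)
  qed
  ultimately show ?thesis by blast
qed

end
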